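(* Let $d\ge 1$, $\alpha>2$, $\rho\in(0,1)$. Let $p$ be a long asymmetric range (LA) jump probability on $\mathbb{Z}^d$ with exponent $\alpha$ and let $p^{(FR)}$ be a finite-range jump probability on $\mathbb{Z}^d$ whose symmetric part is irreducible. Suppose there is a constant $c_*\neq 0$ such that $\sum_y y\,p(y)=c_*\sum_y y\,p^{(FR)}(y)$. Let $f$ be a local function with $\mathbb{E}_\rho[f]=0$. Then $L_f(\lambda)\approx L_f^{(FR)}(\lambda)$ as $\lambda\downarrow 0$, where $L_f$ and $L_f^{(FR)}$ are the Laplace transforms of the additive functional variances for the exclusion processes with jump probability $p$ and $p^{(FR)}$ respectively, both started from $\nu_\rho$.
   Context: Exclusion process: given a jump probability $q$ on $\mathbb{Z}^d$ with $q(0)=0$, it is the Markov process $\eta_t$ on $\Omega=\{0,1\}^{\mathbb{Z}^d}$ whose generator acts on local functions (functions depending on finitely many coordinates) by $\mathcal{L}f(\eta)=\sum_{x,y\in\mathbb{Z}^d}q(y)\eta(x)(1-\eta(x+y))[f(\eta^{x,x+y})-f(\eta)]$, where $\eta^{x,x+y}$ is $\eta$ with the values at $x$ and $x+y$ exchanged. The Bernoulli product measure $\nu_\rho$ of density $\rho$ is invariant; $\mathbb{E}_\rho$ denotes expectation under $\nu_\rho$ and under the process started from $\nu_\rho$. Set $\Gamma_f(t)=\int_0^t f(\eta_s)ds$, $\sigma_t^2(f)=\mathbb{E}_\rho[\Gamma_f(t)^2]$, $L_f(\lambda)=\int_0^\infty e^{-\lambda t}\sigma_t^2(f)dt$ for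 $\lambda>0$. (LA) jump probability with exponent $\alpha$: $p(0)=0$ and $p(y)=\frac{c}{|y|^{d+\alpha}}\sum_{i=1}^d\big(b_i^+\mathbf{1}_{y_i>0}+b_i^-\mathbf{1}_{y_i<0}\big)$ for $y\ne0$, with constants $b_i^\pm>0$, $\sum_{i=1}^d|b_i^+-b_i^-|>0$, and normalization constant $c$. Finite-range jump probability: $p^{(FR)}(y)=0$ for $|y|>R$, some $R<\infty$, and $p^{(FR)}(0)=0$; its symmetric part is $y\mapsto (p^{(FR)}(y)+p^{(FR)}(-y))/2$. $a(\lambda)\approx b(\lambda)$ as $\lambda\downarrow0$ means: there is a constant $C\in(0,\infty)$ with $C^{-1}b(\lambda)\le a(\lambda)\le C\,b(\lambda)$ for all sufficiently small $\lambda>0$. *)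

theory Defs
  imports "HOL-Probability.Probability"
begin

text \<open>The lattice \<open>\<int>\<^sup>d\<close> is the type \<open>int ^ 'd\<close>. It carries no norm, so that lengths and means
  are taken after embedding it into \<open>real ^ 'd\<close>; lengths are Euclidean.\<close>

definition lattice_embed :: "int ^ 'd \<Rightarrow> real ^ 'd" where
  "lattice_embed y = (\<chi> i. real_of_int (y $ i))"


section \<open>Jump probabilities\<close>

definition jump_probability :: "(int ^ 'd \<Rightarrow> real) \<Rightarrow> bool" where
  "jump_probability q \<longleftrightarrow> (\<forall>y. 0 \<le> q y) \<and> (q has_sum 1) UNIV \<and> q 0 = 0"

definition LA_jump_probability :: "real \<Rightarrow> (int ^ 'd \<Rightarrow> real) \<Rightarrow> bool" where
  "LA_jump_probability \<alpha> p \<longleftrightarrow> jump_probability p \<and>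
     (\<exists>(c :: real) (bp :: 'd \<Rightarrow> real) (bm :: 'd \<Rightarrow> real).
        (\<forall>i. 0 < bp i \<and> 0 < bm i) \<and> 0 < (\<Sum>i\<in>UNIV. \<bar>bp i - bm i\<bar>) \<and>
        (\<forall>y. y \<noteq> 0 \<longrightarrow>
           p y = c / norm (lattice_embed y) powr (real CARD('d) + \<alpha>) *
             (\<Sum>i\<in>UNIV. bp i * of_bool (0 < y $ i) + bm i * of_bool (y $ i < 0))))"

definition FR_jump_probability :: "(int ^ 'd \<Rightarrow> real) \<Rightarrow> bool" where
  "FR_jump_probability q \<longleftrightarrow> jump_probability q \<and>
     (\<exists>R :: real. \<forall>y. R < norm (lattice_embed y) \<longrightarrow> q y = 0)"

definition symmetric_part :: "(int ^ 'd \<Rightarrow> real) \<Rightarrow> int ^ 'd \<Rightarrow> real" where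
  "symmetric_part q y = (q y + q (- y)) / 2"

text \<open>Irreducibility of the random walk with step distribution \<open>q\<close>.\<close>

definition irreducible_jumps :: "(int ^ 'd \<Rightarrow> real) \<Rightarrow> bool" where
  "irreducible_jumps q \<longleftrightarrow> (\<forall>x y. (x, y) \<in> {(u, v). 0 < q (v - u)}\<^sup>*)"

definition mean_jump :: "(int ^ 'd \<Rightarrow> real) \<Rightarrow> real ^ 'd" where
  "mean_jump q = (\<Sum>\<^sub>\<infinity>y. q y *\<^sub>R lattice_embed y)"


section \<open>Configurations\<close>

text \<open>\<open>\<eta> x = True\<close> means that the site \<open>x\<close> is occupied. The topology on configurations is the
  product of the discrete topologies, so that \<open>'d config \<Rightarrow>\<^sub>C real\<close> with its supremum norm is the
  space of continuous functions on the compact space of configurations.\<close>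

type_synonym 'd config = "int ^ 'd \<Rightarrow> bool"

definition exchange :: "'d config \<Rightarrow> int ^ 'd \<Rightarrow> int ^ 'd \<Rightarrow> 'd config" where
  "exchange \<eta> x z = \<eta>(x := \<eta> z, z := \<eta> x)"

definition local_function :: "('d config \<Rightarrow> real) \<Rightarrow> bool" where
  "local_function f \<longleftrightarrow>
     (\<exists>A. finite A \<and> (\<forall>\<eta> \<xi>. (\<forall>x\<in>A. \<eta> x = \<xi> x) \<longrightarrow> f \<eta> = f \<xi>))"

definition bernoulli_product :: "real \<Rightarrow> ('d config) measure" where
  "bernoulli_product \<rho> = PiM UNIV (\<lambda>_. measure_pmf (bernoulli_pmf \<rho>))"

abbreviation config_algebra :: "('d config) measure" where
  "config_algebra \<equiv> PiM UNIV (\<lambda>_. count_space UNIV)"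


section \<open>The exclusion process\<close>

text \<open>For a local function \<open>f\<close> the sum below converges absolutely.\<close>

definition exclusion_operator ::
    "(int ^ 'd \<Rightarrow> real) \<Rightarrow> ('d config \<Rightarrow> real) \<Rightarrow> 'd config \<Rightarrow> real" where
  "exclusion_operator q f \<eta> =
     (\<Sum>\<^sub>\<infinity>(x, y). q y * of_bool (\<eta> x) * (1 - of_bool (\<eta> (x + y))) *
        (f (exchange \<eta> x (x + y)) - f \<eta>))"

definition markov_semigroup ::
    "(real \<Rightarrow> ('d config \<Rightarrow>\<^sub>C real) \<Rightarrow> ('d config \<Rightarrow>\<^sub>C real)) \<Rightarrow> bool" where
  "markov_semigroup S \<longleftrightarrow>
     (\<forall>t\<ge>0. linear (S t)) \<and>
     (\<forall>f. S 0 f = f) \<and>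
     (\<forall>s\<ge>0. \<forall>t\<ge>0. \<forall>f. S (s + t) f = S s (S t f)) \<and>
     (\<forall>f. ((\<lambda>t. S t f) \<longlongrightarrow> f) (at_right 0)) \<and>
     (\<forall>t\<ge>0. S t (const_bcontfun 1) = const_bcontfun 1) \<and>
     (\<forall>t\<ge>0. \<forall>f. (\<forall>\<eta>. 0 \<le> apply_bcontfun f \<eta>) \<longrightarrow> (\<forall>\<eta>. 0 \<le> apply_bcontfun (S t f) \<eta>))"

text \<open>The generator as the graph of a partial operator.\<close>

definition generator :: "(real \<Rightarrow> 'b \<Rightarrow> 'b) \<Rightarrow> ('b \<times> 'b :: real_normed_vector) set" where
  "generator S = {(f, g). ((\<lambda>t. (S t f - f) /\<^sub>R t) \<longlongrightarrow> g) (at_right 0)}"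

text \<open>The generator is prescribed on local functions only. This determines the semigroup, as the
  closure of the exclusion operator on local functions is already the generator of a Markov
  semigroup (Liggett, Interacting Particle Systems, Theorem I.3.9).\<close>

definition exclusion_semigroup ::
    "(int ^ 'd \<Rightarrow> real) \<Rightarrow> (real \<Rightarrow> ('d config \<Rightarrow>\<^sub>C real) \<Rightarrow> ('d config \<Rightarrow>\<^sub>C real)) \<Rightarrow> bool" where
  "exclusion_semigroup q S \<longleftrightarrow> markov_semigroup S \<and>
     (\<forall>f. local_function (apply_bcontfun f) \<longrightarrow>
        (\<exists>g. (f, g) \<in> generator S \<and> apply_bcontfun g = exclusion_operator q (apply_bcontfun f)))"

definition history :: "'w measure \<Rightarrow> (real \<Rightarrow> 'w \<Rightarrow> 'd config) \<Rightarrow> real \<Rightarrow> 'w measure" where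
  "history M X s = sigma (space M)
     {X u -` B \<inter> space M | u B. 0 \<le> u \<and> u \<le> s \<and> B \<in> sets config_algebra}"

text \<open>A realization on the probability space \<open>M\<close>, with right-continuous paths having left limits,
  of the exclusion process with jump probability \<open>q\<close> and initial distribution \<open>\<mu>\<close>. Only times
  \<open>t \<ge> 0\<close> matter.\<close>

definition exclusion_process ::
    "(int ^ 'd \<Rightarrow> real) \<Rightarrow> ('d config) measure \<Rightarrow> 'w measure \<Rightarrow> (real \<Rightarrow> 'w \<Rightarrow> 'd config) \<Rightarrow> bool"
  where
  "exclusion_process q \<mu> M X \<longleftrightarrow>
     prob_space M \<and>
     (\<forall>t\<ge>0. X t \<in> measurable M config_algebra) \<and>
     (\<forall>\<omega>\<in>space M. \<forall>t\<ge>0. ((\<lambda>s. X s \<omega>) \<longlongrightarrow> X t \<omega>) (at_right t)) \<and>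
     (\<forall>\<omega>\<in>space M. \<forall>t>0. \<exists>\<xi>. ((\<lambda>s. X s \<omega>) \<longlongrightarrow> \<xi>) (at_left t)) \<and>
     distr M \<mu> (X 0) = \<mu> \<and>
     (\<exists>S. exclusion_semigroup q S \<and>
        (\<forall>s\<ge>0. \<forall>t\<ge>0. \<forall>f :: 'd config \<Rightarrow>\<^sub>C real.
           AE \<omega> in M. real_cond_exp M (history M X s) (\<lambda>\<omega>'. apply_bcontfun f (X (s + t) \<omega>')) \<omega> =
             apply_bcontfun (S t f) (X s \<omega>)))"


section \<open>Additive functionals\<close>

definition additive_functional ::
    "(real \<Rightarrow> 'w \<Rightarrow> 'd config) \<Rightarrow> ('d config \<Rightarrow> real) \<Rightarrow> real \<Rightarrow> 'w \<Rightarrow> real" where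
  "additive_functional X f t \<omega> = (LINT s:{0..t}|lborel. f (X s \<omega>))"

definition additive_variance ::
    "'w measure \<Rightarrow> (real \<Rightarrow> 'w \<Rightarrow> 'd config) \<Rightarrow> ('d config \<Rightarrow> real) \<Rightarrow> real \<Rightarrow> real" where
  "additive_variance M X f t = (LINT \<omega>|M. (additive_functional X f t \<omega>)\<^sup>2)"

definition variance_laplace ::
    "'w measure \<Rightarrow> (real \<Rightarrow> 'w \<Rightarrow> 'd config) \<Rightarrow> ('d config \<Rightarrow> real) \<Rightarrow> real \<Rightarrow> real" where
  "variance_laplace M X f l = (LINT t:{0..}|lborel. exp (- l * t) * additive_variance M X f t)"

definition comparable_at_0 :: "(real \<Rightarrow> real) \<Rightarrow> (real \<Rightarrow> real) \<Rightarrow> bool" where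
  "comparable_at_0 a b \<longleftrightarrow>
     (\<exists>C>0. \<forall>\<^sub>F l in at_right 0. inverse C * b l \<le> a l \<and> a l \<le> C * b l)"

end

theory Submission
  imports Defs
begin

text \<open>Let \<open>G\<close> and \<open>G'\<close> be the two generators. The Laplace transform of the variance is
  \<open>2 / l\<^sup>2\<close> times \<open>E (f g)\<close>, where \<open>(l - G) g = f\<close>. Local functions \<open>g\<close> solve this equation up to
  a uniformly small error: in a finite box the equation is solved by iteration, and weighted
  variations of the iterates stay bounded independently of the box. If the means are proportional
  with factor \<open>c\<close>, the part of \<open>G - c G'\<close> that is linear in the jump cancels. Decomposing a jump \<open>y\<close>
  dyadically into triangles, one controls the rest by \<open>|y|\<^sup>2\<close> times the square roots of the two
  Dirichlet energies; second moments are finite because \<open>\<alpha> > 2\<close>. Hence \<open>G - c G'\<close> is bounded with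
  respect to the energies, and testing the equation for the difference of two resolvents with this
  difference compares them. If \<open>c < 0\<close>, the law \<open>p\<close> is first reversed: this replaces \<open>G\<close> by its
  adjoint, which has the same resolvent form.\<close>

text \<open>In the form \<open>E (h G g)\<close> each bond contributes a part even and a part odd in
  its direction. The even part is bounded by the energies; for the odd part no such bound is
  available, so neither generator is treated alone. What rescues the comparison is that the odd
  part, summed over translates of a bond and viewed as a function of the jump, is nearly additive:
  the three currents around a triangle of sites cancel. A nearly additive function on the lattice is
  nearly linear, and averaging a linear function over a jump law only sees the mean. Since \<alpha>
  > 2 is used only through second moments, the deviation from linearity must grow no faster than the
  square of the jump. The semigroups are known only through their generators on local functions. The
  resolvent therefore never occurs as an operator; sequences of local functions with uniformly
  vanishing residual stand for it. This keeps sums over bonds finite for each fixed jump, and the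
  sup bound from the maximum principle lets the residuals vanish in expectations.\<close>

definition local_on :: "((int, 'd) vec) set \<Rightarrow> ('d config \<Rightarrow> real) \<Rightarrow> bool" where
  "local_on A g \<longleftrightarrow> finite A \<and> (\<forall>\<eta> \<xi>. (\<forall>x\<in>A. \<eta> x = \<xi> x) \<longrightarrow> g \<eta> = g \<xi>)"

section \<open>Closure properties of local functions\<close>

lemma local_functionE:
  assumes "local_function g" obtains A where "local_on A g"
  using assms unfolding local_function_def local_on_def by blast

lemma local_onD: "local_on A g \<Longrightarrow> (\<And>x. x \<in> A \<Longrightarrow> \<eta> x = \<xi> x) \<Longrightarrow> g \<eta> = g \<xi>"
  unfolding local_on_def by blast

lemma local_on_finite: "local_on A g \<Longrightarrow> finite A"
  by (simp add: local_on_def)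

lemma local_on_imp_local: "local_on A g \<Longrightarrow> local_function g"
  unfolding local_function_def local_on_def by blast

lemma local_on_mono: "local_on A g \<Longrightarrow> A \<subseteq> B \<Longrightarrow> finite B \<Longrightarrow> local_on B g"
  unfolding local_on_def by blast

lemma local_function_const [intro, simp]: "local_function (\<lambda>_. c)"
  by (auto simp: local_function_def)

lemma local_function_site [intro, simp]: "local_function (\<lambda>\<eta>. of_bool (\<eta> x))"
  unfolding local_function_def by (rule exI[of _ "{x}"]) auto

lemma local_on_comp2:
  assumes "local_on A g" "local_on B h"
  shows "local_on (A \<union> B) (\<lambda>\<eta>. F (g \<eta>) (h \<eta>))"
  unfolding local_on_def
proof (intro conjI allI impI)
  show "finite (A \<union> B)" using assms by (simp add: local_on_def)
  fix \<eta> \<xi> :: "'a config" assume eq: "\<forall>u\<in>A \<union> B. \<eta> u = \<xi> u"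
  have "g \<eta> = g \<xi>" by (rule local_onD[OF assms(1)]) (use eq in blast)
  moreover have "h \<eta> = h \<xi>" by (rule local_onD[OF assms(2)]) (use eq in blast)
  ultimately show "F (g \<eta>) (h \<eta>) = F (g \<xi>) (h \<xi>)" by simp
qed

lemma local_function_comp2:
  "local_function g \<Longrightarrow> local_function h \<Longrightarrow> local_function (\<lambda>\<eta>. F (g \<eta>) (h \<eta>))"
  by (elim local_functionE, rule local_on_imp_local, rule local_on_comp2)

lemma local_function_comp: "local_function g \<Longrightarrow> local_function (\<lambda>\<eta>. F (g \<eta>))"
  by (rule local_function_comp2[where F = "\<lambda>v _. F v"])

lemma local_function_add [intro, simp]:
  "local_function g \<Longrightarrow> local_function h \<Longrightarrow> local_function (\<lambda>\<eta>. g \<eta> + h \<eta>)"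
  by (rule local_function_comp2[where F = "(+)"])

lemma local_function_diff [intro, simp]:
  "local_function g \<Longrightarrow> local_function h \<Longrightarrow> local_function (\<lambda>\<eta>. g \<eta> - h \<eta>)"
  by (rule local_function_comp2[where F = "(-)"])

lemma local_function_mult [intro, simp]:
  "local_function g \<Longrightarrow> local_function h \<Longrightarrow> local_function (\<lambda>\<eta>. g \<eta> * h \<eta>)"
  by (rule local_function_comp2[where F = "(*)"])

lemma local_function_divide [intro, simp]:
  "local_function g \<Longrightarrow> local_function (\<lambda>\<eta>. g \<eta> / c)"
  by (rule local_function_comp[where F = "\<lambda>v. v / c"])

lemma local_function_uminus [intro, simp]:
  "local_function g \<Longrightarrow> local_function (\<lambda>\<eta>. - g \<eta>)"
  by (rule local_function_comp[where F = "uminus"])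

lemma local_function_power [intro, simp]:
  "local_function g \<Longrightarrow> local_function (\<lambda>\<eta>. g \<eta> ^ n)"
  by (rule local_function_comp[where F = "\<lambda>v. v ^ n"])

lemma local_function_sum [intro, simp]:
  assumes "\<And>i. i \<in> I \<Longrightarrow> local_function (g i)"
  shows "local_function (\<lambda>\<eta>. \<Sum>i\<in>I. g i \<eta>)"
proof (cases "finite I")
  case True
  then show ?thesis using assms by (induction I) auto
qed auto

section \<open>Exchanging the contents of two sites\<close>

lemma exchange_apply:
  "exchange \<eta> x z u = (if u = z then \<eta> x else if u = x then \<eta> z else \<eta> u)"
  by (simp add: exchange_def)

lemma exchange_same [simp]: "exchange \<eta> x x = \<eta>"
  by (simp add: exchange_def)

lemma exchange_commute: "exchange \<eta> x z = exchange \<eta> z x"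
  by (auto simp: exchange_def fun_eq_iff)

lemma exchange_exchange [simp]: "exchange (exchange \<eta> x z) x z = \<eta>"
  by (auto simp: exchange_def fun_eq_iff)

lemma exchange_eq_same: "\<eta> x = \<eta> z \<Longrightarrow> exchange \<eta> x z = \<eta>"
  by (auto simp: exchange_def fun_eq_iff)

lemma local_on_exchange:
  assumes "local_on A g" shows "local_on (A \<union> {x, z}) (\<lambda>\<eta>. g (exchange \<eta> x z))"
  unfolding local_on_def
proof (intro conjI allI impI)
  show "finite (A \<union> {x, z})" using assms by (simp add: local_on_def)
  fix \<eta> \<xi> :: "'a config" assume "\<forall>u\<in>A \<union> {x, z}. \<eta> u = \<xi> u"
  then show "g (exchange \<eta> x z) = g (exchange \<xi> x z)"
    by (intro local_onD[OF assms]) (auto simp: exchange_apply)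
qed

lemma local_function_exchange [intro, simp]:
  "local_function g \<Longrightarrow> local_function (\<lambda>\<eta>. g (exchange \<eta> x z))"
  by (elim local_functionE, rule local_on_imp_local, rule local_on_exchange)

lemma local_on_exchange_outside:
  "local_on A g \<Longrightarrow> x \<notin> A \<Longrightarrow> z \<notin> A \<Longrightarrow> g (exchange \<eta> x z) = g \<eta>"
  by (rule local_onD) (auto simp: exchange_apply)

text \<open>Expansion into indicators of cylinders: the product singles out the one \<open>B\<close>
  that agrees with the occupied sites in \<open>A\<close>. Measurability and continuity of local
  functions are both read off from it.\<close>

lemma local_on_representation:
  assumes "local_on A g"
  shows "g \<eta> = (\<Sum>B\<in>Pow A. g (\<lambda>x. x \<in> B) * (\<Prod>x\<in>A. of_bool (\<eta> x = (x \<in> B))))"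
proof -
  have fin: "finite A" using assms by (simp add: local_on_def)
  let ?B = "{x \<in> A. \<eta> x}"
  have "(\<Prod>x\<in>A. of_bool (\<eta> x = (x \<in> B))) = (of_bool (B = ?B) :: real)" if B: "B \<in> Pow A" for B
  proof (cases "B = ?B")
    case False
    then obtain x where "x \<in> A" "\<eta> x \<noteq> (x \<in> B)" using B by blast
    then have "(\<Prod>x\<in>A. of_bool (\<eta> x = (x \<in> B))) = (0::real)"
      using fin by (intro prod_zero) auto
    then show ?thesis using False by simp
  next
    case True
    have "(\<Prod>x\<in>A. of_bool (\<eta> x = (x \<in> B))) = (1::real)"
      by (intro prod.neutral) (use True in auto)
    then show ?thesis using True by simp
  qed
  then have "(\<Sum>B\<in>Pow A. g (\<lambda>x. x \<in> B) * (\<Prod>x\<in>A. of_bool (\<eta> x = (x \<in> B))))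
      = (\<Sum>B\<in>Pow A. g (\<lambda>x. x \<in> B) * of_bool (B = ?B))"
    by (intro sum.cong) auto
  also have "\<dots> = (\<Sum>B\<in>Pow A. if B = ?B then g (\<lambda>x. x \<in> B) else 0)"
    by (intro sum.cong) auto
  also have "\<dots> = g (\<lambda>x. x \<in> ?B)" using fin by (subst sum.delta) auto
  also have "\<dots> = g \<eta>" by (rule local_onD[OF assms]) auto
  finally show ?thesis by simp
qed

text \<open>The value only depends on which of the finitely many sites of the support are occupied.
  Besides boundedness this gives an attained maximum, which the maximum principle relies on.\<close>

lemma local_function_finite_range:
  assumes "local_function g" shows "finite (range g)"
proof -
  obtain A where A: "local_on A g" using assms by (rule local_functionE)
  have "g \<eta> = g (\<lambda>x. x \<in> {x \<in> A. \<eta> x})" for \<eta>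
    by (rule local_onD[OF A]) auto
  then have "range g \<subseteq> (\<lambda>B. g (\<lambda>x. x \<in> B)) ` Pow A" by blast
  then show ?thesis
    using A by (meson finite_Pow_iff finite_imageI finite_subset local_on_finite)
qed

lemma local_function_bounded:
  assumes "local_function g" obtains C where "0 < C" "\<And>\<eta>. \<bar>g \<eta>\<bar> \<le> C"
proof -
  have "bounded (range g)" using local_function_finite_range[OF assms] by (rule finite_imp_bounded)
  then obtain C where "\<And>\<eta>. \<bar>g \<eta>\<bar> \<le> C" by (auto simp: bounded_real)
  then have "\<bar>g \<eta>\<bar> \<le> \<bar>C\<bar> + 1" for \<eta> using order_trans[of "\<bar>g \<eta>\<bar>" C "\<bar>C\<bar> + 1"] by auto
  then show ?thesis by (intro that[of "\<bar>C\<bar> + 1"]) auto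
qed

lemma local_function_measurable:
  assumes "local_function g" shows "g \<in> borel_measurable config_algebra"
proof -
  obtain A where A: "local_on A g" using assms by (rule local_functionE)
  have "(\<lambda>\<eta>. \<Sum>B\<in>Pow A. g (\<lambda>x. x \<in> B) * (\<Prod>x\<in>A. of_bool (\<eta> x = (x \<in> B))))
      \<in> borel_measurable config_algebra"
    by measurable
  then show ?thesis by (simp flip: local_on_representation[OF A])
qed

lemma local_function_continuous:
  assumes "local_function g" shows "continuous_on UNIV g"
proof -
  obtain A where A: "local_on A g" using assms by (rule local_functionE)
  have "continuous_on UNIV (\<lambda>\<eta>::'a config. of_bool (\<eta> x = b) :: real)" for x b
  proof -
    have "continuous_on UNIV ((\<lambda>c. of_bool (c = b) :: real) \<circ> (\<lambda>\<eta>::'a config. \<eta> x))"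
      by (intro continuous_on_compose continuous_on_product_coordinates)
         (simp add: continuous_on_open_vimage Topological_Spaces.open_discrete)
    then show ?thesis by (simp add: o_def)
  qed
  then have "continuous_on UNIV
      (\<lambda>\<eta>. \<Sum>B\<in>Pow A. g (\<lambda>x. x \<in> B) * (\<Prod>x\<in>A. of_bool (\<eta> x = (x \<in> B))))"
    by (intro continuous_intros)
  then show ?thesis by (simp flip: local_on_representation[OF A])
qed

lemma local_function_bcontfun: "local_function g \<Longrightarrow> g \<in> bcontfun"
  by (metis bcontfun_normI local_function_bounded local_function_continuous real_norm_def)


section \<open>Exchangeable measures\<close>

text \<open>Everything about the stationary measure goes through its invariance under exchanging the
  contents of two sites; this alone yields the integrations by parts below.\<close>

locale exchangeable = prob_space \<mu> for \<mu> :: "('d::finite config) measure" +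
  assumes sets_eq: "sets \<mu> = sets config_algebra"
    and exchange_invariant: "\<And>x z. distr \<mu> \<mu> (\<lambda>\<eta>. exchange \<eta> x z) = \<mu>"

lemma exchange_measurable:
  "(\<lambda>\<eta>. exchange \<eta> x z) \<in> measurable config_algebra config_algebra"
proof (rule measurable_PiM_single')
  show "(\<lambda>\<eta>. exchange \<eta> x z) \<in> space config_algebra \<rightarrow> (\<Pi>\<^sub>E i\<in>UNIV. space (count_space UNIV))"
    by auto
qed (auto simp: exchange_apply)

text \<open>An exchange of two sites reindexes the factors of the product by a transposition, and
  all factors are equal.\<close>

lemma exchangeable_bernoulli: "exchangeable (bernoulli_product \<rho> :: ('d::finite config) measure)"
proof -
  let ?M = "\<lambda>_::int ^ 'd. measure_pmf (bernoulli_pmf \<rho>)"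
  have eq: "bernoulli_product \<rho> = PiM UNIV ?M" by (simp add: bernoulli_product_def)
  interpret product_prob_space ?M UNIV
    by unfold_locales
  have sets: "sets (PiM UNIV ?M) = sets config_algebra"
    by (intro sets_PiM_cong) auto
  show ?thesis
    unfolding eq
  proof (intro exchangeable.intro exchangeable_axioms.intro)
    show "prob_space (PiM UNIV ?M)" by (intro prob_space_PiM prob_space_measure_pmf)
    show "sets (PiM UNIV ?M) = sets config_algebra" by (rule sets)
    fix x z :: "int ^ 'd"
    let ?t = "\<lambda>u. if u = z then x else if u = x then z else u"
    have "distr (PiM UNIV ?M) (PiM UNIV (\<lambda>i. ?M (?t i))) (\<lambda>\<omega>. \<lambda>n\<in>UNIV. \<omega> (?t n)) = PiM UNIV (\<lambda>i. ?M (?t i))"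
      by (rule distr_PiM_reindex) (auto simp: inj_on_def prob_space_measure_pmf)
    moreover have "(\<lambda>\<omega>. \<lambda>n\<in>UNIV. \<omega> (?t n)) = (\<lambda>\<eta>::'d config. exchange \<eta> x z)"
      by (auto simp: exchange_apply fun_eq_iff)
    ultimately show "distr (PiM UNIV ?M) (PiM UNIV ?M) (\<lambda>\<eta>. exchange \<eta> x z) = PiM UNIV ?M"
      by simp
  qed
qed

context exchangeable
begin

lemma measurable_eq: "measurable \<mu> N = measurable config_algebra N"
  by (rule measurable_cong_sets[OF sets_eq refl])

lemma local_integrable [simp, intro]:
  assumes "local_function g" shows "integrable \<mu> g"
proof -
  obtain C where "\<And>\<eta>. \<bar>g \<eta>\<bar> \<le> C" using local_function_bounded[OF assms] by blast
  then have "AE \<eta> in \<mu>. norm (g \<eta>) \<le> C"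
    unfolding real_norm_def by (intro AE_I2)
  moreover have "g \<in> borel_measurable \<mu>"
    unfolding measurable_eq by (rule local_function_measurable[OF assms])
  ultimately show ?thesis by (rule integrable_const_bound)
qed

lemma expectation_exchange:
  assumes "local_function g"
  shows "expectation (\<lambda>\<eta>. g (exchange \<eta> x z)) = expectation g"
proof -
  have "expectation g = integral\<^sup>L (distr \<mu> \<mu> (\<lambda>\<eta>. exchange \<eta> x z)) g"
    by (simp add: exchange_invariant)
  also have "\<dots> = expectation (\<lambda>\<eta>. g (exchange \<eta> x z))"
  proof (rule integral_distr)
    show "(\<lambda>\<eta>. exchange \<eta> x z) \<in> measurable \<mu> \<mu>"
      unfolding measurable_cong_sets[OF sets_eq sets_eq] by (rule exchange_measurable)
    show "g \<in> borel_measurable \<mu>"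
      unfolding measurable_eq by (rule local_function_measurable[OF assms])
  qed
  finally show ?thesis by simp
qed

definition l2 :: "('d config \<Rightarrow> real) \<Rightarrow> real" where
  "l2 g = sqrt (expectation (\<lambda>\<eta>. (g \<eta>)\<^sup>2))"

lemma l2_nonneg [simp]: "0 \<le> l2 g"
  by (simp add: l2_def)

lemma l2_power2: "(l2 g)\<^sup>2 = expectation (\<lambda>\<eta>. (g \<eta>)\<^sup>2)"
  by (simp add: l2_def)

text \<open>The Cauchy-Schwarz inequality, from the nonnegativity of
  \<open>E ((s g + t h)^2)\<close> as a quadratic form in \<open>s\<close> and
  \<open>t\<close>.\<close>

lemma expectation_mult_le_l2:
  assumes g: "local_function g" and h: "local_function h"
  shows "\<bar>expectation (\<lambda>\<eta>. g \<eta> * h \<eta>)\<bar> \<le> l2 g * l2 h"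
proof -
  define a b c where "a = expectation (\<lambda>\<eta>. (g \<eta>)\<^sup>2)" and "b = expectation (\<lambda>\<eta>. g \<eta> * h \<eta>)"
    and "c = expectation (\<lambda>\<eta>. (h \<eta>)\<^sup>2)"
  have c0: "0 \<le> c" by (simp add: c_def)
  have pos: "0 \<le> s\<^sup>2 * a + 2 * s * t * b + t\<^sup>2 * c" for s t
  proof -
    have "0 \<le> expectation (\<lambda>\<eta>. (s * g \<eta> + t * h \<eta>)\<^sup>2)" by simp
    also have "(\<lambda>\<eta>. (s * g \<eta> + t * h \<eta>)\<^sup>2)
        = (\<lambda>\<eta>. s\<^sup>2 * (g \<eta>)\<^sup>2 + (2 * s * t) * (g \<eta> * h \<eta>) + t\<^sup>2 * (h \<eta>)\<^sup>2)"
      by (auto simp: power2_eq_square algebra_simps)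
    also have "expectation \<dots> = s\<^sup>2 * a + 2 * s * t * b + t\<^sup>2 * c"
      unfolding a_def b_def c_def using g h by (subst Bochner_Integration.integral_add | simp)+
    finally show ?thesis .
  qed
  have "b\<^sup>2 \<le> a * c"
  proof (cases "c = 0")
    case True
    have "b = 0"
    proof (rule ccontr)
      assume "b \<noteq> 0"
      \<comment> \<open>With \<open>c = 0\<close> and \<open>s = 1\<close> the form is affine in
        \<open>t\<close>; this choice of \<open>t\<close> would give it the value -1.\<close>
      have "0 \<le> a + 2 * (- (a + 1) / (2 * b)) * b"
        using pos[of 1 "- (a + 1) / (2 * b)"] True by simp
      also have "\<dots> = - 1" using \<open>b \<noteq> 0\<close> by (simp add: field_simps)
      finally show False by simp
    qed
    then show ?thesis using True by simp
  next
    case False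
    then have "c > 0" using c0 by simp
    \<comment> \<open>For \<open>s = c\<close> the form is minimal at
      \<open>t = - b\<close>.\<close>
    have "0 \<le> c\<^sup>2 * a + 2 * c * (- b) * b + (- b)\<^sup>2 * c" by (rule pos)
    also have "\<dots> = c * (a * c - b\<^sup>2)" by (simp add: power2_eq_square algebra_simps)
    finally show ?thesis using \<open>c > 0\<close> by (simp add: zero_le_mult_iff)
  qed
  then have "sqrt (b\<^sup>2) \<le> sqrt (a * c)" by (rule real_sqrt_le_mono)
  then show ?thesis by (simp add: real_sqrt_mult l2_def a_def b_def c_def)
qed

lemma l2_triangle:
  assumes g: "local_function g" and h: "local_function h"
  shows "l2 (\<lambda>\<eta>. g \<eta> + h \<eta>) \<le> l2 g + l2 h"
proof (rule power2_le_imp_le)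
  have "(l2 (\<lambda>\<eta>. g \<eta> + h \<eta>))\<^sup>2 = expectation (\<lambda>\<eta>. (g \<eta>)\<^sup>2 + 2 * (g \<eta> * h \<eta>) + (h \<eta>)\<^sup>2)"
    unfolding l2_power2 by (simp add: power2_sum algebra_simps)
  also have "\<dots> = (l2 g)\<^sup>2 + 2 * expectation (\<lambda>\<eta>. g \<eta> * h \<eta>) + (l2 h)\<^sup>2"
    unfolding l2_power2 using g h by (subst Bochner_Integration.integral_add | simp)+
  also have "\<dots> \<le> (l2 g + l2 h)\<^sup>2"
    using expectation_mult_le_l2[OF g h] by (simp add: power2_sum)
  finally show "(l2 (\<lambda>\<eta>. g \<eta> + h \<eta>))\<^sup>2 \<le> (l2 g + l2 h)\<^sup>2" .
qed simp

lemma l2_exchange: "local_function g \<Longrightarrow> l2 (\<lambda>\<eta>. g (exchange \<eta> x z)) = l2 g"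
  using expectation_exchange[of "\<lambda>\<eta>. (g \<eta>)\<^sup>2"] by (simp add: l2_def)

lemma l2_uminus [simp]: "l2 (\<lambda>\<eta>. - g \<eta>) = l2 g"
  by (simp add: l2_def)

lemma l2_cmult: "l2 (\<lambda>\<eta>. c * g \<eta>) = \<bar>c\<bar> * l2 g"
  by (simp add: l2_def power_mult_distrib real_sqrt_mult)

lemma l2_minus_commute: "l2 (\<lambda>\<eta>. g \<eta> - h \<eta>) = l2 (\<lambda>\<eta>. h \<eta> - g \<eta>)"
  by (simp add: l2_def power2_commute)

lemma l2_triangle_diff:
  assumes "local_function g" "local_function h" "local_function k"
  shows "l2 (\<lambda>\<eta>. g \<eta> - k \<eta>) \<le> l2 (\<lambda>\<eta>. g \<eta> - h \<eta>) + l2 (\<lambda>\<eta>. h \<eta> - k \<eta>)"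
  using l2_triangle[of "\<lambda>\<eta>. g \<eta> - h \<eta>" "\<lambda>\<eta>. h \<eta> - k \<eta>"] assms by simp

end

section \<open>Almost additive functions on the lattice\<close>

text \<open>The l1 norm is used because splitting a vector into its axis components is exact for it,
  and because it is integer valued, hence dominated by its square.\<close>

definition norm1 :: "int ^ 'd \<Rightarrow> real" where
  "norm1 y = (\<Sum>i\<in>UNIV. real_of_int \<bar>y $ i\<bar>)"

lemma norm1_nonneg [simp]: "0 \<le> norm1 y"
  by (simp add: norm1_def sum_nonneg)

lemma norm1_0 [simp]: "norm1 0 = 0"
  by (simp add: norm1_def)

lemma norm1_uminus [simp]: "norm1 (- y) = norm1 y"
  by (simp add: norm1_def)

lemma norm1_triangle: "norm1 (y + z) \<le> norm1 y + norm1 z"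
  unfolding norm1_def sum.distrib [symmetric]
  by (intro sum_mono) (simp flip: of_int_add)

lemma component_le_norm1: "real_of_int \<bar>y $ i\<bar> \<le> norm1 y"
  unfolding norm1_def by (rule member_le_sum) auto

lemma norm1_axis [simp]: "norm1 (axis i k) = real_of_int \<bar>k\<bar>"
proof -
  have "norm1 (axis i k) = (\<Sum>j\<in>UNIV. if j = i then real_of_int \<bar>k\<bar> else 0)"
    unfolding norm1_def by (intro sum.cong) (auto simp: axis_def)
  then show ?thesis by simp
qed

lemma norm1_sum_axis: "norm1 (\<Sum>i\<in>I. axis i (y $ i)) = (\<Sum>i\<in>I. real_of_int \<bar>y $ i\<bar>)"
proof -
  have comp: "(\<Sum>i\<in>I. axis i (y $ i)) $ j = (if j \<in> I then y $ j else 0)" for j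
    by (simp add: axis_def if_distrib[of "\<lambda>f. f j"] sum.delta)
  have "norm1 (\<Sum>i\<in>I. axis i (y $ i)) = (\<Sum>j\<in>UNIV. if j \<in> I then real_of_int \<bar>y $ j\<bar> else 0)"
    unfolding norm1_def comp by (intro sum.cong) auto
  also have "\<dots> = (\<Sum>i\<in>I. real_of_int \<bar>y $ i\<bar>)"
    by (simp add: sum.If_cases)
  finally show ?thesis .
qed

lemma sum_axis_components: "(\<Sum>i\<in>UNIV. axis i (y $ i)) = (y :: int ^ 'd)"
  by (simp add: vec_eq_iff axis_def if_distrib[of "\<lambda>f. f _"] sum.delta)

lemma axis_add: "axis i (a + b) = axis i a + axis i (b :: int)"
  by (simp add: vec_eq_iff axis_def)

lemma axis_uminus: "axis i (- a) = - axis i (a :: int)"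
  by (simp add: vec_eq_iff axis_def)

lemma axis_zero: "axis i (0 :: int) = 0"
  by (simp add: vec_eq_iff axis_def)

text \<open>The factor 2 in the weakened triangle inequality sits on one summand only. Peeling off
  one unit step at a time therefore gives linear growth instead of exponential growth. The final 4
  is one factor 2 along each axis times another for joining the axes.\<close>

lemma seminorm_le_norm1:
  fixes N :: "int ^ 'd \<Rightarrow> real"
  assumes zero: "N 0 = 0" and sym: "\<And>y. N (- y) = N y" and nonneg: "\<And>y. 0 \<le> N y"
    and add: "\<And>y z. N (y + z) \<le> 2 * N y + N z"
    and unit: "\<And>i. N (axis i 1) \<le> s"
  shows "N y \<le> 4 * norm1 y * s"
proof -
  have nat: "N (axis i (int n)) \<le> 2 * real n * s" for i n
  proof (induction n)
    case (Suc n)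
    have "N (axis i (int (Suc n))) \<le> 2 * N (axis i 1) + N (axis i (int n))"
      using add[of "axis i 1" "axis i (int n)"] by (simp flip: axis_add)
    then show ?case using Suc unit[of i] by (simp add: algebra_simps)
  qed (simp add: axis_zero zero)
  have int: "N (axis i k) \<le> 2 * real_of_int \<bar>k\<bar> * s" for i k
  proof (cases "0 \<le> k")
    case True
    then show ?thesis using nat[of i "nat k"] by simp
  next
    case False
    then show ?thesis using nat[of i "nat (- k)"] sym[of "axis i k"] by (simp add: axis_uminus)
  qed
  have "N (\<Sum>i\<in>I. axis i (y $ i)) \<le> 2 * (\<Sum>i\<in>I. N (axis i (y $ i)))" if "finite I" for I
    using that
  proof induction
    case (insert j I)
    then show ?case using add[of "axis j (y $ j)" "\<Sum>i\<in>I. axis i (y $ i)"] by simp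
  qed (simp add: zero)
  from this[of UNIV] have "N y \<le> 2 * (\<Sum>i\<in>UNIV. N (axis i (y $ i)))"
    by (simp add: sum_axis_components)
  also have "\<dots> \<le> 2 * (\<Sum>i\<in>UNIV. 2 * real_of_int \<bar>y $ i\<bar> * s)"
    by (intro mult_left_mono sum_mono int) auto
  also have "\<dots> = 4 * norm1 y * s"
    by (simp add: norm1_def sum_distrib_left sum_distrib_right mult.assoc)
  finally show ?thesis .
qed

text \<open>Halving \<open>n\<close> repeatedly keeps the accumulated error quadratic in \<open>n\<close>; peeling off unit steps
  would give a cubic error.\<close>

lemma almost_additive_line:
  fixes g :: "nat \<Rightarrow> real"
  assumes C: "0 \<le> C" and add: "\<And>m n. \<bar>g m + g n - g (m + n)\<bar> \<le> C * (real (m + n))\<^sup>2"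
  shows "\<bar>g n - real n * g 1\<bar> \<le> 3 * C * (real n)\<^sup>2"
proof -
  \<comment> \<open>The strengthened bound with \<open>n^2 - n\<close> gains \<open>2 a b\<close>
    when \<open>a\<close> and \<open>b\<close> are joined, and two nearly equal halves satisfy
    \<open>(a + b)^2 <= 6 a b\<close>; this is exactly enough to absorb the new error
    \<open>C (a + b)^2\<close>.\<close>
  have "1 \<le> n \<Longrightarrow> \<bar>g n - real n * g 1\<bar> \<le> 3 * C * ((real n)\<^sup>2 - real n)"
  proof (induction n rule: less_induct)
    case (less n)
    show ?case
    proof (cases "n = 1")
      case False
      define a b where "a = n div 2" and "b = n - n div 2"
      have ab: "n = a + b" "1 \<le> a" "1 \<le> b" "a < n" "b < n" "b = a \<or> b = a + 1"
        using False less.prems by (auto simp: a_def b_def)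
      define x y where "x = real a" and "y = real b"
      have xy: "1 \<le> x" "y = x \<or> y = x + 1" using ab by (auto simp: x_def y_def)
      have "(x + y)\<^sup>2 \<le> 6 * (x * y)"
        using xy(2)
      proof
        assume "y = x + 1"
        moreover have "1 * 1 \<le> x * x" using xy(1) by (intro mult_mono) auto
        ultimately show ?thesis using xy(1) by (simp add: power2_eq_square algebra_simps)
      next
        assume "y = x"
        moreover have "1 * 1 \<le> x * x" using xy(1) by (intro mult_mono) auto
        ultimately show ?thesis using xy(1) by (simp add: power2_eq_square algebra_simps)
      qed
      then have key: "C * (x + y)\<^sup>2 \<le> C * (6 * (x * y))" by (rule mult_left_mono[OF _ C])
      have "\<bar>g n - real n * g 1\<bar> \<le> \<bar>g a + g b - g (a + b)\<bar> + \<bar>g a - real a * g 1\<bar> + \<bar>g b - real b * g 1\<bar>"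
        unfolding ab(1) by (simp add: algebra_simps)
      also have "\<dots> \<le> C * (x + y)\<^sup>2 + 3 * C * (x\<^sup>2 - x) + 3 * C * (y\<^sup>2 - y)"
        using add[of a b] less.IH[of a] less.IH[of b] ab by (simp add: x_def y_def)
      also have "\<dots> \<le> 3 * C * ((x + y)\<^sup>2 - (x + y))"
        using key by (simp add: power2_eq_square algebra_simps)
      finally show ?thesis using ab(1) by (simp add: x_def y_def)
    qed simp
  qed
  moreover have "3 * C * ((real n)\<^sup>2 - real n) \<le> 3 * C * (real n)\<^sup>2"
    using C by (intro mult_left_mono) auto
  moreover have "g 0 = 0" using add[of 0 0] by simp
  ultimately show ?thesis by (cases "n = 0") auto
qed

text \<open>Joining the axis components costs \<open>C |y|^2\<close> for each of the d coordinates.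
  The axes together cost 7: the 3 of \<open>almost_additive_line\<close>, and 4 more for negative
  multiples.\<close>

lemma almost_additive:
  fixes g :: "int ^ 'd \<Rightarrow> real"
  assumes C: "0 \<le> C" and add: "\<And>y z. \<bar>g y + g z - g (y + z)\<bar> \<le> C * (norm1 y + norm1 z)\<^sup>2"
  shows "\<bar>g y - (\<Sum>i\<in>UNIV. real_of_int (y $ i) * g (axis i 1))\<bar>
    \<le> (real CARD('d) + 7) * C * (norm1 y)\<^sup>2"
proof -
  have g0: "g 0 = 0" using add[of 0 0] by simp
  have nat: "\<bar>g (axis i (int n)) - real n * g (axis i 1)\<bar> \<le> 3 * C * (real n)\<^sup>2" for i n
    using almost_additive_line[OF C, of "\<lambda>n. g (axis i (int n))" n] add[of "axis i (int _)" "axis i (int _)"]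
    by (simp add: axis_add)
  have int: "\<bar>g (axis i k) - real_of_int k * g (axis i 1)\<bar> \<le> 7 * C * (real_of_int k)\<^sup>2" for i k
  proof (cases "0 \<le> k")
    case True
    have "3 * C * (real_of_int k)\<^sup>2 \<le> 7 * C * (real_of_int k)\<^sup>2"
      using C by (intro mult_right_mono) auto
    then show ?thesis using True nat[of i "nat k"] by simp
  next
    case False
    define n where "n = nat (- k)"
    have k: "k = - int n" using False by (simp add: n_def)
    \<comment> \<open>The steps \<open>n\<close> and \<open>- n\<close> add up to the zero jump;
      their l1 norms add up to \<open>2 n\<close>, whence the 4.\<close>
    have "\<bar>g (axis i (int n)) + g (axis i (- int n))\<bar> \<le> 4 * C * (real n)\<^sup>2"
      using add[of "axis i (int n)" "axis i (- int n)"] g0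
      by (simp add: axis_zero power2_eq_square flip: axis_add)
    then show ?thesis using nat[of i n] by (simp add: k)
  qed
  have sum: "\<bar>g (\<Sum>i\<in>I. axis i (y $ i)) - (\<Sum>i\<in>I. g (axis i (y $ i)))\<bar> \<le> real (card I) * C * (norm1 y)\<^sup>2"
    if "finite I" for I
    using that
  proof induction
    case (insert j I)
    have "norm1 (axis j (y $ j)) + norm1 (\<Sum>i\<in>I. axis i (y $ i)) = (\<Sum>i\<in>insert j I. real_of_int \<bar>y $ i\<bar>)"
      using insert by (simp add: norm1_sum_axis)
    also have "\<dots> \<le> norm1 y"
      unfolding norm1_def by (intro sum_mono2) auto
    finally have "C * (norm1 (axis j (y $ j)) + norm1 (\<Sum>i\<in>I. axis i (y $ i)))\<^sup>2 \<le> C * (norm1 y)\<^sup>2"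
      by (intro mult_left_mono power_mono C) (simp_all add: sum_nonneg)
    then have "\<bar>g (axis j (y $ j)) + g (\<Sum>i\<in>I. axis i (y $ i)) - g (axis j (y $ j) + (\<Sum>i\<in>I. axis i (y $ i)))\<bar>
        \<le> C * (norm1 y)\<^sup>2"
      using add[of "axis j (y $ j)" "\<Sum>i\<in>I. axis i (y $ i)"] by simp
    then show ?case using insert by (simp add: algebra_simps)
  qed (simp add: g0)
  have "\<bar>(\<Sum>i\<in>UNIV. g (axis i (y $ i))) - (\<Sum>i\<in>UNIV. real_of_int (y $ i) * g (axis i 1))\<bar>
      \<le> (\<Sum>i\<in>UNIV. 7 * C * (real_of_int (y $ i))\<^sup>2)"
    unfolding sum_subtractf [symmetric] by (intro order.trans[OF sum_abs] sum_mono int)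
  also have "\<dots> = 7 * C * (\<Sum>i\<in>UNIV. (real_of_int \<bar>y $ i\<bar>)\<^sup>2)"
    by (simp add: sum_distrib_left)
  also have "(\<Sum>i\<in>UNIV. (real_of_int \<bar>y $ i\<bar>)\<^sup>2) \<le> (\<Sum>i\<in>UNIV. real_of_int \<bar>y $ i\<bar> * norm1 y)"
    unfolding power2_eq_square by (intro sum_mono mult_left_mono component_le_norm1) auto
  also have "\<dots> = (norm1 y)\<^sup>2"
    by (simp add: norm1_def power2_eq_square sum_distrib_right)
  finally have "\<bar>(\<Sum>i\<in>UNIV. g (axis i (y $ i))) - (\<Sum>i\<in>UNIV. real_of_int (y $ i) * g (axis i 1))\<bar>
      \<le> 7 * C * (norm1 y)\<^sup>2"
    using C by (simp add: mult_left_mono)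
  then show ?thesis
    using sum[of UNIV] by (simp add: sum_axis_components algebra_simps)
qed

section \<open>Gradient forms\<close>

lemma infsum_finite_support:
  fixes g :: "'a \<Rightarrow> real"
  assumes "finite F" "\<And>x. x \<notin> F \<Longrightarrow> g x = 0"
  shows "infsum g UNIV = sum g F"
  using infsum_cong_neutral[of UNIV F g g] assms by auto

lemma summable_finite_support:
  fixes g :: "'a \<Rightarrow> real"
  assumes "finite F" "\<And>x. x \<notin> F \<Longrightarrow> g x = 0"
  shows "g summable_on UNIV"
  using summable_on_cong_neutral[of UNIV F g g] assms by auto

lemma infsum_translate:
  fixes g :: "int ^ 'd \<Rightarrow> real"
  shows "(\<Sum>\<^sub>\<infinity>x. g (x + y)) = infsum g UNIV"
  by (rule infsum_reindex_bij_betw) (rule bij_betwI[where g = "\<lambda>x. x - y"]; simp)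

text \<open>The bonds \<open>(x, x + y)\<close> that meet \<open>A\<close>.\<close>

definition touching :: "(int ^ 'd) set \<Rightarrow> int ^ 'd \<Rightarrow> (int ^ 'd) set" where
  "touching A y = A \<union> (\<lambda>x. x - y) ` A"

lemma finite_touching: "finite A \<Longrightarrow> finite (touching A y)"
  by (simp add: touching_def)

lemma not_touching:
  assumes "x \<notin> touching A y" shows "x \<notin> A" "x + y \<notin> A"
  using assms unfolding touching_def by (auto simp: image_iff dest: bspec[of A _ "x + y"])

lemma local_function_common:
  assumes h: "local_function h" and g: "local_function g"
  obtains A where "local_on A h" "local_on A g" "finite A"
proof -
  obtain A where A: "local_on A h" using h by (rule local_functionE)
  obtain B where B: "local_on B g" using g by (rule local_functionE)
  have "finite (A \<union> B)" using A B by (simp add: local_on_finite)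
  with A B show ?thesis
    by (intro that[of "A \<union> B"] local_on_mono[OF A] local_on_mono[OF B]) auto
qed

text \<open>Whenever the exchange of \<open>x\<close> and \<open>z\<close> changes the
  configuration, the exclusion rate from \<open>x\<close> to \<open>z\<close> equals
  \<open>(1 + current) / 2\<close>. The current thus carries the direction of the bond.\<close>

definition current :: "'d::finite config \<Rightarrow> int ^ 'd \<Rightarrow> int ^ 'd \<Rightarrow> real" where
  "current \<eta> x z = of_bool (\<eta> x) - of_bool (\<eta> z)"

lemma local_function_current [intro, simp]: "local_function (\<lambda>\<eta>. current \<eta> x z)"
  unfolding current_def by (intro local_function_diff local_function_site)

lemma abs_current_le: "\<bar>current \<eta> x z\<bar> \<le> 1"
  by (simp add: current_def)

lemma current_exchange: "current (exchange \<eta> x z) x z = - current \<eta> x z"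
  by (simp add: current_def exchange_apply)

context exchangeable
begin

lemma l2_mono:
  assumes "local_function g" "local_function h" "\<And>\<eta>. \<bar>g \<eta>\<bar> \<le> \<bar>h \<eta>\<bar>"
  shows "l2 g \<le> l2 h"
  unfolding l2_def using assms
  by (intro real_sqrt_le_mono integral_mono local_integrable local_function_power) (simp_all add: abs_le_square_iff)

definition edge :: "int ^ 'd \<Rightarrow> int ^ 'd \<Rightarrow> ('d config \<Rightarrow> real) \<Rightarrow> real" where
  "edge x z g = l2 (\<lambda>\<eta>. g (exchange \<eta> x z) - g \<eta>)"

text \<open>Twice the part of the bond's contribution to \<open>E (h L g)\<close> that is odd in the
  direction of the bond; \<open>bond_form\<close> is minus four times the even part, see
  \<open>expectation_bond_generator\<close>.\<close>

definition bond_drift :: "int ^ 'd \<Rightarrow> int ^ 'd \<Rightarrow> ('d config \<Rightarrow> real) \<Rightarrow> ('d config \<Rightarrow> real) \<Rightarrow> real" where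
  "bond_drift x z h g = expectation (\<lambda>\<eta>. h \<eta> * current \<eta> x z * (g (exchange \<eta> x z) - g \<eta>))"

definition bond_form :: "int ^ 'd \<Rightarrow> int ^ 'd \<Rightarrow> ('d config \<Rightarrow> real) \<Rightarrow> ('d config \<Rightarrow> real) \<Rightarrow> real" where
  "bond_form x z h g = expectation (\<lambda>\<eta>. (h (exchange \<eta> x z) - h \<eta>) * (g (exchange \<eta> x z) - g \<eta>))"

definition grad :: "('d config \<Rightarrow> real) \<Rightarrow> int ^ 'd \<Rightarrow> real" where
  "grad g y = sqrt (\<Sum>\<^sub>\<infinity>x. (edge x (x + y) g)\<^sup>2)"

definition drift :: "('d config \<Rightarrow> real) \<Rightarrow> ('d config \<Rightarrow> real) \<Rightarrow> int ^ 'd \<Rightarrow> real" where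
  "drift h g y = (\<Sum>\<^sub>\<infinity>x. bond_drift x (x + y) h g)"

definition form :: "('d config \<Rightarrow> real) \<Rightarrow> ('d config \<Rightarrow> real) \<Rightarrow> int ^ 'd \<Rightarrow> real" where
  "form h g y = (\<Sum>\<^sub>\<infinity>x. bond_form x (x + y) h g)"

lemma edge_nonneg [simp]: "0 \<le> edge x z g"
  by (simp add: edge_def)

lemma edge_same [simp]: "edge x x g = 0"
  by (simp add: edge_def l2_def)

lemma edge_commute: "edge x z g = edge z x g"
  by (simp add: edge_def exchange_commute)

lemma bond_drift_same [simp]: "bond_drift x x h g = 0"
  by (simp add: bond_drift_def)

lemma bond_drift_commute: "bond_drift z x h g = - bond_drift x z h g"
proof -
  have "(\<lambda>\<eta>. h \<eta> * current \<eta> z x * (g (exchange \<eta> z x) - g \<eta>))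
      = (\<lambda>\<eta>. - (h \<eta> * current \<eta> x z * (g (exchange \<eta> x z) - g \<eta>)))"
    by (simp add: current_def exchange_commute[of _ z x] algebra_simps)
  then show ?thesis by (simp add: bond_drift_def)
qed

lemma edge_outside: "local_on A g \<Longrightarrow> x \<notin> A \<Longrightarrow> z \<notin> A \<Longrightarrow> edge x z g = 0"
  by (simp add: edge_def local_on_exchange_outside l2_def)

lemma bond_drift_outside: "local_on A g \<Longrightarrow> x \<notin> A \<Longrightarrow> z \<notin> A \<Longrightarrow> bond_drift x z h g = 0"
  by (simp add: bond_drift_def local_on_exchange_outside)

lemma bond_form_outside: "local_on A g \<Longrightarrow> x \<notin> A \<Longrightarrow> z \<notin> A \<Longrightarrow> bond_form x z h g = 0"
  by (simp add: bond_form_def local_on_exchange_outside)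

lemma grad_eq_L2_set:
  assumes "local_on A g" "finite F" "touching A y \<subseteq> F"
  shows "grad g y = L2_set (\<lambda>x. edge x (x + y) g) F"
  unfolding grad_def L2_set_def
proof -
  have "edge x (x + y) g = 0" if "x \<notin> F" for x
    by (rule edge_outside[OF assms(1)]) (use that assms(3) not_touching[of _ A y] in auto)
  then have "(\<Sum>\<^sub>\<infinity>x. (edge x (x + y) g)\<^sup>2) = (\<Sum>x\<in>F. (edge x (x + y) g)\<^sup>2)"
    by (intro infsum_finite_support assms(2)) simp
  then show "sqrt (\<Sum>\<^sub>\<infinity>x. (edge x (x + y) g)\<^sup>2) = sqrt (\<Sum>x\<in>F. (edge x (x + y) g)\<^sup>2)"
    by simp
qed

lemma drift_eq_sum:
  assumes "local_on A g" "finite F" "touching A y \<subseteq> F"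
  shows "drift h g y = (\<Sum>x\<in>F. bond_drift x (x + y) h g)"
  unfolding drift_def
  by (rule infsum_finite_support[OF assms(2)], rule bond_drift_outside[OF assms(1)])
     (use assms(3) not_touching[of _ A y] in auto)

lemma form_eq_sum:
  assumes "local_on A g" "finite F" "touching A y \<subseteq> F"
  shows "form h g y = (\<Sum>x\<in>F. bond_form x (x + y) h g)"
  unfolding form_def
  by (rule infsum_finite_support[OF assms(2)], rule bond_form_outside[OF assms(1)])
     (use assms(3) not_touching[of _ A y] in auto)

lemma grad_nonneg [simp]: "0 \<le> grad g y"
  by (simp add: grad_def infsum_nonneg)

lemma grad_0 [simp]: "grad g 0 = 0"
  by (simp add: grad_def)

lemma grad_uminus: "grad g (- y) = grad g y"
  using infsum_translate[of "\<lambda>x. (edge x (x + - y) g)\<^sup>2" y]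
  by (simp add: grad_def edge_commute[of _ "_ + y"])

text \<open>The exchange of \<open>x\<close> and \<open>w\<close> is the exchange of
  \<open>v\<close> and \<open>w\<close> conjugated by that of \<open>x\<close> and \<open>v\<close>.
  By invariance of the measure each of the three exchanges costs its own edge, the conjugating one
  twice.\<close>

lemma edge_triangle:
  assumes g: "local_function g"
  shows "edge x w g \<le> 2 * edge x v g + edge v w g"
proof (cases "x = w \<or> v = x \<or> v = w")
  case False
  define T1 T2 where "T1 = (\<lambda>\<eta> :: 'd config. exchange \<eta> x v)" and "T2 = (\<lambda>\<eta> :: 'd config. exchange \<eta> v w)"
  have T: "exchange \<eta> x w = T1 (T2 (T1 \<eta>))" for \<eta>
    using False by (auto simp: T1_def T2_def fun_eq_iff exchange_apply)
  have loc: "local_function (\<lambda>\<eta>. k (T1 \<eta>))" "local_function (\<lambda>\<eta>. k (T2 \<eta>))"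
    if "local_function k" for k using that by (auto simp: T1_def T2_def)
  have g2: "local_function (\<lambda>\<eta>. g (T1 (T2 \<eta>)))" using loc(2)[OF loc(1)[OF g]] .
  have "edge x w g = l2 (\<lambda>\<eta>. g (T1 (T2 (T1 \<eta>))) - g \<eta>)"
    by (simp add: edge_def T)
  also have "\<dots> \<le> l2 (\<lambda>\<eta>. g (T1 (T2 (T1 \<eta>))) - g (T2 (T1 \<eta>))) + l2 (\<lambda>\<eta>. g (T2 (T1 \<eta>)) - g \<eta>)"
    by (rule l2_triangle_diff) (intro loc(1)[OF g2] loc(1)[OF loc(2)[OF g]] g)+
  also have "l2 (\<lambda>\<eta>. g (T2 (T1 \<eta>)) - g \<eta>) \<le> l2 (\<lambda>\<eta>. g (T2 (T1 \<eta>)) - g (T1 \<eta>)) + l2 (\<lambda>\<eta>. g (T1 \<eta>) - g \<eta>)"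
    by (rule l2_triangle_diff) (intro loc(1)[OF loc(2)[OF g]] loc(1)[OF g] g)+
  also have "l2 (\<lambda>\<eta>. g (T2 (T1 \<eta>)) - g (T1 \<eta>)) = l2 (\<lambda>\<eta>. g (T2 \<eta>) - g \<eta>)"
    using l2_exchange[of "\<lambda>\<eta>. g (T2 \<eta>) - g \<eta>" x v] loc(2)[OF g] g by (simp add: T1_def)
  also have "l2 (\<lambda>\<eta>. g (T1 (T2 (T1 \<eta>))) - g (T2 (T1 \<eta>))) = l2 (\<lambda>\<eta>. g (T1 (T2 \<eta>)) - g (T2 \<eta>))"
    using l2_exchange[of "\<lambda>\<eta>. g (T1 (T2 \<eta>)) - g (T2 \<eta>)" x v] loc(2)[OF g] g2 by (simp add: T1_def)
  also have "\<dots> = l2 (\<lambda>\<eta>. g (T1 \<eta>) - g \<eta>)"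
    using l2_exchange[of "\<lambda>\<eta>. g (T1 \<eta>) - g \<eta>" v w] loc(1)[OF g] g by (simp add: T2_def)
  finally show ?thesis by (simp add: edge_def T1_def T2_def)
qed auto

lemma grad_add:
  assumes g: "local_function g" shows "grad g (y + z) \<le> 2 * grad g y + grad g z"
proof -
  obtain A where A: "local_on A g" using g by (rule local_functionE)
  then have fin: "finite A" by (rule local_on_finite)
  \<comment> \<open>One finite index set for all three sums. The sum for \<open>z\<close> runs over
    the shifted bonds from \<open>x + y\<close> to \<open>x + y + z\<close>, which explains the
    shifted copy of \<open>touching A z\<close>.\<close>
  define F where "F = touching A (y + z) \<union> touching A y \<union> (\<lambda>x. x - y) ` touching A z"
  have F: "finite F" "touching A (y + z) \<subseteq> F" "touching A y \<subseteq> F"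
    using fin by (auto simp: F_def finite_touching)
  have "(edge (x + y) (x + y + z) g)\<^sup>2 = 0" if "x \<notin> F" for x
  proof -
    have "x + y \<notin> touching A z" using that unfolding F_def by (auto simp: image_iff)
    then show ?thesis using not_touching[of "x + y" A z] by (simp add: edge_outside[OF A])
  qed
  then have z: "grad g z = L2_set (\<lambda>x. edge (x + y) (x + y + z) g) F"
    unfolding grad_def L2_set_def
    using infsum_translate[of "\<lambda>x. (edge x (x + z) g)\<^sup>2" y]
      infsum_finite_support[OF F(1), of "\<lambda>x. (edge (x + y) (x + y + z) g)\<^sup>2"] by simp
  have "grad g (y + z) = L2_set (\<lambda>x. edge x (x + (y + z)) g) F"
    by (rule grad_eq_L2_set[OF A F(1,2)])
  also have "\<dots> \<le> L2_set (\<lambda>x. 2 * edge x (x + y) g + edge (x + y) (x + y + z) g) F"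
    using edge_triangle[OF g, of _ "_ + (y + z)" "_ + y"] by (intro L2_set_mono) (simp_all add: add.assoc)
  also have "\<dots> \<le> L2_set (\<lambda>x. 2 * edge x (x + y) g) F + L2_set (\<lambda>x. edge (x + y) (x + y + z) g) F"
    by (rule L2_set_triangle_ineq)
  also have "L2_set (\<lambda>x. 2 * edge x (x + y) g) F = 2 * L2_set (\<lambda>x. edge x (x + y) g) F"
    by (simp add: L2_set_right_distrib)
  also have "\<dots> = 2 * grad g y" by (simp add: grad_eq_L2_set[OF A F(1,3)])
  finally show ?thesis using z by simp
qed

text \<open>The nearest-neighbour energy belongs to neither process. It is the common yardstick to
  which both Dirichlet forms are shown to be equivalent.\<close>

definition energy :: "('d config \<Rightarrow> real) \<Rightarrow> real" where
  "energy g = (\<Sum>i\<in>UNIV. (grad g (axis i 1))\<^sup>2)"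

lemma energy_nonneg [simp]: "0 \<le> energy g"
  by (simp add: energy_def sum_nonneg)

text \<open>A long exchange is a path of unit exchanges. That the growth in the jump is only linear
  is what makes second moments of the jump law sufficient.\<close>

lemma grad_le_energy:
  assumes "local_function g" shows "grad g y \<le> 4 * norm1 y * sqrt (energy g)"
proof (rule seminorm_le_norm1[where N = "grad g"])
  fix i
  have "(grad g (axis i 1))\<^sup>2 \<le> energy g"
    unfolding energy_def by (rule member_le_sum) auto
  then show "grad g (axis i 1) \<le> sqrt (energy g)" by (rule real_le_rsqrt)
qed (simp_all add: grad_uminus grad_add assms)

text \<open>Averaging \<open>h\<close> over all permutations of the three sites makes the cyclic sum vanish, because
  the three currents add up to zero. Hence only the fluctuation of \<open>h\<close> around this average
  contributes.\<close>

lemma triangle_drift_distinct: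
  assumes h: "local_function h" and g: "local_function g"
    and distinct: "x \<noteq> v" "v \<noteq> w" "w \<noteq> x"
  shows "\<bar>bond_drift x v h g + bond_drift v w h g + bond_drift w x h g\<bar>
    \<le> (edge x v h + edge v w h + edge w x h) * (edge x v g + edge v w g + edge w x g)"
proof -
  define T1 T2 T3 where "T1 = (\<lambda>\<eta> :: 'd config. exchange \<eta> x v)"
    and "T2 = (\<lambda>\<eta> :: 'd config. exchange \<eta> v w)" and "T3 = (\<lambda>\<eta> :: 'd config. exchange \<eta> w x)"
  note T_defs = T1_def T2_def T3_def
  have rel: "T1 (T1 \<eta>) = \<eta>" "T2 (T2 \<eta>) = \<eta>" "T3 (T3 \<eta>) = \<eta>"
    "T3 (T1 \<eta>) = T1 (T2 \<eta>)" "T3 (T2 \<eta>) = T2 (T1 \<eta>)" "T1 (T3 \<eta>) = T2 (T1 \<eta>)" "T2 (T3 \<eta>) = T1 (T2 \<eta>)"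
    "T1 (T2 (T1 \<eta>)) = T3 \<eta>" "T2 (T1 (T2 \<eta>)) = T3 \<eta>" for \<eta>
    using distinct by (auto simp: T_defs fun_eq_iff exchange_apply)
  have loc: "local_function (\<lambda>\<eta>. k (T1 \<eta>))" "local_function (\<lambda>\<eta>. k (T2 \<eta>))" "local_function (\<lambda>\<eta>. k (T3 \<eta>))"
    if "local_function k" for k using that by (auto simp: T_defs)
  have loc12: "local_function (\<lambda>\<eta>. h (T1 (T2 \<eta>)))" using loc(2)[OF loc(1)[OF h]] .
  have loc21: "local_function (\<lambda>\<eta>. h (T2 (T1 \<eta>)))" using loc(1)[OF loc(2)[OF h]] .
  \<comment> \<open>The six permutations of the three sites: the identity, three transpositions and
    the two three-cycles \<open>T1 T2\<close> and \<open>T2 T1\<close>.\<close>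
  define m where "m = (\<lambda>\<eta>. (h \<eta> + h (T1 \<eta>) + h (T2 \<eta>) + h (T3 \<eta>) + h (T1 (T2 \<eta>)) + h (T2 (T1 \<eta>))) / 6)"
  have m: "local_function m"
    unfolding m_def by (intro local_function_divide local_function_add h loc[OF h] loc12 loc21)
  have inv: "m (T1 \<eta>) = m \<eta>" "m (T2 \<eta>) = m \<eta>" "m (T3 \<eta>) = m \<eta>" for \<eta>
    unfolding m_def by (simp_all add: rel)
  \<comment> \<open>For an invariant \<open>m\<close> the change of variables by the exchange
    reverses the current, so the shifted term equals the unshifted one with its sign.\<close>
  have vanish: "bond_drift y z m g = - 2 * expectation (\<lambda>\<eta>. m \<eta> * g \<eta> * current \<eta> y z)"
    if "\<And>\<eta>. m (exchange \<eta> y z) = m \<eta>" for y z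
  proof -
    have "bond_drift y z m g = expectation (\<lambda>\<eta>. m \<eta> * current \<eta> y z * g (exchange \<eta> y z))
        - expectation (\<lambda>\<eta>. m \<eta> * g \<eta> * current \<eta> y z)"
      unfolding bond_drift_def using m g
      by (subst Bochner_Integration.integral_diff [symmetric]) (auto simp: algebra_simps)
    moreover have "expectation (\<lambda>\<eta>. m \<eta> * current \<eta> y z * g (exchange \<eta> y z))
        = expectation (\<lambda>\<eta>. - (m \<eta> * g \<eta> * current \<eta> y z))"
      using expectation_exchange[of "\<lambda>\<eta>. - (m \<eta> * g \<eta> * current \<eta> y z)" y z] m g that
      by (simp add: current_exchange algebra_simps)
    ultimately show ?thesis by simp
  qed
  have "bond_drift x v m g + bond_drift v w m g + bond_drift w x m g
      = - 2 * (expectation (\<lambda>\<eta>. m \<eta> * g \<eta> * current \<eta> x v)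
        + expectation (\<lambda>\<eta>. m \<eta> * g \<eta> * current \<eta> v w) + expectation (\<lambda>\<eta>. m \<eta> * g \<eta> * current \<eta> w x))"
    using vanish[of x v] vanish[of v w] vanish[of w x] inv by (simp add: T_defs)
  also have "\<dots> = - 2 * expectation (\<lambda>\<eta>. m \<eta> * g \<eta> * current \<eta> x v + m \<eta> * g \<eta> * current \<eta> v w
      + m \<eta> * g \<eta> * current \<eta> w x)"
    using m g by (subst Bochner_Integration.integral_add | simp)+
  also have "(\<lambda>\<eta>. m \<eta> * g \<eta> * current \<eta> x v + m \<eta> * g \<eta> * current \<eta> v w + m \<eta> * g \<eta> * current \<eta> w x)
      = (\<lambda>_. 0)"
    \<comment> \<open>The three currents around the triangle telescope to 0, with the same factor
      \<open>m g\<close> in front.\<close>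
    by (simp add: current_def algebra_simps)
  finally have sum0: "bond_drift x v m g + bond_drift v w m g + bond_drift w x m g = 0" by simp
  define d where "d = (\<lambda>\<eta>. h \<eta> - m \<eta>)"
  have d: "local_function d" unfolding d_def using h m by simp
  have split: "bond_drift y z h g = bond_drift y z m g + bond_drift y z d g" for y z
    unfolding bond_drift_def d_def using h m g
    by (subst Bochner_Integration.integral_add [symmetric]) (auto simp: algebra_simps)
  have bound: "\<bar>bond_drift y z d g\<bar> \<le> l2 d * edge y z g" for y z
  proof -
    have "\<bar>bond_drift y z d g\<bar> \<le> l2 (\<lambda>\<eta>. d \<eta> * current \<eta> y z) * edge y z g"
      unfolding bond_drift_def edge_def using d g by (intro expectation_mult_le_l2) auto
    moreover have "l2 (\<lambda>\<eta>. d \<eta> * current \<eta> y z) \<le> l2 d"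
      using d by (intro l2_mono) (auto simp: abs_mult intro!: mult_left_le abs_current_le)
    ultimately show ?thesis by (meson edge_nonneg mult_right_mono order_trans)
  qed
  \<comment> \<open>A three-cycle is a product of two transpositions, so the corresponding
    fluctuation of \<open>h\<close> is at most the sum of two edges.\<close>
  have l12: "l2 (\<lambda>\<eta>. h \<eta> - h (T1 (T2 \<eta>))) \<le> edge x v h + edge v w h"
  proof -
    have "l2 (\<lambda>\<eta>. h \<eta> - h (T1 (T2 \<eta>))) \<le> l2 (\<lambda>\<eta>. h \<eta> - h (T2 \<eta>)) + l2 (\<lambda>\<eta>. h (T2 \<eta>) - h (T1 (T2 \<eta>)))"
      by (rule l2_triangle_diff) (intro h loc12 loc(2)[OF h])+
    also have "l2 (\<lambda>\<eta>. h (T2 \<eta>) - h (T1 (T2 \<eta>))) = l2 (\<lambda>\<eta>. h \<eta> - h (T1 \<eta>))"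
      using l2_exchange[of "\<lambda>\<eta>. h \<eta> - h (T1 \<eta>)" v w] loc(1)[OF h] h by (simp add: T2_def)
    finally show ?thesis by (simp add: edge_def T_defs l2_minus_commute[of h])
  qed
  have l21: "l2 (\<lambda>\<eta>. h \<eta> - h (T2 (T1 \<eta>))) \<le> edge x v h + edge v w h"
  proof -
    have "l2 (\<lambda>\<eta>. h \<eta> - h (T2 (T1 \<eta>))) \<le> l2 (\<lambda>\<eta>. h \<eta> - h (T1 \<eta>)) + l2 (\<lambda>\<eta>. h (T1 \<eta>) - h (T2 (T1 \<eta>)))"
      by (rule l2_triangle_diff) (intro h loc21 loc(1)[OF h])+
    also have "l2 (\<lambda>\<eta>. h (T1 \<eta>) - h (T2 (T1 \<eta>))) = l2 (\<lambda>\<eta>. h \<eta> - h (T2 \<eta>))"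
      using l2_exchange[of "\<lambda>\<eta>. h \<eta> - h (T2 \<eta>)" x v] loc(2)[OF h] h by (simp add: T1_def)
    finally show ?thesis by (simp add: edge_def T_defs l2_minus_commute[of h])
  qed
  let ?D = "\<lambda>T \<eta>. h \<eta> - h (T \<eta>)"
  have "6 * l2 d = l2 (\<lambda>\<eta>. 6 * d \<eta>)" by (simp add: l2_cmult)
  also have "(\<lambda>\<eta>. 6 * d \<eta>) = (\<lambda>\<eta>. (?D T1 \<eta> + ?D T2 \<eta>) + (?D T3 \<eta> + (?D (\<lambda>\<eta>. T1 (T2 \<eta>)) \<eta> + ?D (\<lambda>\<eta>. T2 (T1 \<eta>)) \<eta>)))"
    by (simp add: d_def m_def fun_eq_iff field_simps)
  also have "l2 \<dots> \<le> l2 (\<lambda>\<eta>. ?D T1 \<eta> + ?D T2 \<eta>) + l2 (\<lambda>\<eta>. ?D T3 \<eta> + (?D (\<lambda>\<eta>. T1 (T2 \<eta>)) \<eta> + ?D (\<lambda>\<eta>. T2 (T1 \<eta>)) \<eta>))"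
    by (rule l2_triangle) (intro local_function_add local_function_diff h loc[OF h] loc12 loc21)+
  also have "l2 (\<lambda>\<eta>. ?D T1 \<eta> + ?D T2 \<eta>) \<le> l2 (?D T1) + l2 (?D T2)"
    by (rule l2_triangle) (intro local_function_diff h loc[OF h])+
  also have "l2 (\<lambda>\<eta>. ?D T3 \<eta> + (?D (\<lambda>\<eta>. T1 (T2 \<eta>)) \<eta> + ?D (\<lambda>\<eta>. T2 (T1 \<eta>)) \<eta>))
      \<le> l2 (?D T3) + l2 (\<lambda>\<eta>. ?D (\<lambda>\<eta>. T1 (T2 \<eta>)) \<eta> + ?D (\<lambda>\<eta>. T2 (T1 \<eta>)) \<eta>)"
    by (rule l2_triangle) (intro local_function_add local_function_diff h loc[OF h] loc12 loc21)+
  also have "l2 (\<lambda>\<eta>. ?D (\<lambda>\<eta>. T1 (T2 \<eta>)) \<eta> + ?D (\<lambda>\<eta>. T2 (T1 \<eta>)) \<eta>)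
      \<le> l2 (?D (\<lambda>\<eta>. T1 (T2 \<eta>))) + l2 (?D (\<lambda>\<eta>. T2 (T1 \<eta>)))"
    by (rule l2_triangle) (intro local_function_diff h loc12 loc21)+
  finally have "6 * l2 d \<le> l2 (?D T1) + l2 (?D T2) + l2 (?D T3) + 2 * (edge x v h + edge v w h)"
    using l12 l21 by simp
  moreover have "l2 (?D T1) = edge x v h" "l2 (?D T2) = edge v w h" "l2 (?D T3) = edge w x h"
    by (simp_all add: edge_def T_defs l2_minus_commute[of h])
  ultimately have "6 * l2 d \<le> (edge x v h + edge v w h + edge w x h) + 2 * (edge x v h + edge v w h)" by simp
  also have "\<dots> \<le> 6 * (edge x v h + edge v w h + edge w x h)" by simp
  finally have "l2 d \<le> edge x v h + edge v w h + edge w x h" by simp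
  then have ld: "l2 d * (edge x v g + edge v w g + edge w x g)
      \<le> (edge x v h + edge v w h + edge w x h) * (edge x v g + edge v w g + edge w x g)"
    by (rule mult_right_mono) simp
  have "\<bar>bond_drift x v h g + bond_drift v w h g + bond_drift w x h g\<bar>
      = \<bar>bond_drift x v d g + bond_drift v w d g + bond_drift w x d g\<bar>"
    using sum0 by (simp add: split)
  also have "\<dots> \<le> l2 d * (edge x v g + edge v w g + edge w x g)"
    using bound[of x v] bound[of v w] bound[of w x] by (simp add: distrib_left)
  also note ld
  finally show ?thesis .
qed

text \<open>In a degenerate triangle one side is a point and the other two cancel by
  antisymmetry.\<close>

lemma triangle_drift:
  assumes "local_function h" "local_function g"
  shows "\<bar>bond_drift x v h g + bond_drift v w h g + bond_drift w x h g\<bar>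
    \<le> (edge x v h + edge v w h + edge w x h) * (edge x v g + edge v w g + edge w x g)"
proof (cases "x \<noteq> v \<and> v \<noteq> w \<and> w \<noteq> x")
  case True
  then show ?thesis by (intro triangle_drift_distinct assms) auto
next
  case False
  have "bond_drift x v h g + bond_drift v w h g + bond_drift w x h g = 0"
    if "x = v \<or> v = w \<or> w = x"
    using that
  proof (elim disjE)
    show ?thesis if "x = v" unfolding that using bond_drift_commute[of v w h g] by simp
    show ?thesis if "v = w" unfolding that using bond_drift_commute[of x w h g] by simp
    show ?thesis if "w = x" unfolding that using bond_drift_commute[of x v h g] by simp
  qed
  then show ?thesis using False by simp
qed

text \<open>Sum of \<open>triangle_drift\<close> over the translates of one triangle. The third side
  is traversed backwards and so contributes minus the drift of \<open>y + z\<close>. Cauchy-Schwarz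
  and Minkowski over the translates turn edges into gradients.\<close>

lemma drift_add:
  assumes h: "local_function h" and g: "local_function g"
  shows "\<bar>drift h g y + drift h g z - drift h g (y + z)\<bar>
    \<le> (grad h y + grad h z + grad h (y + z)) * (grad g y + grad g z + grad g (y + z))"
proof -
  obtain A where A: "local_on A h" "local_on A g" "finite A"
    using local_function_common[OF h g] .
  define F where "F = touching A (y + z) \<union> touching A y \<union> (\<lambda>x. x - y) ` touching A z"
  have F: "finite F" "touching A (y + z) \<subseteq> F" "touching A y \<subseteq> F"
    using A(3) by (auto simp: F_def finite_touching)
  have out: "x + y \<notin> A \<and> x + y + z \<notin> A" if "x \<notin> F" for x
  proof -
    have "x + y \<notin> touching A z" using that unfolding F_def by (auto simp: image_iff)
    then show ?thesis using not_touching[of "x + y" A z] by simp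
  qed
  have gz: "grad k z = L2_set (\<lambda>x. edge (x + y) (x + y + z) k) F" if "local_on A k" for k
  proof -
    have "(\<Sum>\<^sub>\<infinity>x. (edge x (x + z) k)\<^sup>2) = (\<Sum>\<^sub>\<infinity>x. (edge (x + y) (x + y + z) k)\<^sup>2)"
      by (rule infsum_translate [symmetric])
    also have "\<dots> = (\<Sum>x\<in>F. (edge (x + y) (x + y + z) k)\<^sup>2)"
      by (rule infsum_finite_support[OF F(1)]) (use out edge_outside[OF that] in auto)
    finally show ?thesis unfolding grad_def L2_set_def by simp
  qed
  have dz: "drift h g z = (\<Sum>x\<in>F. bond_drift (x + y) (x + y + z) h g)"
  proof -
    have "drift h g z = (\<Sum>\<^sub>\<infinity>x. bond_drift (x + y) (x + y + z) h g)"
      unfolding drift_def by (rule infsum_translate [symmetric])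
    also have "\<dots> = (\<Sum>x\<in>F. bond_drift (x + y) (x + y + z) h g)"
      by (rule infsum_finite_support[OF F(1)]) (use out bond_drift_outside[OF A(2)] in auto)
    finally show ?thesis .
  qed
  let ?e = "\<lambda>k x. edge x (x + y) k + edge (x + y) (x + y + z) k + edge (x + y + z) x k"
  have L2: "L2_set (?e k) F \<le> grad k y + grad k z + grad k (y + z)" if "local_on A k" for k
  proof -
    have "L2_set (?e k) F \<le> L2_set (\<lambda>x. edge x (x + y) k + edge (x + y) (x + y + z) k) F
        + L2_set (\<lambda>x. edge (x + y + z) x k) F"
      by (rule L2_set_triangle_ineq)
    also have "L2_set (\<lambda>x. edge x (x + y) k + edge (x + y) (x + y + z) k) F
        \<le> L2_set (\<lambda>x. edge x (x + y) k) F + L2_set (\<lambda>x. edge (x + y) (x + y + z) k) F"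
      by (rule L2_set_triangle_ineq)
    also have "L2_set (\<lambda>x. edge (x + y + z) x k) F = grad k (y + z)"
      unfolding grad_eq_L2_set[OF that F(1,2)] by (subst edge_commute) (simp add: add.assoc)
    finally show ?thesis using gz[OF that] grad_eq_L2_set[OF that F(1,3)] by simp
  qed
  let ?b = "\<lambda>x. bond_drift x (x + y) h g + bond_drift (x + y) (x + y + z) h g + bond_drift (x + y + z) x h g"
  have eq: "drift h g y + drift h g z - drift h g (y + z) = (\<Sum>x\<in>F. ?b x)"
  proof -
    have "(\<Sum>x\<in>F. bond_drift (x + y + z) x h g) = - (\<Sum>x\<in>F. bond_drift x (x + (y + z)) h g)"
      unfolding sum_negf [symmetric]
      by (intro sum.cong refl) (subst bond_drift_commute, simp add: add.assoc)
    then show ?thesis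
      unfolding drift_eq_sum[OF A(2) F(1,2)] drift_eq_sum[OF A(2) F(1,3)] dz sum.distrib by simp
  qed
  have "\<bar>\<Sum>x\<in>F. ?b x\<bar> \<le> (\<Sum>x\<in>F. ?e h x * ?e g x)"
    by (rule order.trans[OF sum_abs], rule sum_mono, rule triangle_drift[OF h g])
  also have "\<dots> = (\<Sum>x\<in>F. \<bar>?e h x\<bar> * \<bar>?e g x\<bar>)"
    by (subst (1 2) abs_of_nonneg) (simp_all only: add_nonneg_nonneg edge_nonneg)
  also have "\<dots> \<le> L2_set (?e h) F * L2_set (?e g) F" by (rule L2_set_mult_ineq)
  also have "\<dots> \<le> (grad h y + grad h z + grad h (y + z)) * (grad g y + grad g z + grad g (y + z))"
    by (intro mult_mono L2 A) (simp_all add: L2_set_nonneg)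
  finally show ?thesis unfolding eq .
qed

text \<open>For each of the two functions the three gradients in \<open>drift_add\<close> sum to at
  most \<open>4 (|y| + |z| + |y + z|) <= 8 (|y| + |z|)\<close> times the root of its energy; hence
  64.\<close>

lemma drift_almost_linear:
  assumes h: "local_function h" and g: "local_function g"
  shows "\<bar>drift h g y - (\<Sum>i\<in>UNIV. real_of_int (y $ i) * drift h g (axis i 1))\<bar>
    \<le> (real CARD('d) + 7) * (64 * sqrt (energy h) * sqrt (energy g)) * (norm1 y)\<^sup>2"
proof (rule almost_additive[where g = "drift h g" and C = "64 * sqrt (energy h) * sqrt (energy g)"])
  fix y z :: "int ^ 'd"
  have le: "grad k y + grad k z + grad k (y + z) \<le> 8 * (norm1 y + norm1 z) * sqrt (energy k)"
    if k: "local_function k" for k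
  proof -
    have "4 * norm1 (y + z) * sqrt (energy k) \<le> 4 * (norm1 y + norm1 z) * sqrt (energy k)"
      by (intro mult_right_mono mult_left_mono norm1_triangle) auto
    then show ?thesis
      using grad_le_energy[OF k, of y] grad_le_energy[OF k, of z] grad_le_energy[OF k, of "y + z"]
      by (simp add: algebra_simps)
  qed
  have "\<bar>drift h g y + drift h g z - drift h g (y + z)\<bar>
      \<le> (grad h y + grad h z + grad h (y + z)) * (grad g y + grad g z + grad g (y + z))"
    by (rule drift_add[OF h g])
  also have "\<dots> \<le> (8 * (norm1 y + norm1 z) * sqrt (energy h)) * (8 * (norm1 y + norm1 z) * sqrt (energy g))"
    by (intro mult_mono le h g) simp_all
  finally show "\<bar>drift h g y + drift h g z - drift h g (y + z)\<bar>
      \<le> 64 * sqrt (energy h) * sqrt (energy g) * (norm1 y + norm1 z)\<^sup>2"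
    by (simp add: power2_eq_square algebra_simps)
qed simp

lemma form_le_grad:
  assumes h: "local_function h" and g: "local_function g"
  shows "\<bar>form h g y\<bar> \<le> grad h y * grad g y"
proof -
  obtain A where A: "local_on A h" "local_on A g" "finite A"
    using local_function_common[OF h g] .
  let ?F = "touching A y"
  have F: "finite ?F" using A(3) by (rule finite_touching)
  have "\<bar>form h g y\<bar> \<le> (\<Sum>x\<in>?F. \<bar>edge x (x + y) h\<bar> * \<bar>edge x (x + y) g\<bar>)"
    unfolding form_eq_sum[OF A(2) F order_refl] bond_form_def edge_def
    using h g by (intro order.trans[OF sum_abs] sum_mono) (simp add: expectation_mult_le_l2)
  also have "\<dots> \<le> L2_set (\<lambda>x. edge x (x + y) h) ?F * L2_set (\<lambda>x. edge x (x + y) g) ?F"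
    by (rule L2_set_mult_ineq)
  finally show ?thesis
    using grad_eq_L2_set[OF A(1) F order_refl] grad_eq_L2_set[OF A(2) F order_refl] by simp
qed

lemma form_self: "form g g y = (grad g y)\<^sup>2"
proof -
  have "bond_form x z g g = (edge x z g)\<^sup>2" for x z
    unfolding bond_form_def edge_def l2_power2 by (simp add: power2_eq_square)
  then show ?thesis
    by (simp add: form_def grad_def infsum_nonneg)
qed

text \<open>The expectation for the bond from \<open>x\<close> to \<open>x + y\<close> is a
  difference \<open>c x - c (x + y)\<close> with \<open>c\<close> of finite support, so the sum over
  all translates telescopes.\<close>

lemma current_sum_zero:
  assumes A: "local_on A h" and F: "finite F" "touching A y \<subseteq> F"
  shows "(\<Sum>x\<in>F. expectation (\<lambda>\<eta>. h \<eta> * current \<eta> x (x + y))) = 0"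
proof -
  have h: "local_function h" using A by (rule local_on_imp_local)
  have "infinite (UNIV :: (int ^ 'd) set)"
    using infinite_UNIV_int by (intro infinite_UNIV_vec) simp
  then obtain u where u: "u \<notin> A" using ex_new_if_finite[OF _ local_on_finite[OF A]] by blast
  \<comment> \<open>Far from the support of \<open>h\<close> the expectation of \<open>h\<close>
    times the occupation is constant but in general not 0. Subtracting its value at an outside site
    \<open>u\<close> makes \<open>c\<close> finitely supported: exchanging \<open>x\<close> with
    \<open>u\<close> does not affect \<open>h\<close>.\<close>
  define c where "c = (\<lambda>x. expectation (\<lambda>\<eta>. h \<eta> * of_bool (\<eta> x)) - expectation (\<lambda>\<eta>. h \<eta> * of_bool (\<eta> u)))"
  have c0: "c x = 0" if "x \<notin> A" for x
    using expectation_exchange[of "\<lambda>\<eta>. h \<eta> * of_bool (\<eta> u)" x u] h local_on_exchange_outside[OF A that u]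
    by (simp add: c_def exchange_apply)
  have "expectation (\<lambda>\<eta>. h \<eta> * current \<eta> x (x + y)) = c x - c (x + y)" for x
  proof -
    have "expectation (\<lambda>\<eta>. h \<eta> * of_bool (\<eta> x) - h \<eta> * of_bool (\<eta> (x + y)))
      = expectation (\<lambda>\<eta>. h \<eta> * of_bool (\<eta> x)) - expectation (\<lambda>\<eta>. h \<eta> * of_bool (\<eta> (x + y)))"
      using h by (intro Bochner_Integration.integral_diff local_integrable) auto
    then show ?thesis by (simp add: c_def current_def right_diff_distrib)
  qed
  then have "(\<Sum>x\<in>F. expectation (\<lambda>\<eta>. h \<eta> * current \<eta> x (x + y))) = (\<Sum>x\<in>F. c x) - (\<Sum>x\<in>F. c (x + y))"
    by (simp add: sum_subtractf)
  also have "(\<Sum>x\<in>F. c x) = infsum c UNIV"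
    by (rule infsum_finite_support [symmetric, OF F(1)], rule c0) (use F(2) not_touching[of _ A y] in auto)
  also have "(\<Sum>x\<in>F. c (x + y)) = (\<Sum>\<^sub>\<infinity>x. c (x + y))"
    by (rule infsum_finite_support [symmetric, OF F(1)], rule c0) (use F(2) not_touching[of _ A y] in auto)
  finally show ?thesis by (simp add: infsum_translate)
qed

text \<open>The cross term is odd under the exchange and vanishes; what remains is the total current
  weighted by \<open>g^2\<close>, which is 0 by \<open>current_sum_zero\<close>. So the drift is
  invisible in the Dirichlet form.\<close>

lemma drift_self:
  assumes g: "local_function g" shows "drift g g y = 0"
proof -
  obtain A where A: "local_on A g" using g by (rule local_functionE)
  have fin: "finite (touching A y)" using local_on_finite[OF A] by (rule finite_touching)
  have "bond_drift x z g g = - expectation (\<lambda>\<eta>. (g \<eta>)\<^sup>2 * current \<eta> x z)" for x z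
  proof -
    let ?k = "\<lambda>\<eta>. g \<eta> * current \<eta> x z * g (exchange \<eta> x z)"
    have "expectation ?k = expectation (\<lambda>\<eta>. - ?k \<eta>)"
      using expectation_exchange[of ?k x z] g by (simp add: current_exchange algebra_simps)
    then have "expectation ?k = 0" by simp
    moreover have "bond_drift x z g g = expectation ?k - expectation (\<lambda>\<eta>. (g \<eta>)\<^sup>2 * current \<eta> x z)"
      unfolding bond_drift_def using g
      by (subst Bochner_Integration.integral_diff [symmetric]) (auto simp: algebra_simps power2_eq_square)
    ultimately show ?thesis by simp
  qed
  moreover have "local_on A (\<lambda>\<eta>. (g \<eta>)\<^sup>2)"
    using local_on_comp2[OF A A, of "\<lambda>v _. v\<^sup>2"] by simp
  ultimately show ?thesis
    using current_sum_zero[OF _ fin order_refl] by (simp add: drift_eq_sum[OF A fin order_refl] sum_negf)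
qed

text \<open>Stationarity of the measure for jumps by \<open>y\<close>: after symmetrization only the
  total current weighted by \<open>g\<close> is left.\<close>

lemma drift_const:
  assumes g: "local_function g" shows "drift (\<lambda>_. c) g y = 0"
proof -
  obtain A where A: "local_on A g" using g by (rule local_functionE)
  have fin: "finite (touching A y)" using local_on_finite[OF A] by (rule finite_touching)
  have "bond_drift x z (\<lambda>_. c) g = - 2 * c * expectation (\<lambda>\<eta>. g \<eta> * current \<eta> x z)" for x z
  proof -
    have "expectation (\<lambda>\<eta>. c * (current \<eta> x z * g (exchange \<eta> x z)))
        = expectation (\<lambda>\<eta>. - c * (g \<eta> * current \<eta> x z))"
      using expectation_exchange[of "\<lambda>\<eta>. - c * (g \<eta> * current \<eta> x z)" x z] g
      by (simp add: current_exchange algebra_simps)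
    moreover have "bond_drift x z (\<lambda>_. c) g = expectation (\<lambda>\<eta>. c * (current \<eta> x z * g (exchange \<eta> x z)))
        - expectation (\<lambda>\<eta>. c * (g \<eta> * current \<eta> x z))"
      unfolding bond_drift_def using g
      by (subst Bochner_Integration.integral_diff [symmetric]) (auto simp: algebra_simps)
    ultimately show ?thesis by simp
  qed
  then show ?thesis
    using current_sum_zero[OF A fin order_refl]
    by (simp add: drift_eq_sum[OF A fin order_refl] sum_negf flip: sum_distrib_left)
qed

end

section \<open>The exclusion operator on local functions\<close>

lemma compact_configs: "compact (UNIV :: 'd::finite config set)"
proof -
  have "compact_space (euclidean :: bool topology)"
    by (simp add: compact_space_def compactin_euclidean_iff finite_imp_compact)
  then have "compact_space (product_topology (\<lambda>_ :: int ^ 'd. euclidean :: bool topology) UNIV)"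
    by (simp add: compact_space_product_topology)
  then show ?thesis
    by (simp add: euclidean_product_topology compact_space_def compactin_euclidean_iff)
qed

text \<open>By compactness finitely many cylinders, on each of which \<open>g\<close> stays within
  \<open>e / 2\<close> of its value at a centre, cover the space. Altering sites outside their
  supports does not leave a cylinder.\<close>

lemma continuous_local_approx:
  fixes g :: "'d::finite config \<Rightarrow> real"
  assumes g: "continuous_on UNIV g" and e: "0 < e"
  obtains h where "local_function h" "\<And>\<eta>. \<bar>g \<eta> - h \<eta>\<bar> < e"
proof -
  let ?cyl = "\<lambda>A \<eta>. {\<xi> :: 'd config. \<forall>x\<in>A. \<xi> x = \<eta> x}"
  have ex: "\<exists>A. finite A \<and> (\<forall>\<xi>\<in>?cyl A \<eta>. \<bar>g \<xi> - g \<eta>\<bar> < e / 2)" for \<eta>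
  proof -
    have "open {\<xi>. \<bar>g \<xi> - g \<eta>\<bar> < e / 2}"
      using g by (intro open_Collect_less continuous_intros)
    then obtain X where X: "\<eta> \<in> (\<Pi>\<^sub>E i\<in>UNIV. X i)" "finite {i. X i \<noteq> topspace (euclidean :: bool topology)}"
        "(\<Pi>\<^sub>E i\<in>UNIV. X i) \<subseteq> {\<xi>. \<bar>g \<xi> - g \<eta>\<bar> < e / 2}"
      using e product_topology_open_contains_basis[of "\<lambda>_. euclidean" UNIV "{\<xi>. \<bar>g \<xi> - g \<eta>\<bar> < e / 2}" \<eta>]
      unfolding open_fun_def by auto
    have inPi: "\<xi> \<in> (\<Pi>\<^sub>E i\<in>UNIV. X i)" if "\<xi> \<in> ?cyl {i. X i \<noteq> UNIV} \<eta>" for \<xi>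
    proof -
      have "\<xi> i \<in> X i" for i
        using that X(1) by (cases "X i = UNIV") (auto simp: PiE_iff)
      then show ?thesis by auto
    qed
    have "\<bar>g \<xi> - g \<eta>\<bar> < e / 2" if "\<xi> \<in> ?cyl {i. X i \<noteq> UNIV} \<eta>" for \<xi>
      using subsetD[OF X(3) inPi[OF that]] by simp
    moreover have "finite {i. X i \<noteq> UNIV}" using X(2) by simp
    ultimately show ?thesis by blast
  qed
  obtain A where A: "\<forall>\<eta>. finite (A \<eta>) \<and> (\<forall>\<xi>\<in>?cyl (A \<eta>) \<eta>. \<bar>g \<xi> - g \<eta>\<bar> < e / 2)"
    using choice[of "\<lambda>\<eta> A. finite A \<and> (\<forall>\<xi>\<in>?cyl A \<eta>. \<bar>g \<xi> - g \<eta>\<bar> < e / 2)"] ex by auto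
  have cyl_open: "open (?cyl (A \<eta>) \<eta>)" for \<eta>
  proof -
    have "?cyl (A \<eta>) \<eta> = (\<Inter>x\<in>A \<eta>. (\<lambda>\<xi>. \<xi> x) -` {\<eta> x})" by auto
    also have "open \<dots>"
    proof (rule open_INT)
      show "finite (A \<eta>)" using A by blast
      show "\<forall>x\<in>A \<eta>. open ((\<lambda>\<xi> :: 'd config. \<xi> x) -` {\<eta> x})"
      proof
        fix x
        have "continuous_on UNIV (\<lambda>\<xi> :: 'd config. \<xi> x)"
          by (rule continuous_on_product_coordinates)
        moreover have "open {\<eta> x}" by (rule Topological_Spaces.open_discrete)
        ultimately show "open ((\<lambda>\<xi> :: 'd config. \<xi> x) -` {\<eta> x})"
          using continuous_on_open_vimage[OF open_UNIV, of "\<lambda>\<xi> :: 'd config. \<xi> x"] by simp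
      qed
    qed
    finally show ?thesis .
  qed
  have "UNIV \<subseteq> (\<Union>\<eta>\<in>UNIV. ?cyl (A \<eta>) \<eta>)" by auto
  then obtain D where D: "D \<subseteq> UNIV" "finite D" "UNIV \<subseteq> (\<Union>\<eta>\<in>D. ?cyl (A \<eta>) \<eta>)"
    by (rule compactE_image[OF compact_configs, of UNIV "\<lambda>\<eta>. ?cyl (A \<eta>) \<eta>", rotated])
       (assumption | rule cyl_open)+
  define B where "B = (\<Union>\<eta>\<in>D. A \<eta>)"
  \<comment> \<open>The value of \<open>g\<close> after emptying every site outside
    \<open>B\<close>.\<close>
  define h where "h = (\<lambda>\<xi>. g (\<lambda>x. x \<in> B \<and> \<xi> x))"
  have "finite B" using A D(2) by (auto simp: B_def)
  moreover have "h \<xi> = h \<eta>" if "\<forall>x\<in>B. \<xi> x = \<eta> x" for \<xi> \<eta>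
  proof -
    have "(\<lambda>x. x \<in> B \<and> \<xi> x) = (\<lambda>x. x \<in> B \<and> \<eta> x)" using that by auto
    then show ?thesis by (simp add: h_def)
  qed
  ultimately have h: "local_function h" unfolding local_function_def by (intro exI[of _ B]) simp
  have "\<bar>g \<xi> - h \<xi>\<bar> < e" for \<xi>
  proof -
    obtain \<eta> where \<eta>: "\<eta> \<in> D" "\<xi> \<in> ?cyl (A \<eta>) \<eta>" using D(3) by blast
    then have "(\<lambda>x. x \<in> B \<and> \<xi> x) \<in> ?cyl (A \<eta>) \<eta>" by (auto simp: B_def)
    then have "\<bar>h \<xi> - g \<eta>\<bar> < e / 2" "\<bar>g \<xi> - g \<eta>\<bar> < e / 2"
      unfolding h_def using A \<eta>(2) by blast+
    then show ?thesis by linarith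
  qed
  with h show ?thesis by (rule that)
qed

lemma continuous_config_bounded:
  fixes g :: "'d::finite config \<Rightarrow> real"
  assumes "continuous_on UNIV g" obtains C where "0 < C" "\<And>\<eta>. \<bar>g \<eta>\<bar> \<le> C"
proof -
  have "bounded (range g)"
    using compact_configs assms by (intro compact_imp_bounded compact_continuous_image)
  then obtain C where "0 < C" "\<And>\<eta>. \<bar>g \<eta>\<bar> \<le> C" unfolding bounded_pos by auto
  then show ?thesis by (rule that)
qed

text \<open>Measurability for the product sigma-algebra is inherited from local functions through
  approximation.\<close>

lemma continuous_config_measurable:
  fixes g :: "'d::finite config \<Rightarrow> real"
  assumes g: "continuous_on UNIV g" shows "g \<in> borel_measurable config_algebra"
proof -
  have "\<forall>n. \<exists>h. local_function h \<and> (\<forall>\<eta>. \<bar>g \<eta> - h \<eta>\<bar> < inverse (real (Suc n)))"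
  proof
    fix n
    show "\<exists>h. local_function h \<and> (\<forall>\<eta>. \<bar>g \<eta> - h \<eta>\<bar> < inverse (real (Suc n)))"
      by (rule continuous_local_approx[OF g, of "inverse (real (Suc n))"]) auto
  qed
  from choice[OF this] obtain h where hh: "\<forall>n. local_function (h n) \<and> (\<forall>\<eta>. \<bar>g \<eta> - h n \<eta>\<bar> < inverse (real (Suc n)))" by blast
  have h: "local_function (h n)" "\<bar>g \<eta> - h n \<eta>\<bar> < inverse (real (Suc n))" for n \<eta>
    using hh by simp_all
  show ?thesis
  proof (rule borel_measurable_LIMSEQ_real)
    show "h n \<in> borel_measurable config_algebra" for n
      using h(1) by (rule local_function_measurable)
    show "(\<lambda>n. h n \<eta>) \<longlonglongrightarrow> g \<eta>" for \<eta>
    proof (rule Lim_transform)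
      show "(\<lambda>n. g \<eta>) \<longlonglongrightarrow> g \<eta>" by simp
      have "(\<lambda>n. h n \<eta> - g \<eta>) \<longlonglongrightarrow> 0"
        by (rule Lim_null_comparison[OF _ LIMSEQ_inverse_real_of_nat])
           (use h(2)[of \<eta>] in \<open>auto intro!: always_eventually less_imp_le simp: abs_minus_commute\<close>)
      then show "(\<lambda>n. h n \<eta> - g \<eta>) \<longlonglongrightarrow> 0" .
    qed
  qed
qed

text \<open>The truncation error depends on \<open>k\<close> only through its bound
  \<open>M\<close>. Applied to a family indexed by configurations, this gives uniform
  convergence.\<close>

lemma weighted_tail_bound:
  fixes q k :: "'a \<Rightarrow> real"
  assumes q: "(q has_sum s) UNIV" "\<And>y. 0 \<le> q y" and k: "\<And>y. \<bar>k y\<bar> \<le> M"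
    and sum: "((\<lambda>y. q y * k y) has_sum S) UNIV" and F: "finite F"
  shows "\<bar>S - (\<Sum>y\<in>F. q y * k y)\<bar> \<le> M * (s - (\<Sum>y\<in>F. q y))"
proof -
  have tail: "((\<lambda>y. q y * k y) has_sum (S - (\<Sum>y\<in>F. q y * k y))) (UNIV - F)"
    by (rule has_sum_Diff[OF sum]) (use F in \<open>auto intro: has_sum_finite\<close>)
  have "(q has_sum (s - (\<Sum>y\<in>F. q y))) (UNIV - F)"
    by (rule has_sum_Diff[OF q(1)]) (use F in \<open>auto intro: has_sum_finite\<close>)
  then have Mq: "((\<lambda>y. M * q y) has_sum (M * (s - (\<Sum>y\<in>F. q y)))) (UNIV - F)"
    by (rule has_sum_cmult_right)
  have le: "q y * k y \<le> M * q y" "- (q y * k y) \<le> M * q y" for y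
  proof -
    have "k y \<le> M" "- k y \<le> M" using k[of y] by auto
    from this[THEN mult_left_mono, OF q(2)[of y]] show "q y * k y \<le> M * q y" "- (q y * k y) \<le> M * q y"
      by (simp_all add: mult.commute)
  qed
  have "S - (\<Sum>y\<in>F. q y * k y) \<le> M * (s - (\<Sum>y\<in>F. q y))"
    by (rule has_sum_mono[OF tail Mq]) (rule le)
  moreover have "- (S - (\<Sum>y\<in>F. q y * k y)) \<le> M * (s - (\<Sum>y\<in>F. q y))"
    by (rule has_sum_mono[OF has_sum_uminusI[OF tail] Mq]) (rule le)
  ultimately show ?thesis by linarith
qed

definition shift_gen :: "int ^ 'd \<Rightarrow> ('d config \<Rightarrow> real) \<Rightarrow> 'd config \<Rightarrow> real" where
  "shift_gen y g \<eta> =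
     (\<Sum>\<^sub>\<infinity>x. of_bool (\<eta> x) * (1 - of_bool (\<eta> (x + y))) * (g (exchange \<eta> x (x + y)) - g \<eta>))"

lemma exclusion_term_outside:
  assumes "local_on A g" "x \<notin> touching A y"
  shows "g (exchange \<eta> x (x + y)) = g \<eta>"
  using local_on_exchange_outside[OF assms(1) not_touching[OF assms(2)]] by simp

lemma shift_gen_eq_sum:
  assumes "local_on A g"
  shows "shift_gen y g \<eta> = (\<Sum>x\<in>touching A y.
    of_bool (\<eta> x) * (1 - of_bool (\<eta> (x + y))) * (g (exchange \<eta> x (x + y)) - g \<eta>))"
  unfolding shift_gen_def
  by (rule infsum_finite_support[OF finite_touching[OF local_on_finite[OF assms]]])
     (simp add: exclusion_term_outside[OF assms])

lemma local_function_shift_gen [intro, simp]: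
  assumes g: "local_function g" shows "local_function (shift_gen y g)"
proof -
  obtain A where A: "local_on A g" using g by (rule local_functionE)
  have "local_function (\<lambda>\<eta>. \<Sum>x\<in>touching A y.
      of_bool (\<eta> x) * (1 - of_bool (\<eta> (x + y))) * (g (exchange \<eta> x (x + y)) - g \<eta>))"
    using g by (intro local_function_sum local_function_mult local_function_diff) auto
  then show ?thesis by (simp flip: shift_gen_eq_sum[OF A])
qed

lemma card_touching_le: "finite A \<Longrightarrow> card (touching A y) \<le> 2 * card A"
  unfolding touching_def
  using card_Un_le[of A "(\<lambda>x. x - y) ` A"] card_image_le[of A "\<lambda>x. x - y"] by linarith

lemma abs_exclusion_term_le:
  fixes C :: real
  assumes "\<And>\<eta>. \<bar>g \<eta>\<bar> \<le> C"
  shows "\<bar>of_bool a * (1 - of_bool b) * (g \<eta> - g \<xi>)\<bar> \<le> 2 * C"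
  using assms[of \<eta>] assms[of \<xi>] by (cases a; cases b) auto

lemma abs_shift_gen_le:
  assumes A: "local_on A g" and C: "\<And>\<eta>. \<bar>g \<eta>\<bar> \<le> C"
  shows "\<bar>shift_gen y g \<eta>\<bar> \<le> 4 * real (card A) * C"
proof -
  have C0: "0 \<le> C" using C[of \<eta>] by linarith
  have "\<bar>shift_gen y g \<eta>\<bar> \<le> (\<Sum>x\<in>touching A y. 2 * C)"
    unfolding shift_gen_eq_sum[OF A]
  proof (rule order.trans[OF sum_abs], rule sum_mono)
    fix x
    show "\<bar>of_bool (\<eta> x) * (1 - of_bool (\<eta> (x + y))) * (g (exchange \<eta> x (x + y)) - g \<eta>)\<bar> \<le> 2 * C"
      by (rule abs_exclusion_term_le[of g C, OF C])
  qed
  also have "\<dots> = 2 * C * real (card (touching A y))" by simp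
  also have "\<dots> \<le> 2 * C * real (2 * card A)"
    using card_touching_le[OF local_on_finite[OF A]] C0 by (intro mult_left_mono) (simp_all only: of_nat_le_iff)
  finally show ?thesis by (simp add: algebra_simps)
qed

text \<open>Regrouping the double sum by jumps needs absolute summability: for each \<open>y\<close>
  at most \<open>2 card A\<close> bonds meet the support, and each term is at most
  \<open>2 C q y\<close>.\<close>

lemma exclusion_operator_has_sum:
  fixes q :: "int ^ 'd \<Rightarrow> real"
  assumes q: "jump_probability q" and A: "local_on A g"
  shows "((\<lambda>y. q y * shift_gen y g \<eta>) has_sum exclusion_operator q g \<eta>) UNIV"
proof -
  have q0: "0 \<le> q y" for y using q by (simp add: jump_probability_def)
  have qsum: "q summable_on UNIV" using q by (auto simp: jump_probability_def intro: has_sum_imp_summable)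
  have finA: "finite A" using A by (rule local_on_finite)
  obtain C where C: "0 < C" "\<And>\<eta>. \<bar>g \<eta>\<bar> \<le> C"
    using local_function_bounded[OF local_on_imp_local[OF A]] by blast
  let ?s = "\<lambda>y x. of_bool (\<eta> x) * (1 - of_bool (\<eta> (x + y))) * (g (exchange \<eta> x (x + y)) - g \<eta>)"
  define t where "t = (\<lambda>(y, x). q y * ?s y x)"
  define G where "G = (\<lambda>(y, x). q y * (2 * C) * of_bool (x \<in> touching A y))"
  have row: "((\<lambda>x. t (y, x)) has_sum q y * shift_gen y g \<eta>) UNIV" for y
    unfolding t_def case_prod_conv
  proof (rule has_sum_cmult_right)
    show "(?s y has_sum shift_gen y g \<eta>) UNIV"
      unfolding shift_gen_eq_sum[OF A]
      by (rule has_sum_finite_neutralI[OF finite_touching[OF finA, of y]]) (simp_all add: exclusion_term_outside[OF A])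
  qed
  have "G summable_on (SIGMA y:UNIV. UNIV)"
  proof (rule summable_on_SigmaI)
    show "((\<lambda>x. G (y, x)) has_sum q y * (2 * C) * real (card (touching A y))) UNIV" for y
      by (rule has_sum_finite_neutralI[OF finite_touching[OF finA, of y]]) (simp_all add: G_def)
    have "(\<lambda>y. q y * (4 * real (card A) * C)) summable_on UNIV"
      using qsum by (rule summable_on_cmult_left)
    then show "(\<lambda>y. q y * (2 * C) * real (card (touching A y))) summable_on UNIV"
    proof (rule summable_on_comparison_test)
      fix y
      have "real (card (touching A y)) \<le> real (2 * card A)"
        using card_touching_le[OF finA] by (simp only: of_nat_le_iff)
      then have "q y * (2 * C) * real (card (touching A y)) \<le> q y * (2 * C) * real (2 * card A)"
        using q0 C(1) by (intro mult_left_mono) auto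
      then show "q y * (2 * C) * real (card (touching A y)) \<le> q y * (4 * real (card A) * C)"
        by (simp add: algebra_simps)
    qed (use q0 C(1) in auto)
  qed (use q0 C(1) in \<open>auto simp: G_def\<close>)
  then have "(\<lambda>p. norm (G p)) summable_on (SIGMA y:UNIV. UNIV)"
    by (rule summable_on_iff_abs_summable_on_real[THEN iffD1])
  then have "(\<lambda>p. norm (t p)) summable_on (SIGMA y:UNIV. UNIV)"
  proof (rule Infinite_Sum.abs_summable_on_comparison_test)
    fix p :: "(int ^ 'd) \<times> (int ^ 'd)"
    obtain y x where p: "p = (y, x)" by (cases p)
    show "norm (t p) \<le> norm (G p)"
    proof (cases "x \<in> touching A y")
      case True
      have "q y * \<bar>?s y x\<bar> \<le> q y * (2 * C)"
        using abs_exclusion_term_le[of g C, OF C(2)] q0 by (rule mult_left_mono)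
      then show ?thesis using True q0[of y] C(1) by (simp add: p t_def G_def abs_mult)
    qed (simp add: p t_def G_def exclusion_term_outside[OF A])
  qed
  then have "t summable_on (SIGMA y:UNIV. UNIV)" by (rule Infinite_Sum.abs_summable_summable)
  then have "(t has_sum infsum t (SIGMA y:UNIV. UNIV)) (SIGMA y:UNIV. UNIV)" by (rule has_sum_infsum)
  then have "((\<lambda>y. q y * shift_gen y g \<eta>) has_sum infsum t (SIGMA y:UNIV. UNIV)) UNIV"
    by (rule has_sum_SigmaD) (rule row)
  moreover have "infsum t (UNIV \<times> UNIV) = exclusion_operator q g \<eta>"
  proof -
    have "infsum t (UNIV \<times> UNIV) = (\<Sum>\<^sub>\<infinity>p\<in>UNIV \<times> UNIV. t (prod.swap p))"
      by (rule infsum_reindex_bij_betw [symmetric]) (auto simp: bij_betw_def inj_on_def image_iff)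
    then show ?thesis
      by (simp add: exclusion_operator_def t_def case_prod_unfold mult.assoc)
  qed
  ultimately show ?thesis by simp
qed

lemma exclusion_operator_tail:
  assumes q: "jump_probability q" and A: "local_on A g" and C: "\<And>\<eta>. \<bar>g \<eta>\<bar> \<le> C" and F: "finite F"
  shows "\<bar>exclusion_operator q g \<eta> - (\<Sum>y\<in>F. q y * shift_gen y g \<eta>)\<bar>
    \<le> 4 * real (card A) * C * (1 - (\<Sum>y\<in>F. q y))"
  using q abs_shift_gen_le[OF A C] exclusion_operator_has_sum[OF q A] F
  by (intro weighted_tail_bound[where k = "\<lambda>y. shift_gen y g \<eta>"]) (auto simp: jump_probability_def)

text \<open>Uniformity makes the image of a local function continuous, though in general not local,
  and allows expectations to be taken jump by jump.\<close>

lemma exclusion_operator_uniform_limit: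
  assumes q: "jump_probability q" and g: "local_function g"
  shows "uniform_limit UNIV (\<lambda>F \<eta>. \<Sum>y\<in>F. q y * shift_gen y g \<eta>) (exclusion_operator q g)
    (finite_subsets_at_top UNIV)"
proof (rule uniform_limitI)
  fix e :: real assume e: "0 < e"
  obtain A where A: "local_on A g" using g by (rule local_functionE)
  obtain C where C: "0 < C" "\<And>\<eta>. \<bar>g \<eta>\<bar> \<le> C" using local_function_bounded[OF g] by blast
  let ?M = "4 * real (card A) * C"
  have "((\<lambda>F. ?M * (1 - sum q F)) \<longlongrightarrow> ?M * (1 - 1)) (finite_subsets_at_top UNIV)"
    using q unfolding jump_probability_def has_sum_def by (intro tendsto_intros) auto
  then have "\<forall>\<^sub>F F in finite_subsets_at_top UNIV. ?M * (1 - sum q F) < e"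
    using e by (intro order_tendstoD) auto
  moreover have "\<forall>\<^sub>F F in finite_subsets_at_top UNIV. finite F"
    by (rule eventually_finite_subsets_at_top_weakI) auto
  ultimately show "\<forall>\<^sub>F F in finite_subsets_at_top UNIV. \<forall>\<eta>\<in>UNIV.
      dist (\<Sum>y\<in>F. q y * shift_gen y g \<eta>) (exclusion_operator q g \<eta>) < e"
  proof eventually_elim
    case (elim F)
    then show ?case
      using exclusion_operator_tail[OF q A C(2), of F]
      by (auto simp: dist_real_def abs_minus_commute intro: le_less_trans)
  qed
qed

lemma local_function_cmult [intro, simp]: "local_function g \<Longrightarrow> local_function (\<lambda>\<eta>. c * g \<eta>)"
  by (rule local_function_comp[where F = "\<lambda>v. c * v"])

lemma exclusion_operator_continuous:
  assumes q: "jump_probability q" and g: "local_function g"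
  shows "continuous_on UNIV (exclusion_operator q g)"
proof (rule uniform_limit_theorem[OF _ exclusion_operator_uniform_limit[OF q g]])
  show "\<forall>\<^sub>F F in finite_subsets_at_top UNIV. continuous_on UNIV (\<lambda>\<eta>. \<Sum>y\<in>F. q y * shift_gen y g \<eta>)"
    using g by (intro always_eventually allI local_function_continuous local_function_sum
        local_function_cmult local_function_shift_gen)
qed simp

lemma exclusion_operator_linear:
  assumes q: "jump_probability q" and g: "local_function g" and h: "local_function h"
  shows "exclusion_operator q (\<lambda>\<eta>. a * g \<eta> + b * h \<eta>) \<eta>
    = a * exclusion_operator q g \<eta> + b * exclusion_operator q h \<eta>"
proof -
  obtain A where A: "local_on A g" "local_on A h" "finite A"
    using local_function_common[OF g h] .
  have "local_on (A \<union> A) (\<lambda>\<eta>. a * g \<eta> + b * h \<eta>)"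
    by (rule local_on_comp2[OF A(1,2)])
  then have loc: "local_on A (\<lambda>\<eta>. a * g \<eta> + b * h \<eta>)" by simp
  have "shift_gen y (\<lambda>\<eta>. a * g \<eta> + b * h \<eta>) \<eta> = a * shift_gen y g \<eta> + b * shift_gen y h \<eta>" for y
    unfolding shift_gen_eq_sum[OF A(1)] shift_gen_eq_sum[OF A(2)] shift_gen_eq_sum[OF loc]
    by (simp add: sum_distrib_left algebra_simps flip: sum.distrib)
  then have "q y * shift_gen y (\<lambda>\<eta>. a * g \<eta> + b * h \<eta>) \<eta>
      = a * (q y * shift_gen y g \<eta>) + b * (q y * shift_gen y h \<eta>)" for y
    by (simp add: algebra_simps)
  moreover have "((\<lambda>y. a * (q y * shift_gen y g \<eta>) + b * (q y * shift_gen y h \<eta>)) has_sum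
      a * exclusion_operator q g \<eta> + b * exclusion_operator q h \<eta>) UNIV"
    by (intro has_sum_add has_sum_cmult_right exclusion_operator_has_sum[OF q A(1)] exclusion_operator_has_sum[OF q A(2)])
  ultimately show ?thesis
    using has_sum_unique[OF exclusion_operator_has_sum[OF q loc]] by simp
qed

section \<open>The bilinear form of the exclusion operator\<close>

context exchangeable
begin

lemma continuous_integrable:
  fixes g :: "'d config \<Rightarrow> real"
  assumes "continuous_on UNIV g" shows "integrable \<mu> g"
proof -
  obtain C where C: "\<And>\<eta>. \<bar>g \<eta>\<bar> \<le> C" using continuous_config_bounded[OF assms] by blast
  have "AE \<eta> in \<mu>. norm (g \<eta>) \<le> C" using C by simp
  moreover have "g \<in> borel_measurable \<mu>"
    unfolding measurable_eq by (rule continuous_config_measurable[OF assms])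
  ultimately show ?thesis by (rule integrable_const_bound)
qed

lemma abs_expectation_le:
  fixes g :: "'d config \<Rightarrow> real"
  assumes g: "continuous_on UNIV g" and B: "\<And>\<eta>. \<bar>g \<eta>\<bar> \<le> B"
  shows "\<bar>expectation g\<bar> \<le> B"
proof -
  have "\<bar>expectation g\<bar> \<le> expectation (\<lambda>\<eta>. \<bar>g \<eta>\<bar>)"
    by (rule integral_abs_bound)
  also have "\<dots> \<le> expectation (\<lambda>_. B)"
    by (rule integral_mono) (use B continuous_integrable[OF g] in auto)
  finally show ?thesis by (simp add: prob_space)
qed

text \<open>If the two occupations agree the exchange does nothing; otherwise the rate is
  \<open>(1 + current) / 2\<close>. The half without current becomes the symmetric form after
  averaging over the exchange.\<close>

lemma expectation_bond_generator:
  assumes h: "local_function h" and g: "local_function g"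
  shows "expectation (\<lambda>\<eta>. h \<eta> * (of_bool (\<eta> x) * (1 - of_bool (\<eta> z)) * (g (exchange \<eta> x z) - g \<eta>)))
    = bond_drift x z h g / 2 - bond_form x z h g / 4"
proof -
  let ?d = "\<lambda>\<eta>. g (exchange \<eta> x z) - g \<eta>"
  have "(\<lambda>\<eta>. h \<eta> * (of_bool (\<eta> x) * (1 - of_bool (\<eta> z)) * ?d \<eta>))
      = (\<lambda>\<eta>. h \<eta> * ?d \<eta> / 2 + h \<eta> * current \<eta> x z * ?d \<eta> / 2)"
  proof
    fix \<eta>
    show "h \<eta> * (of_bool (\<eta> x) * (1 - of_bool (\<eta> z)) * ?d \<eta>)
      = h \<eta> * ?d \<eta> / 2 + h \<eta> * current \<eta> x z * ?d \<eta> / 2"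
      using exchange_eq_same[of \<eta> x z] by (cases "\<eta> x"; cases "\<eta> z") (auto simp: current_def)
  qed
  then have "expectation (\<lambda>\<eta>. h \<eta> * (of_bool (\<eta> x) * (1 - of_bool (\<eta> z)) * ?d \<eta>))
      = expectation (\<lambda>\<eta>. h \<eta> * ?d \<eta>) / 2 + bond_drift x z h g / 2"
    using h g by (simp add: bond_drift_def)
  moreover have "bond_form x z h g = - 2 * expectation (\<lambda>\<eta>. h \<eta> * ?d \<eta>)"
  proof -
    have "bond_form x z h g = expectation (\<lambda>\<eta>. h (exchange \<eta> x z) * ?d \<eta> - h \<eta> * ?d \<eta>)"
      by (simp add: bond_form_def left_diff_distrib)
    also have "\<dots> = expectation (\<lambda>\<eta>. h (exchange \<eta> x z) * ?d \<eta>) - expectation (\<lambda>\<eta>. h \<eta> * ?d \<eta>)"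
      using h g by (intro Bochner_Integration.integral_diff local_integrable) auto
    also have "expectation (\<lambda>\<eta>. h (exchange \<eta> x z) * ?d \<eta>) = expectation (\<lambda>\<eta>. - (h \<eta> * ?d \<eta>))"
      using expectation_exchange[of "\<lambda>\<eta>. - (h \<eta> * ?d \<eta>)" x z] h g by (simp add: algebra_simps)
    finally show ?thesis by simp
  qed
  ultimately show ?thesis by simp
qed

lemma expectation_shift_gen:
  assumes h: "local_function h" and g: "local_function g"
  shows "expectation (\<lambda>\<eta>. h \<eta> * shift_gen y g \<eta>) = drift h g y / 2 - form h g y / 4"
proof -
  obtain A where A: "local_on A g" using g by (rule local_functionE)
  note F = finite_touching[OF local_on_finite[OF A], of y]
  let ?s = "\<lambda>x \<eta>. h \<eta> * (of_bool (\<eta> x) * (1 - of_bool (\<eta> (x + y))) * (g (exchange \<eta> x (x + y)) - g \<eta>))"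
  have "expectation (\<lambda>\<eta>. h \<eta> * shift_gen y g \<eta>) = expectation (\<lambda>\<eta>. \<Sum>x\<in>touching A y. ?s x \<eta>)"
    unfolding shift_gen_eq_sum[OF A] by (simp add: sum_distrib_left)
  also have "\<dots> = (\<Sum>x\<in>touching A y. expectation (?s x))"
    using h g by (intro Bochner_Integration.integral_sum local_integrable local_function_mult local_function_diff) auto
  also have "\<dots> = (\<Sum>x\<in>touching A y. bond_drift x (x + y) h g) / 2 - (\<Sum>x\<in>touching A y. bond_form x (x + y) h g) / 4"
    by (simp add: expectation_bond_generator[OF h g] sum_subtractf sum_divide_distrib)
  finally show ?thesis
    by (simp add: drift_eq_sum[OF A F order_refl] form_eq_sum[OF A F order_refl])
qed

lemma expectation_exclusion_operator:
  assumes q: "jump_probability q" and h: "local_function h" and g: "local_function g"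
  shows "((\<lambda>y. q y * (drift h g y / 2 - form h g y / 4)) has_sum
    expectation (\<lambda>\<eta>. h \<eta> * exclusion_operator q g \<eta>)) UNIV"
  unfolding has_sum_def
proof (rule tendstoI)
  fix e :: real assume e: "0 < e"
  obtain C where C: "0 < C" "\<And>\<eta>. \<bar>h \<eta>\<bar> \<le> C" using local_function_bounded[OF h] by blast
  have "\<forall>\<^sub>F F in finite_subsets_at_top UNIV. \<forall>\<eta>\<in>UNIV.
      dist (\<Sum>y\<in>F. q y * shift_gen y g \<eta>) (exclusion_operator q g \<eta>) < e / (2 * C)"
    by (rule uniform_limitD[OF exclusion_operator_uniform_limit[OF q g]]) (use e C in simp)
  then show "\<forall>\<^sub>F F in finite_subsets_at_top UNIV.
      dist (\<Sum>y\<in>F. q y * (drift h g y / 2 - form h g y / 4)) (expectation (\<lambda>\<eta>. h \<eta> * exclusion_operator q g \<eta>)) < e"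
  proof eventually_elim
    case (elim F)
    let ?S = "\<lambda>\<eta>. \<Sum>y\<in>F. q y * shift_gen y g \<eta>"
    have S: "local_function ?S" using g by (intro local_function_sum local_function_cmult local_function_shift_gen)
    have "(\<Sum>y\<in>F. q y * (drift h g y / 2 - form h g y / 4)) = (\<Sum>y\<in>F. expectation (\<lambda>\<eta>. q y * (h \<eta> * shift_gen y g \<eta>)))"
      by (simp add: expectation_shift_gen[OF h g])
    also have "\<dots> = expectation (\<lambda>\<eta>. \<Sum>y\<in>F. q y * (h \<eta> * shift_gen y g \<eta>))"
      using h g by (intro Bochner_Integration.integral_sum [symmetric] local_integrable
          local_function_cmult local_function_mult local_function_shift_gen)
    also have "\<dots> = expectation (\<lambda>\<eta>. h \<eta> * ?S \<eta>)"
      by (simp add: sum_distrib_left algebra_simps)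
    finally have sum: "(\<Sum>y\<in>F. q y * (drift h g y / 2 - form h g y / 4)) = expectation (\<lambda>\<eta>. h \<eta> * ?S \<eta>)" .
    have cont: "continuous_on UNIV (\<lambda>\<eta>. h \<eta> * ?S \<eta>)" "continuous_on UNIV (\<lambda>\<eta>. h \<eta> * exclusion_operator q g \<eta>)"
      by (rule continuous_on_mult[OF local_function_continuous[OF h]],
          rule local_function_continuous[OF S] exclusion_operator_continuous[OF q g])+
    have "expectation (\<lambda>\<eta>. h \<eta> * ?S \<eta>) - expectation (\<lambda>\<eta>. h \<eta> * exclusion_operator q g \<eta>)
        = expectation (\<lambda>\<eta>. h \<eta> * ?S \<eta> - h \<eta> * exclusion_operator q g \<eta>)"
      using cont by (intro Bochner_Integration.integral_diff [symmetric] continuous_integrable)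
    moreover have "\<bar>expectation (\<lambda>\<eta>. h \<eta> * ?S \<eta> - h \<eta> * exclusion_operator q g \<eta>)\<bar> \<le> C * (e / (2 * C))"
    proof (rule abs_expectation_le)
      show "continuous_on UNIV (\<lambda>\<eta>. h \<eta> * ?S \<eta> - h \<eta> * exclusion_operator q g \<eta>)"
        using cont by (rule continuous_on_diff)
      fix \<eta>
      have "\<bar>h \<eta> * ?S \<eta> - h \<eta> * exclusion_operator q g \<eta>\<bar> = \<bar>h \<eta>\<bar> * \<bar>?S \<eta> - exclusion_operator q g \<eta>\<bar>"
        by (simp add: abs_mult flip: right_diff_distrib)
      also have "\<dots> \<le> C * (e / (2 * C))"
        using elim C by (intro mult_mono) (auto simp: dist_real_def intro: less_imp_le)
      finally show "\<bar>h \<eta> * ?S \<eta> - h \<eta> * exclusion_operator q g \<eta>\<bar> \<le> C * (e / (2 * C))" .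
    qed
    ultimately show ?case using e C(1) unfolding sum dist_real_def by (simp add: field_simps)
  qed
qed

text \<open>Infinitesimal invariance of the measure, obtained by testing with the constant
  1.\<close>

lemma expectation_exclusion_operator_eq_0:
  assumes q: "jump_probability q" and g: "local_function g"
  shows "expectation (exclusion_operator q g) = 0"
proof -
  have "form (\<lambda>_. 1) g y = 0" for y
    by (simp add: form_def bond_form_def)
  then have "((\<lambda>y :: int ^ 'd. 0) has_sum expectation (\<lambda>\<eta>. 1 * exclusion_operator q g \<eta>)) UNIV"
    using expectation_exclusion_operator[OF q local_function_const[of 1] g] drift_const[OF g] by simp
  from has_sum_unique[OF this has_sum_0_simp] show ?thesis by simp
qed

end

section \<open>Density of the range of the resolvent equation\<close>

lemma exclusion_operator_nonpos_at_max:
  assumes q: "jump_probability q" and g: "local_function g" and max: "\<And>\<xi>. g \<xi> \<le> g \<eta>"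
  shows "exclusion_operator q g \<eta> \<le> 0"
proof -
  obtain A where A: "local_on A g" using g by (rule local_functionE)
  have "shift_gen y g \<eta> \<le> 0" for y
    unfolding shift_gen_eq_sum[OF A]
    using max by (intro sum_nonpos mult_nonneg_nonpos) (auto simp: le_diff_eq)
  then have "q y * shift_gen y g \<eta> \<le> 0" for y
    using q by (simp add: jump_probability_def mult_nonneg_nonpos)
  then show ?thesis
    using has_sum_mono[OF exclusion_operator_has_sum[OF q A] has_sum_0_simp] by simp
qed

lemma exclusion_operator_cmult:
  assumes "jump_probability q" "local_function g"
  shows "exclusion_operator q (\<lambda>\<eta>. a * g \<eta>) \<eta> = a * exclusion_operator q g \<eta>"
  using exclusion_operator_linear[OF assms assms(2), of a 0] by simp

lemma exclusion_operator_uminus: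
  assumes "jump_probability q" "local_function g"
  shows "exclusion_operator q (\<lambda>\<eta>. - g \<eta>) \<eta> = - exclusion_operator q g \<eta>"
  using exclusion_operator_cmult[OF assms, of "-1"] by simp

lemma exclusion_operator_add:
  assumes "jump_probability q" "local_function g" "local_function h"
  shows "exclusion_operator q (\<lambda>\<eta>. g \<eta> + h \<eta>) \<eta> = exclusion_operator q g \<eta> + exclusion_operator q h \<eta>"
  using exclusion_operator_linear[OF assms, of 1 1] by simp

text \<open>The maximum of a local function is attained, and there the exclusion operator is at most
  0.\<close>

lemma resolvent_upper_bound:
  assumes q: "jump_probability q" and g: "local_function g" and l: "0 < l"
    and B: "\<And>\<eta>. l * g \<eta> - exclusion_operator q g \<eta> \<le> B"
  shows "g \<eta> \<le> B / l"
proof -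
  have fin: "finite (range g)" using g by (rule local_function_finite_range)
  then have "Max (range g) \<in> range g" by (intro Max_in) auto
  then obtain \<xi> where \<xi>: "g \<xi> = Max (range g)" by auto
  have max: "g \<zeta> \<le> g \<xi>" for \<zeta> unfolding \<xi> using fin by (intro Max_ge) auto
  have "l * g \<xi> \<le> B"
    using B[of \<xi>] exclusion_operator_nonpos_at_max[OF q g max] by linarith
  moreover have "l * g \<eta> \<le> l * g \<xi>" using max[of \<eta>] l by simp
  ultimately have "l * g \<eta> \<le> B" by linarith
  then show ?thesis using l by (simp add: pos_le_divide_eq mult.commute)
qed

lemma resolvent_bound:
  assumes q: "jump_probability q" and g: "local_function g" and l: "0 < l"
    and B: "\<And>\<eta>. \<bar>l * g \<eta> - exclusion_operator q g \<eta>\<bar> \<le> B"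
  shows "\<bar>g \<eta>\<bar> \<le> B / l"
proof -
  have "g \<eta> \<le> B / l"
    by (rule resolvent_upper_bound[OF q g l]) (use B abs_le_D1 in blast)
  moreover have "- g \<eta> \<le> B / l"
  proof (rule resolvent_upper_bound[OF q local_function_uminus[OF g] l])
    show "l * - g \<xi> - exclusion_operator q (\<lambda>\<eta>. - g \<eta>) \<xi> \<le> B" for \<xi>
      using B[of \<xi>] exclusion_operator_uminus[OF q g, of \<xi>] by simp
  qed
  ultimately show ?thesis by linarith
qed

section \<open>Propagation of variations under attempted jumps\<close>

definition move :: "'d::finite config \<Rightarrow> int ^ 'd \<Rightarrow> int ^ 'd \<Rightarrow> 'd config" where
  "move \<eta> x z = (if \<eta> x \<and> \<not> \<eta> z then exchange \<eta> x z else \<eta>)"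

text \<open>With \<open>move\<close> a jump term becomes a plain difference. In a finite box the
  generator is then a positive operator minus a multiple of the identity.\<close>

lemma exclusion_term_move:
  "of_bool (\<eta> x) * (1 - of_bool (\<eta> z)) * (g (exchange \<eta> x z) - g \<eta>) = (g (move \<eta> x z) - g \<eta> :: real)"
  by (simp add: move_def)

definition variation_le :: "(int ^ 'd \<Rightarrow> real) \<Rightarrow> ('d config \<Rightarrow> real) \<Rightarrow> bool" where
  "variation_le a g \<longleftrightarrow> (\<forall>\<eta> u. \<bar>g (\<eta>(u := \<not> \<eta> u)) - g \<eta>\<bar> \<le> a u)"

lemma variation_le_nonneg: "variation_le a g \<Longrightarrow> 0 \<le> a u"
  unfolding variation_le_def using order_trans[OF abs_ge_zero] by blast

lemma variation_one_site:
  assumes a: "variation_le a g" and eq: "\<And>u. u \<noteq> x \<Longrightarrow> \<eta> u = \<xi> u"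
  shows "\<bar>g \<xi> - g \<eta>\<bar> \<le> a x"
proof (cases "\<eta> x = \<xi> x")
  case True
  have "\<eta> u = \<xi> u" for u by (cases "u = x") (simp_all add: True eq)
  then have "\<eta> = \<xi>" by (rule ext)
  then show ?thesis using variation_le_nonneg[OF a] by simp
next
  case False
  then have "\<xi> = \<eta>(x := \<not> \<eta> x)" using eq by (auto simp: fun_eq_iff)
  then show ?thesis using a by (simp add: variation_le_def)
qed

lemma variation_two_sites:
  assumes a: "variation_le a g" and eq: "\<And>u. u \<noteq> x \<Longrightarrow> u \<noteq> z \<Longrightarrow> \<eta> u = \<xi> u"
  shows "\<bar>g \<xi> - g \<eta>\<bar> \<le> a x + a z"
proof -
  have "\<bar>g (\<eta>(x := \<xi> x)) - g \<eta>\<bar> \<le> a x" by (rule variation_one_site[OF a]) simp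
  moreover have "\<bar>g \<xi> - g (\<eta>(x := \<xi> x))\<bar> \<le> a z"
    by (rule variation_one_site[OF a]) (use eq in auto)
  ultimately show ?thesis by linarith
qed

text \<open>A discrepancy at \<open>u\<close> stays at \<open>u\<close> unless the attempted jump
  uses \<open>u\<close>; then it may spread to both ends of the bond.\<close>

lemma variation_move:
  assumes a: "variation_le a g"
  shows "\<bar>g (move (\<eta>(u := \<not> \<eta> u)) x z) - g (move \<eta> x z)\<bar>
    \<le> a u + of_bool (x = u) * a z + of_bool (z = u) * a x"
proof (cases "u = x \<or> u = z")
  case True
  have "\<bar>g (move (\<eta>(u := \<not> \<eta> u)) x z) - g (move \<eta> x z)\<bar> \<le> a x + a z"
    by (rule variation_two_sites[OF a]) (use True in \<open>auto simp: move_def exchange_apply\<close>)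
  then show ?thesis
    using True variation_le_nonneg[OF a, of x] variation_le_nonneg[OF a, of z] by auto
next
  case False
  have "\<bar>g (move (\<eta>(u := \<not> \<eta> u)) x z) - g (move \<eta> x z)\<bar> \<le> a u"
    by (rule variation_one_site[OF a]) (use False in \<open>auto simp: move_def exchange_apply\<close>)
  then show ?thesis using False by auto
qed

text \<open>A jump by \<open>y\<close> changes the weight at most by the factor
  \<open>1 + |y|\<close>, so the first moment controls the growth of weighted variations. Being
  large far away, the weight makes variations near the boundary of a large box small.\<close>

definition weight :: "int ^ 'd \<Rightarrow> real" where
  "weight u = 1 + norm1 u"

lemma weight_ge_1: "1 \<le> weight u"
  by (simp add: weight_def)

lemma weight_add: "weight (x + y) \<le> (1 + norm1 y) * weight x"
proof -
  have "weight (x + y) \<le> 1 + (norm1 x + norm1 y)" using norm1_triangle[of x y] by (simp add: weight_def)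
  also have "\<dots> \<le> (1 + norm1 y) * weight x" by (simp add: weight_def algebra_simps)
  finally show ?thesis .
qed

lemma weight_diff: "weight x \<le> (1 + norm1 y) * weight (x + y)"
  using weight_add[of "x + y" "- y"] by simp

lemma finite_norm1_le: "finite {u :: int ^ 'd. norm1 u \<le> r}"
proof -
  define k where "k = \<lceil>r\<rceil>"
  have "{u :: int ^ 'd. norm1 u \<le> r} \<subseteq> vec_lambda ` (UNIV \<rightarrow>\<^sub>E {- k..k})"
  proof
    fix u :: "int ^ 'd" assume "u \<in> {u. norm1 u \<le> r}"
    then have "real_of_int \<bar>u $ i\<bar> \<le> real_of_int k" for i
      using component_le_norm1[of u i] le_of_int_ceiling[of r] unfolding k_def
      by (metis mem_Collect_eq order_trans)
    then have abs: "\<bar>u $ i\<bar> \<le> k" for i by (simp only: of_int_le_iff)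
    have "u $ i \<in> {- k..k}" for i using abs[of i] by auto
    then have "vec_nth u \<in> UNIV \<rightarrow>\<^sub>E {- k..k}" by auto
    then show "u \<in> vec_lambda ` (UNIV \<rightarrow>\<^sub>E {- k..k})"
      by (intro image_eqI[of _ _ "vec_nth u"]) (simp_all add: vec_nth_inverse)
  qed
  then show ?thesis by (rule finite_subset) (intro finite_imageI finite_PiE, auto)
qed

text \<open>The weighted bound on the variations is preserved by the iteration of the resolvent equation
  in the box \<open>\<Lambda>\<close>, uniformly in \<open>\<Lambda>\<close>.\<close>

locale finite_volume =
  fixes q :: "int ^ 'd \<Rightarrow> real" and K :: real and \<Lambda> :: "(int ^ 'd) set"
  assumes q: "jump_probability q" and K: "((\<lambda>y. q y * (1 + norm1 y)) has_sum K) UNIV"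
    and fin: "finite \<Lambda>"
begin

definition box :: "int ^ 'd \<Rightarrow> (int ^ 'd) set" where
  "box y = {x \<in> \<Lambda>. x + y \<in> \<Lambda>}"

definition steps :: "(int ^ 'd) set" where
  "steps = (\<lambda>(x, z). z - x) ` (\<Lambda> \<times> \<Lambda>)"

text \<open>The total rate of attempted jumps within the box. The box generator is
  \<open>pos_op - rate\<close>, and its resolvent equation is the fixed point equation
  \<open>(l + rate) g = f + pos_op g\<close>.\<close>

definition rate :: real where
  "rate = (\<Sum>y\<in>steps. q y * real (card (box y)))"

definition pos_op :: "('d config \<Rightarrow> real) \<Rightarrow> 'd config \<Rightarrow> real" where
  "pos_op g \<eta> = (\<Sum>y\<in>steps. q y * (\<Sum>x\<in>box y. g (move \<eta> x (x + y))))"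

lemma finite_steps [simp]: "finite steps" and finite_box [simp]: "finite (box y)"
  using fin by (auto simp: steps_def box_def)

lemma box_empty: "y \<notin> steps \<Longrightarrow> box y = {}"
  unfolding steps_def box_def by force

lemma q_nonneg [simp]: "0 \<le> q y"
  using q by (simp add: jump_probability_def)

lemma rate_nonneg [simp]: "0 \<le> rate"
  unfolding rate_def by (intro sum_nonneg) auto

lemma abs_pos_op_le:
  assumes "\<And>\<eta>. \<bar>g \<eta>\<bar> \<le> B" shows "\<bar>pos_op g \<eta>\<bar> \<le> rate * B"
proof -
  have "\<bar>q y * (\<Sum>x\<in>box y. g (move \<eta> x (x + y)))\<bar> \<le> q y * (real (card (box y)) * B)" for y
    unfolding abs_mult abs_of_nonneg[OF q_nonneg]
    using assms by (intro mult_left_mono order.trans[OF sum_abs] sum_bounded_above) auto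
  then have "\<bar>pos_op g \<eta>\<bar> \<le> (\<Sum>y\<in>steps. q y * (real (card (box y)) * B))"
    unfolding pos_op_def by (intro order.trans[OF sum_abs] sum_mono)
  then show ?thesis by (simp add: rate_def sum_distrib_right mult.assoc)
qed

lemma pos_op_diff: "pos_op (\<lambda>\<eta>. (g \<eta> - h \<eta>) / c) \<eta> = (pos_op g \<eta> - pos_op h \<eta>) / c"
  by (simp add: pos_op_def sum_subtractf sum_divide_distrib right_diff_distrib diff_divide_distrib
      flip: sum_divide_distrib)

lemma local_on_pos_op:
  assumes "local_on \<Lambda> g" shows "local_on \<Lambda> (pos_op g)"
  unfolding local_on_def
proof (intro conjI fin allI impI)
  fix \<eta> \<xi> :: "'d config" assume eq: "\<forall>x\<in>\<Lambda>. \<eta> x = \<xi> x"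
  have "g (move \<eta> x (x + y)) = g (move \<xi> x (x + y))" if "x \<in> box y" for x y
    by (rule local_onD[OF assms]) (use eq that in \<open>auto simp: box_def move_def exchange_apply\<close>)
  then show "pos_op g \<eta> = pos_op g \<xi>" by (simp add: pos_op_def)
qed

definition iter_variation :: "(int ^ 'd \<Rightarrow> real) \<Rightarrow> int ^ 'd \<Rightarrow> real" where
  "iter_variation a u = (\<Sum>y\<in>steps. q y * (\<Sum>x\<in>box y. a u + of_bool (x = u) * a (x + y) + of_bool (x + y = u) * a x))"

lemma variation_pos_op:
  assumes a: "variation_le a g" shows "variation_le (iter_variation a) (pos_op g)"
  unfolding variation_le_def
proof (intro allI)
  fix \<eta> :: "'d config" and u
  let ?\<xi> = "\<eta>(u := \<not> \<eta> u)"
  have "pos_op g ?\<xi> - pos_op g \<eta>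
      = (\<Sum>y\<in>steps. q y * (\<Sum>x\<in>box y. g (move ?\<xi> x (x + y)) - g (move \<eta> x (x + y))))"
    unfolding pos_op_def by (simp only: sum_subtractf right_diff_distrib)
  moreover have "\<bar>\<Sum>y\<in>steps. q y * (\<Sum>x\<in>box y. g (move ?\<xi> x (x + y)) - g (move \<eta> x (x + y)))\<bar>
      \<le> iter_variation a u"
    unfolding iter_variation_def
  proof (rule order.trans[OF sum_abs], rule sum_mono)
    fix y
    have "\<bar>\<Sum>x\<in>box y. g (move ?\<xi> x (x + y)) - g (move \<eta> x (x + y))\<bar>
        \<le> (\<Sum>x\<in>box y. a u + of_bool (x = u) * a (x + y) + of_bool (x + y = u) * a x)"
      by (rule order.trans[OF sum_abs], rule sum_mono, rule variation_move[OF a])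
    then show "\<bar>q y * (\<Sum>x\<in>box y. g (move ?\<xi> x (x + y)) - g (move \<eta> x (x + y)))\<bar>
        \<le> q y * (\<Sum>x\<in>box y. a u + of_bool (x = u) * a (x + y) + of_bool (x + y = u) * a x)"
      unfolding abs_mult abs_of_nonneg[OF q_nonneg] by (rule mult_left_mono) simp
  qed
  ultimately show "\<bar>pos_op g ?\<xi> - pos_op g \<eta>\<bar> \<le> iter_variation a u" by simp
qed

definition total :: "(int ^ 'd \<Rightarrow> real) \<Rightarrow> real" where
  "total a = (\<Sum>u\<in>\<Lambda>. weight u * a u)"

lemma moment_le: "(\<Sum>y\<in>F. q y * (1 + norm1 y)) \<le> K" if "finite F"
  by (rule finite_sum_le_has_sum[OF K]) (use that in auto)

text \<open>Every attempted jump reproduces the old variation, which gives \<open>rate\<close>. It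
  also passes variation from either end of the bond to the other, and each direction costs the
  moment \<open>K\<close>.\<close>

lemma total_iter_variation:
  assumes a0: "\<And>u. 0 \<le> a u"
  shows "total (iter_variation a) \<le> (rate + 2 * K) * total a"
proof -
  have w0: "0 \<le> weight u" for u :: "int ^ 'd" using weight_ge_1[of u] by linarith
  have tot0: "0 \<le> total a" unfolding total_def using a0 w0 by (intro sum_nonneg) auto
  have delta: "(\<Sum>u\<in>\<Lambda>. weight u * (of_bool (v = u) * b)) = weight v * b" if "v \<in> \<Lambda>" for v b
  proof -
    have "(\<Sum>u\<in>\<Lambda>. weight u * (of_bool (v = u) * b)) = (\<Sum>u\<in>\<Lambda>. if v = u then weight v * b else 0)"
      by (intro sum.cong) auto
    then show ?thesis using that fin by simp
  qed
  have "total (iter_variation a) = (\<Sum>u\<in>\<Lambda>. \<Sum>y\<in>steps. q y * (\<Sum>x\<in>box y.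
      weight u * a u + weight u * (of_bool (x = u) * a (x + y)) + weight u * (of_bool (x + y = u) * a x)))"
    unfolding total_def iter_variation_def
    by (simp add: sum_distrib_left distrib_left mult.left_commute)
  also have "\<dots> = (\<Sum>y\<in>steps. q y * (\<Sum>x\<in>box y. \<Sum>u\<in>\<Lambda>.
      weight u * a u + weight u * (of_bool (x = u) * a (x + y)) + weight u * (of_bool (x + y = u) * a x)))"
    by (subst sum.swap) (simp add: sum_distrib_left [symmetric] sum.swap[of _ "box _" \<Lambda>])
  also have "\<dots> = (\<Sum>y\<in>steps. q y * (\<Sum>x\<in>box y. total a + weight x * a (x + y) + weight (x + y) * a x))"
    by (intro sum.cong refl arg_cong2[where f = "(*)"]) (simp add: sum.distrib delta total_def box_def)
  also have "\<dots> \<le> (\<Sum>y\<in>steps. q y * (real (card (box y)) * total a + 2 * (1 + norm1 y) * total a))"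
  proof (intro sum_mono mult_left_mono)
    fix y
    have "(\<Sum>x\<in>box y. weight x * a (x + y)) \<le> (\<Sum>x\<in>box y. (1 + norm1 y) * (weight (x + y) * a (x + y)))"
      using a0 weight_diff[of _ y] by (intro sum_mono) (simp add: mult_right_mono flip: mult.assoc)
    also have "\<dots> = (1 + norm1 y) * (\<Sum>u\<in>(\<lambda>x. x + y) ` box y. weight u * a u)"
      by (subst sum.reindex) (auto simp: inj_on_def sum_distrib_left)
    also have "\<dots> \<le> (1 + norm1 y) * total a"
      unfolding total_def using a0 w0 fin by (intro mult_left_mono sum_mono2) (auto simp: box_def)
    finally have 1: "(\<Sum>x\<in>box y. weight x * a (x + y)) \<le> (1 + norm1 y) * total a" .
    have "(\<Sum>x\<in>box y. weight (x + y) * a x) \<le> (\<Sum>x\<in>box y. (1 + norm1 y) * (weight x * a x))"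
      using a0 weight_add[of _ y] by (intro sum_mono) (simp add: mult_right_mono flip: mult.assoc)
    also have "\<dots> \<le> (1 + norm1 y) * total a"
      unfolding total_def sum_distrib_left [symmetric] using a0 w0 fin
      by (intro mult_left_mono sum_mono2) (auto simp: box_def)
    finally show "(\<Sum>x\<in>box y. total a + weight x * a (x + y) + weight (x + y) * a x)
        \<le> real (card (box y)) * total a + 2 * (1 + norm1 y) * total a"
      using 1 by (simp add: sum.distrib algebra_simps)
  qed simp
  also have "\<dots> = (rate + 2 * (\<Sum>y\<in>steps. q y * (1 + norm1 y))) * total a"
    by (simp add: rate_def sum_distrib_left sum_distrib_right sum.distrib algebra_simps)
  also have "\<dots> \<le> (rate + 2 * K) * total a"
    using moment_le[OF finite_steps] tot0 by (intro mult_right_mono) auto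
  finally show ?thesis .
qed

text \<open>The iteration \<open>g' = (f + pos_op g) / (l + rate)\<close>, started at 0. The speed
  of convergence depends on the box through \<open>rate\<close>, while the bound on the variations
  involves the box only through \<open>total b\<close>.\<close>

lemma resolvent_iteration:
  assumes f: "local_on \<Lambda> f" and C: "\<And>\<eta>. \<bar>f \<eta>\<bar> \<le> C" and b: "variation_le b f" and l: "2 * K < l"
  shows "\<exists>g a. local_on \<Lambda> g \<and> variation_le a g \<and> (\<forall>u. u \<notin> \<Lambda> \<longrightarrow> a u = 0) \<and>
    total a \<le> total b / (l - 2 * K) \<and>
    (\<forall>\<eta>. \<bar>f \<eta> - ((l + rate) * g \<eta> - pos_op g \<eta>)\<bar> \<le> (rate / (l + rate)) ^ k * C)"
proof (induction k)
  case 0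
  have "0 \<le> b u" for u using b by (rule variation_le_nonneg)
  moreover have "0 \<le> weight u" for u :: "int ^ 'd" using weight_ge_1[of u] by linarith
  ultimately have "0 \<le> total b" unfolding total_def by (intro sum_nonneg mult_nonneg_nonneg)
  then show ?case
    using l C fin
    by (intro exI[of _ "\<lambda>_. 0"]) (auto simp: local_on_def variation_le_def total_def pos_op_def)
next
  case (Suc k)
  then obtain g a where g: "local_on \<Lambda> g" and a: "variation_le a g" and a_out: "\<And>u. u \<notin> \<Lambda> \<Longrightarrow> a u = 0"
    and tot: "total a \<le> total b / (l - 2 * K)"
    and res: "\<And>\<eta>. \<bar>f \<eta> - ((l + rate) * g \<eta> - pos_op g \<eta>)\<bar> \<le> (rate / (l + rate)) ^ k * C"
    by blast
  have K0: "0 \<le> K" using moment_le[of "{}"] by simp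
  have pos: "0 < l + rate" using l K0 rate_nonneg by linarith
  define g' where "g' = (\<lambda>\<eta>. (f \<eta> + pos_op g \<eta>) / (l + rate))"
  define a' where "a' = (\<lambda>u. if u \<in> \<Lambda> then (b u + iter_variation a u) / (l + rate) else 0)"
  have g': "local_on \<Lambda> g'"
    unfolding g'_def using local_on_comp2[OF f local_on_pos_op[OF g], of "\<lambda>v w. (v + w) / (l + rate)"] by simp
  have a': "variation_le a' g'"
    unfolding variation_le_def
  proof (intro allI)
    fix \<eta> :: "'d config" and u
    let ?\<xi> = "\<eta>(u := \<not> \<eta> u)"
    show "\<bar>g' ?\<xi> - g' \<eta>\<bar> \<le> a' u"
    proof (cases "u \<in> \<Lambda>")
      case True
      have "\<bar>f ?\<xi> - f \<eta>\<bar> \<le> b u" "\<bar>pos_op g ?\<xi> - pos_op g \<eta>\<bar> \<le> iter_variation a u"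
        using b variation_pos_op[OF a] unfolding variation_le_def by blast+
      moreover have "g' ?\<xi> - g' \<eta> = ((f ?\<xi> - f \<eta>) + (pos_op g ?\<xi> - pos_op g \<eta>)) / (l + rate)"
        by (simp add: g'_def flip: diff_divide_distrib)
      ultimately show ?thesis using True pos by (simp add: a'_def divide_right_mono)
    next
      case False
      have "g' ?\<xi> = g' \<eta>" by (rule local_onD[OF g']) (use False in auto)
      then show ?thesis using False by (simp add: a'_def)
    qed
  qed
  have "total a' = (total b + total (iter_variation a)) / (l + rate)"
    by (simp add: total_def a'_def sum.distrib sum_divide_distrib add_divide_distrib distrib_left)
  also have "\<dots> \<le> (total b + (rate + 2 * K) * total a) / (l + rate)"
    using total_iter_variation[OF variation_le_nonneg[OF a]] pos by (simp add: divide_right_mono)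
  also have "\<dots> \<le> (total b + (rate + 2 * K) * (total b / (l - 2 * K))) / (l + rate)"
    using tot pos K0 by (intro divide_right_mono add_left_mono mult_left_mono) auto
  \<comment> \<open>\<open>total b / (l - 2 K)\<close> is the fixed point of the recursion for the
    weighted variation: \<open>total b + (rate + 2 K) s = (l + rate) s\<close>. The rate drops
    out.\<close>
  also have "\<dots> = total b / (l - 2 * K)"
  proof -
    define s where "s = total b / (l - 2 * K)"
    have "total b = (l - 2 * K) * s" using l by (simp add: s_def)
    then have "total b + (rate + 2 * K) * s = (l + rate) * s" by (simp add: algebra_simps)
    then show ?thesis using pos by (simp flip: s_def)
  qed
  finally have tot': "total a' \<le> total b / (l - 2 * K)" .
  have res': "\<bar>f \<eta> - ((l + rate) * g' \<eta> - pos_op g' \<eta>)\<bar> \<le> (rate / (l + rate)) ^ Suc k * C" for \<eta>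
  proof -
    let ?r = "\<lambda>\<eta>. f \<eta> - ((l + rate) * g \<eta> - pos_op g \<eta>)"
    have g'_eq: "g' \<eta> - g \<eta> = ?r \<eta> / (l + rate)" for \<eta>
      using pos by (simp add: g'_def field_simps)
    \<comment> \<open>By construction \<open>(l + rate) g' = f + pos_op g\<close>. So the new
      residual is \<open>pos_op\<close> applied to \<open>g' - g\<close>, that is, to the old
      residual divided by \<open>l + rate\<close>.\<close>
    have "f \<eta> - ((l + rate) * g' \<eta> - pos_op g' \<eta>) = pos_op g' \<eta> - pos_op g \<eta>"
      using pos by (simp add: g'_def)
    also have "\<dots> = pos_op (\<lambda>\<eta>. ?r \<eta> / (l + rate)) \<eta>"
      using pos_op_diff[of g' g 1 \<eta>] by (simp add: g'_eq)
    finally have eq: "f \<eta> - ((l + rate) * g' \<eta> - pos_op g' \<eta>) = pos_op (\<lambda>\<eta>. ?r \<eta> / (l + rate)) \<eta>" .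
    have "\<bar>?r \<xi> / (l + rate)\<bar> \<le> (rate / (l + rate)) ^ k * C / (l + rate)" for \<xi>
      unfolding abs_divide abs_of_pos[OF pos] by (intro divide_right_mono res) (use pos in simp)
    then have "\<bar>pos_op (\<lambda>\<eta>. ?r \<eta> / (l + rate)) \<eta>\<bar> \<le> rate * ((rate / (l + rate)) ^ k * C / (l + rate))"
      by (rule abs_pos_op_le)
    then show ?thesis unfolding eq by simp
  qed
  show ?case using g' a' tot' res' by (intro exI[of _ g'] exI[of _ a']) (simp add: a'_def)
qed

text \<open>Only bonds leaving the box contribute to the error. Their outer end has weight at least
  \<open>n\<close>, so the inner end \<open>u\<close> has weight at least
  \<open>n / (1 + |y|)\<close>, and the variation there is at most \<open>(1 + |y|) / n\<close>
  times its weighted value.\<close>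

lemma exclusion_operator_box:
  assumes g: "local_on \<Lambda> g" and a: "variation_le a g" and a_out: "\<And>u. u \<notin> \<Lambda> \<Longrightarrow> a u = 0"
    and n: "0 < n" "\<And>u. u \<notin> \<Lambda> \<Longrightarrow> n \<le> weight u"
  shows "\<bar>exclusion_operator q g \<eta> - (pos_op g \<eta> - rate * g \<eta>)\<bar> \<le> 2 * K * total a / n"
proof -
  have a0: "0 \<le> a u" for u using a by (rule variation_le_nonneg)
  have w0: "0 \<le> weight u" for u :: "int ^ 'd" using weight_ge_1[of u] by linarith
  let ?t = "\<lambda>y x. g (move \<eta> x (x + y)) - g \<eta>"
  have shift: "shift_gen y g \<eta> = (\<Sum>x\<in>touching \<Lambda> y. ?t y x)" for y
    unfolding shift_gen_eq_sum[OF g] by (simp add: exclusion_term_move)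
  have inner: "((\<lambda>y. q y * (\<Sum>x\<in>box y. ?t y x)) has_sum (pos_op g \<eta> - rate * g \<eta>)) UNIV"
  proof (rule has_sum_finite_neutralI[OF finite_steps])
    show "pos_op g \<eta> - rate * g \<eta> = (\<Sum>y\<in>steps. q y * (\<Sum>x\<in>box y. ?t y x))"
      by (simp add: pos_op_def rate_def sum_subtractf right_diff_distrib sum_distrib_right mult.assoc)
  qed (simp_all add: box_empty)
  have diff: "((\<lambda>y. q y * shift_gen y g \<eta> + - (q y * (\<Sum>x\<in>box y. ?t y x))) has_sum
      (exclusion_operator q g \<eta> + - (pos_op g \<eta> - rate * g \<eta>))) UNIV"
    by (rule has_sum_add[OF exclusion_operator_has_sum[OF q g] has_sum_uminusI[OF inner]])
  have bound: "\<bar>q y * shift_gen y g \<eta> + - (q y * (\<Sum>x\<in>box y. ?t y x))\<bar> \<le> 2 * total a / n * (q y * (1 + norm1 y))" for y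
  proof -
    have sub: "box y \<subseteq> touching \<Lambda> y" by (auto simp: box_def touching_def)
    have fin_t: "finite (touching \<Lambda> y)" using fin by (rule finite_touching)
    have "shift_gen y g \<eta> - (\<Sum>x\<in>box y. ?t y x) = (\<Sum>x\<in>touching \<Lambda> y - box y. ?t y x)"
      unfolding shift by (rule sum_diff [symmetric, OF fin_t sub])
    moreover have "\<bar>\<Sum>x\<in>touching \<Lambda> y - box y. ?t y x\<bar> \<le> (\<Sum>x\<in>touching \<Lambda> y - box y. a x + a (x + y))"
    proof (rule order.trans[OF sum_abs], rule sum_mono)
      show "\<bar>?t y x\<bar> \<le> a x + a (x + y)" for x
        by (rule variation_two_sites[OF a]) (auto simp: move_def exchange_apply)
    qed
    moreover have "(\<Sum>x\<in>touching \<Lambda> y - box y. a x + a (x + y)) \<le> 2 * ((1 + norm1 y) * total a / n)"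
    proof -
      have out: "a x \<le> (1 + norm1 y) * (weight x * a x) / n" if "x + y \<notin> \<Lambda>" for x
      proof -
        have "n * a x \<le> (1 + norm1 y) * weight x * a x"
          using n(2)[OF that] weight_add[of x y] a0 by (intro mult_right_mono) auto
        then show ?thesis using n(1) by (simp add: field_simps)
      qed
      have out': "a (x + y) \<le> (1 + norm1 y) * (weight (x + y) * a (x + y)) / n" if "x \<notin> \<Lambda>" for x
      proof -
        have "n * a (x + y) \<le> (1 + norm1 y) * weight (x + y) * a (x + y)"
          using n(2)[OF that] weight_diff[of x y] a0 by (intro mult_right_mono) auto
        then show ?thesis using n(1) by (simp add: field_simps)
      qed
      have pos: "0 \<le> (1 + norm1 y) * (weight u * a u) / n" for u
        using a0[of u] w0[of u] n(1) by (intro divide_nonneg_pos mult_nonneg_nonneg) auto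
      have 1: "(\<Sum>x\<in>touching \<Lambda> y - box y. a x) \<le> (1 + norm1 y) * total a / n"
      proof -
        have "(\<Sum>x\<in>touching \<Lambda> y - box y. a x) = (\<Sum>x\<in>\<Lambda> - box y. a x)"
          using fin_t a_out by (intro sum.mono_neutral_right) (auto simp: touching_def)
        also have "\<dots> \<le> (\<Sum>x\<in>\<Lambda> - box y. (1 + norm1 y) * (weight x * a x) / n)"
          using out by (intro sum_mono) (auto simp: box_def)
        also have "\<dots> \<le> (\<Sum>x\<in>\<Lambda>. (1 + norm1 y) * (weight x * a x) / n)"
          using fin pos by (intro sum_mono2) auto
        finally show ?thesis by (simp add: total_def sum_distrib_left sum_divide_distrib)
      qed
      have 2: "(\<Sum>x\<in>touching \<Lambda> y - box y. a (x + y)) \<le> (1 + norm1 y) * total a / n"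
      proof -
        have "(\<Sum>x\<in>touching \<Lambda> y - box y. a (x + y)) = (\<Sum>x\<in>{x \<in> touching \<Lambda> y - box y. x + y \<in> \<Lambda>}. a (x + y))"
          using fin_t a_out by (intro sum.mono_neutral_right) auto
        also have "\<dots> \<le> (\<Sum>x\<in>{x \<in> touching \<Lambda> y - box y. x + y \<in> \<Lambda>}. (1 + norm1 y) * (weight (x + y) * a (x + y)) / n)"
          using out' by (intro sum_mono) (auto simp: box_def)
        also have "\<dots> = (\<Sum>u\<in>(\<lambda>x. x + y) ` {x \<in> touching \<Lambda> y - box y. x + y \<in> \<Lambda>}. (1 + norm1 y) * (weight u * a u) / n)"
          by (subst sum.reindex) (auto simp: inj_on_def)
        also have "\<dots> \<le> (\<Sum>u\<in>\<Lambda>. (1 + norm1 y) * (weight u * a u) / n)"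
          using fin pos by (intro sum_mono2) auto
        finally show ?thesis by (simp add: total_def sum_distrib_left sum_divide_distrib)
      qed
      show ?thesis unfolding sum.distrib using 1 2 by linarith
    qed
    ultimately have "\<bar>shift_gen y g \<eta> - (\<Sum>x\<in>box y. ?t y x)\<bar> \<le> 2 * ((1 + norm1 y) * total a / n)"
      by linarith
    then have "q y * \<bar>shift_gen y g \<eta> - (\<Sum>x\<in>box y. ?t y x)\<bar> \<le> q y * (2 * ((1 + norm1 y) * total a / n))"
      by (rule mult_left_mono) simp
    moreover have "\<bar>q y * shift_gen y g \<eta> + - (q y * (\<Sum>x\<in>box y. ?t y x))\<bar> = q y * \<bar>shift_gen y g \<eta> - (\<Sum>x\<in>box y. ?t y x)\<bar>"
      by (simp add: abs_mult flip: right_diff_distrib)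
    ultimately show ?thesis by (simp add: field_simps)
  qed
  have dom: "((\<lambda>y. 2 * total a / n * (q y * (1 + norm1 y))) has_sum 2 * total a / n * K) UNIV"
    by (rule has_sum_cmult_right[OF K])
  have "exclusion_operator q g \<eta> + - (pos_op g \<eta> - rate * g \<eta>) \<le> 2 * total a / n * K"
    by (rule has_sum_mono[OF diff dom]) (use bound abs_le_D1 in blast)
  moreover have "- (exclusion_operator q g \<eta> + - (pos_op g \<eta> - rate * g \<eta>)) \<le> 2 * total a / n * K"
    by (rule has_sum_mono[OF has_sum_uminusI[OF diff] dom]) (use bound abs_le_D2 in blast)
  ultimately show ?thesis by (simp add: algebra_simps)
qed

end

lemma variation_le_exists:
  assumes "local_on A f"
  obtains b where "variation_le b f"
proof -
  obtain C where C: "0 < C" "\<And>\<eta>. \<bar>f \<eta>\<bar> \<le> C"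
    using local_function_bounded[OF local_on_imp_local[OF assms]] by blast
  have "\<bar>f \<eta> - f \<xi>\<bar> \<le> 2 * C * of_bool (u \<in> A)" if "\<And>v. v \<noteq> u \<Longrightarrow> \<eta> v = \<xi> v" for \<eta> \<xi> u
  proof (cases "u \<in> A")
    case True
    then show ?thesis using C(2)[of \<eta>] C(2)[of \<xi>] by simp
  next
    case False
    have "f \<eta> = f \<xi>"
    proof (rule local_onD[OF assms])
      fix x assume "x \<in> A"
      with False have "x \<noteq> u" by blast
      then show "\<eta> x = \<xi> x" by (rule that)
    qed
    then show ?thesis using C(1) by simp
  qed
  then have "variation_le (\<lambda>u. 2 * C * of_bool (u \<in> A)) f"
    unfolding variation_le_def by simp
  then show ?thesis by (rule that)
qed

text \<open>The range condition for generators in an approximate form that speaks of local functions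
  only.\<close>

definition resolvent_dense :: "(int ^ 'd \<Rightarrow> real) \<Rightarrow> real \<Rightarrow> bool" where
  "resolvent_dense q l \<longleftrightarrow> (\<forall>f e. local_function f \<and> 0 < e \<longrightarrow>
     (\<exists>g. local_function g \<and> (\<forall>\<eta>. \<bar>f \<eta> - (l * g \<eta> - exclusion_operator q g \<eta>)\<bar> \<le> e)))"

lemma resolvent_denseD:
  assumes "resolvent_dense q l" "local_function f" "0 < e"
  obtains g where "local_function g" "\<And>\<eta>. \<bar>f \<eta> - (l * g \<eta> - exclusion_operator q g \<eta>)\<bar> \<le> e"
proof -
  have "\<exists>g. local_function g \<and> (\<forall>\<eta>. \<bar>f \<eta> - (l * g \<eta> - exclusion_operator q g \<eta>)\<bar> \<le> e)"
    using assms(1) unfolding resolvent_dense_def using assms(2,3) by simp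
  then show ?thesis using that by auto
qed

text \<open>For \<open>l > 2 K\<close> the weighted variations are bounded before the box is chosen.
  So the box is fixed first, making the boundary error small for every iterate, and the number of
  iterations afterwards.\<close>

lemma resolvent_dense_large:
  fixes q :: "int ^ 'd \<Rightarrow> real"
  assumes q: "jump_probability q" and K: "((\<lambda>y. q y * (1 + norm1 y)) has_sum K) UNIV" and l: "2 * K < l"
  shows "resolvent_dense q l"
  unfolding resolvent_dense_def
proof (intro allI impI, elim conjE)
  fix f :: "'d config \<Rightarrow> real" and e :: real
  assume f: "local_function f" and e: "0 < e"
  obtain A where A: "local_on A f" using f by (rule local_functionE)
  obtain C where C: "0 < C" "\<And>\<eta>. \<bar>f \<eta>\<bar> \<le> C" using local_function_bounded[OF f] by blast
  obtain b' where b': "variation_le b' f" using A by (rule variation_le_exists)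
  define b where "b = (\<lambda>u. if u \<in> A then b' u else 0)"
  have b: "variation_le b f"
    unfolding variation_le_def
  proof (intro allI)
    fix \<eta> :: "'d config" and u
    show "\<bar>f (\<eta>(u := \<not> \<eta> u)) - f \<eta>\<bar> \<le> b u"
    proof (cases "u \<in> A")
      case True
      then show ?thesis using b' by (simp add: b_def variation_le_def)
    next
      case False
      have "f (\<eta>(u := \<not> \<eta> u)) = f \<eta>" by (rule local_onD[OF A]) (use False in auto)
      then show ?thesis using False by (simp add: b_def)
    qed
  qed
  define W where "W = (\<Sum>u\<in>A. weight u * b u)"
  have K0: "0 \<le> K"
    by (rule has_sum_nonneg[OF K]) (use q in \<open>simp add: jump_probability_def\<close>)
  \<comment> \<open>The first part puts \<open>A\<close> inside the box of weights up to
    \<open>n\<close>; the second makes the boundary error \<open>2 K total a / n\<close> at most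
    \<open>e / 2\<close>.\<close>
  define n where "n = Max (insert 1 (weight ` A)) + \<bar>4 * K * W / (l - 2 * K) / e\<bar>"
  have finA: "finite A" using A by (rule local_on_finite)
  have n1: "1 \<le> n" "4 * K * W / (l - 2 * K) / e \<le> n"
  proof -
    have "1 \<le> Max (insert 1 (weight ` A))" using finA by (intro Max_ge) auto
    then show "1 \<le> n" "4 * K * W / (l - 2 * K) / e \<le> n" unfolding n_def by linarith+
  qed
  define \<Lambda> where "\<Lambda> = {u :: int ^ 'd. weight u \<le> n}"
  have fin: "finite \<Lambda>"
    using finite_norm1_le[of "n - 1"] by (simp add: \<Lambda>_def weight_def algebra_simps)
  have sub: "A \<subseteq> \<Lambda>"
  proof
    fix u assume "u \<in> A"
    then have "weight u \<le> Max (insert 1 (weight ` A))" using finA by (intro Max_ge) auto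
    also have "\<dots> \<le> n" unfolding n_def by linarith
    finally show "u \<in> \<Lambda>" by (simp add: \<Lambda>_def)
  qed
  interpret finite_volume q K \<Lambda> by unfold_locales (fact q K fin)+
  have pos: "0 < l + rate" using l K0 rate_nonneg by linarith
  have "rate / (l + rate) < 1" using pos l K0 by simp
  moreover have "0 \<le> rate / (l + rate)" using pos by simp
  ultimately have "(\<lambda>k. (rate / (l + rate)) ^ k * C) \<longlonglongrightarrow> 0 * C"
    using pos by (intro tendsto_intros LIMSEQ_power_zero) simp
  then have "\<forall>\<^sub>F k in sequentially. (rate / (l + rate)) ^ k * C < e / 2"
    using e by (intro order_tendstoD) auto
  then obtain k where k: "(rate / (l + rate)) ^ k * C < e / 2"
    by (auto simp: eventually_sequentially)
  obtain g a where g: "local_on \<Lambda> g" and a: "variation_le a g" "\<And>u. u \<notin> \<Lambda> \<Longrightarrow> a u = 0"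
    and tot: "total a \<le> total b / (l - 2 * K)"
    and res: "\<And>\<eta>. \<bar>f \<eta> - ((l + rate) * g \<eta> - pos_op g \<eta>)\<bar> \<le> (rate / (l + rate)) ^ k * C"
    using resolvent_iteration[OF local_on_mono[OF A sub fin] C(2) b l, of k] by blast
  have "total b = W"
    unfolding total_def W_def using fin sub by (intro sum.mono_neutral_right) (auto simp: b_def)
  then have "2 * K * total a \<le> 2 * K * (W / (l - 2 * K))"
    using tot K0 by (intro mult_left_mono) auto
  also have "\<dots> = (4 * K * W / (l - 2 * K) / e) * (e / 2)"
  proof -
    have "4 * K * W / d / e * (e / 2) = 2 * K * (W / d)" for d using e by simp
    from this[of "l - 2 * K"] show ?thesis by (rule sym)
  qed
  also have "\<dots> \<le> n * (e / 2)" using n1(2) e by (intro mult_right_mono) auto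
  finally have small: "2 * K * total a / n \<le> e / 2" using n1(1) by (simp add: field_simps)
  have "\<bar>f \<eta> - (l * g \<eta> - exclusion_operator q g \<eta>)\<bar> \<le> e" for \<eta>
  proof -
    have "\<bar>exclusion_operator q g \<eta> - (pos_op g \<eta> - rate * g \<eta>)\<bar> \<le> 2 * K * total a / n"
      by (rule exclusion_operator_box[OF g a]) (use n1 in \<open>auto simp: \<Lambda>_def\<close>)
    then have "\<bar>exclusion_operator q g \<eta> - (pos_op g \<eta> - rate * g \<eta>)\<bar> \<le> e / 2"
      using small by linarith
    moreover have "\<bar>f \<eta> - ((l + rate) * g \<eta> - pos_op g \<eta>)\<bar> \<le> e / 2"
      using res[of \<eta>] k by linarith
    moreover have "f \<eta> - (l * g \<eta> - exclusion_operator q g \<eta>) = (f \<eta> - ((l + rate) * g \<eta> - pos_op g \<eta>))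
        + (exclusion_operator q g \<eta> - (pos_op g \<eta> - rate * g \<eta>))"
      by (simp add: algebra_simps)
    ultimately show ?thesis by linarith
  qed
  with local_on_imp_local[OF g]
  show "\<exists>g. local_function g \<and> (\<forall>\<eta>. \<bar>f \<eta> - (l * g \<eta> - exclusion_operator q g \<eta>)\<bar> \<le> e)"
    by blast
qed

text \<open>The resolvent at \<open>l\<^sub>0\<close> reduces the residual at \<open>l\<close> by the factor \<open>1 - l / l\<^sub>0\<close>, up to an error.\<close>

lemma resolvent_dense_step:
  fixes q :: "int ^ 'd \<Rightarrow> real"
  assumes q: "jump_probability q" and dense: "resolvent_dense q l0" and l: "0 < l" "l \<le> l0"
    and f: "local_function f" and e: "0 < e" and g: "local_function g"
    and r: "\<And>\<eta>. \<bar>f \<eta> - (l * g \<eta> - exclusion_operator q g \<eta>)\<bar> \<le> r"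
  obtains h where "local_function h"
    "\<And>\<eta>. \<bar>f \<eta> - (l * h \<eta> - exclusion_operator q h \<eta>)\<bar> \<le> (1 - l / l0) * r + 4 * e"
proof -
  define R where "R = (\<lambda>\<eta>. f \<eta> - (l * g \<eta> - exclusion_operator q g \<eta>))"
  have "continuous_on UNIV R"
    unfolding R_def using local_function_continuous[OF f] local_function_continuous[OF g]
      exclusion_operator_continuous[OF q g] by (intro continuous_intros)
  then obtain F where F: "local_function F" "\<And>\<eta>. \<bar>R \<eta> - F \<eta>\<bar> < e"
    using continuous_local_approx[OF _ e] by blast
  obtain u where u: "local_function u" "\<And>\<eta>. \<bar>F \<eta> - (l0 * u \<eta> - exclusion_operator q u \<eta>)\<bar> \<le> e"
    using resolvent_denseD[OF dense F(1) e] by blast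
  have l0: "0 < l0" using l by simp
  have u_le: "\<bar>u \<eta>\<bar> \<le> (r + 2 * e) / l0" for \<eta>
  proof (rule resolvent_bound[OF q u(1) l0])
    show "\<bar>l0 * u \<xi> - exclusion_operator q u \<xi>\<bar> \<le> r + 2 * e" for \<xi>
      using u(2)[of \<xi>] F(2)[of \<xi>] r[of \<xi>] unfolding R_def by linarith
  qed
  \<comment> \<open>The \<open>4 e\<close> consist of \<open>e\<close> for replacing the residual by
    a local function, \<open>e\<close> for solving at \<open>l0\<close> only approximately, and
    \<open>2 e\<close> from the sup bound \<open>(r + 2 e) / l0\<close> on \<open>u\<close>.\<close>
  have "\<bar>f \<eta> - (l * (g \<eta> + u \<eta>) - exclusion_operator q (\<lambda>\<eta>. g \<eta> + u \<eta>) \<eta>)\<bar> \<le> (1 - l / l0) * r + 4 * e" for \<eta>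
  proof -
    have "f \<eta> - (l * (g \<eta> + u \<eta>) - exclusion_operator q (\<lambda>\<eta>. g \<eta> + u \<eta>) \<eta>)
        = (R \<eta> - F \<eta>) + (F \<eta> - (l0 * u \<eta> - exclusion_operator q u \<eta>)) + (l0 - l) * u \<eta>"
      by (simp add: exclusion_operator_add[OF q g u(1)] R_def algebra_simps)
    moreover have "\<bar>(l0 - l) * u \<eta>\<bar> \<le> (1 - l / l0) * r + 2 * e"
    proof -
      have "\<bar>(l0 - l) * u \<eta>\<bar> \<le> (l0 - l) * ((r + 2 * e) / l0)"
        unfolding abs_mult using l u_le[of \<eta>] by (intro mult_mono) auto
      also have "\<dots> = (1 - l / l0) * r + (1 - l / l0) * (2 * e)"
        using l0 by (simp add: field_simps)
      also have "(1 - l / l0) * (2 * e) \<le> 1 * (2 * e)"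
        using l l0 e by (intro mult_right_mono) auto
      finally show ?thesis by simp
    qed
    ultimately show ?thesis using F(2)[of \<eta>] u(2)[of \<eta>] by linarith
  qed
  then show ?thesis using that[of "\<lambda>\<eta>. g \<eta> + u \<eta>"] g u(1) by simp
qed

lemma resolvent_dense_smaller:
  fixes q :: "int ^ 'd \<Rightarrow> real"
  assumes q: "jump_probability q" and dense: "resolvent_dense q l0" and l: "0 < l" "l \<le> l0"
  shows "resolvent_dense q l"
  unfolding resolvent_dense_def
proof (intro allI impI, elim conjE)
  fix f :: "'d config \<Rightarrow> real" and e :: real
  assume f: "local_function f" and e: "0 < e"
  obtain C where C: "0 < C" "\<And>\<eta>. \<bar>f \<eta>\<bar> \<le> C" using local_function_bounded[OF f] by blast
  define \<theta> where "\<theta> = 1 - l / l0"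
  have \<theta>: "0 \<le> \<theta>" "\<theta> < 1" using l by (auto simp: \<theta>_def)
  \<comment> \<open>Chosen such that \<open>e / 2\<close> is the fixed point of
    \<open>r -> \<theta> r + 4 d\<close>; only the part \<open>\<theta> ^ k C\<close> of the
    residual then changes with \<open>k\<close>.\<close>
  define d where "d = (1 - \<theta>) * (e / 2) / 4"
  have d: "0 < d" using \<theta> e by (simp add: d_def)
  have "\<exists>g. local_function g \<and> (\<forall>\<eta>. \<bar>f \<eta> - (l * g \<eta> - exclusion_operator q g \<eta>)\<bar> \<le> \<theta> ^ k * C + e / 2)" for k
  proof (induction k)
    case 0
    have "\<bar>f \<eta> - (l * 0 - exclusion_operator q (\<lambda>_. 0) \<eta>)\<bar> \<le> C + e / 2" for \<eta>
      using exclusion_operator_cmult[OF q local_function_const[of 0], of 0 \<eta>] C(2)[of \<eta>] e by simp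
    then show ?case by (intro exI[of _ "\<lambda>_. 0"]) simp
  next
    case (Suc k)
    then obtain g where g: "local_function g"
      "\<And>\<eta>. \<bar>f \<eta> - (l * g \<eta> - exclusion_operator q g \<eta>)\<bar> \<le> \<theta> ^ k * C + e / 2" by blast
    obtain h where h: "local_function h"
      "\<And>\<eta>. \<bar>f \<eta> - (l * h \<eta> - exclusion_operator q h \<eta>)\<bar> \<le> (1 - l / l0) * (\<theta> ^ k * C + e / 2) + 4 * d"
      using resolvent_dense_step[OF q dense l f d g] by blast
    have "(1 - l / l0) * (\<theta> ^ k * C + e / 2) + 4 * d = \<theta> ^ Suc k * C + e / 2"
      unfolding \<theta>_def [symmetric] d_def by (simp add: field_simps)
    then show ?case using h by auto
  qed
  moreover have "\<exists>k. \<theta> ^ k * C < e / 2"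
  proof -
    have "(\<lambda>k. \<theta> ^ k * C) \<longlonglongrightarrow> 0 * C"
      using \<theta> by (intro tendsto_intros LIMSEQ_power_zero) simp
    then have "\<forall>\<^sub>F k in sequentially. \<theta> ^ k * C < e / 2"
      using e by (intro order_tendstoD) auto
    then show ?thesis by (auto simp: eventually_sequentially)
  qed
  then obtain k where k: "\<theta> ^ k * C < e / 2" by blast
  ultimately obtain g where g: "local_function g"
    "\<And>\<eta>. \<bar>f \<eta> - (l * g \<eta> - exclusion_operator q g \<eta>)\<bar> \<le> \<theta> ^ k * C + e / 2" by blast
  have "\<bar>f \<eta> - (l * g \<eta> - exclusion_operator q g \<eta>)\<bar> \<le> e" for \<eta> using g(2)[of \<eta>] k by linarith
  with g(1) show "\<exists>g. local_function g \<and> (\<forall>\<eta>. \<bar>f \<eta> - (l * g \<eta> - exclusion_operator q g \<eta>)\<bar> \<le> e)" by blast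
qed

lemma resolvent_dense:
  fixes q :: "int ^ 'd \<Rightarrow> real"
  assumes q: "jump_probability q" and m: "(\<lambda>y. q y * norm1 y) summable_on UNIV" and l: "0 < l"
  shows "resolvent_dense q l"
proof -
  have "q summable_on UNIV" using q by (auto simp: jump_probability_def intro: has_sum_imp_summable)
  then have "(\<lambda>y. q y + q y * norm1 y) summable_on UNIV" using m by (rule summable_on_add)
  then obtain K where K: "((\<lambda>y. q y * (1 + norm1 y)) has_sum K) UNIV"
    unfolding summable_on_def by (auto simp: distrib_left)
  show ?thesis
    \<comment> \<open>A value of the spectral parameter above both \<open>2 K\<close> and
      \<open>l\<close>.\<close>
    by (rule resolvent_dense_smaller[OF q resolvent_dense_large[OF q K, of "2 * \<bar>K\<bar> + 1 + l"] l])
       (use l in linarith)+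
qed

section \<open>Comparison of resolvents\<close>

definition second_moment :: "(int ^ 'd \<Rightarrow> real) \<Rightarrow> bool" where
  "second_moment q \<longleftrightarrow> (\<lambda>y. q y * (norm1 y)\<^sup>2) summable_on UNIV"

definition reversed :: "(int ^ 'd \<Rightarrow> real) \<Rightarrow> int ^ 'd \<Rightarrow> real" where
  "reversed q y = q (- y)"

lemma bij_uminus_lattice: "bij_betw uminus (UNIV :: (int ^ 'd) set) UNIV"
  by (rule bij_betwI[where g = uminus]) auto

lemma has_sum_uminus_lattice: "((\<lambda>y :: int ^ 'd. k (- y)) has_sum s) UNIV \<longleftrightarrow> (k has_sum s) UNIV"
  by (rule has_sum_reindex_bij_betw[OF bij_uminus_lattice])

lemma jump_probability_reversed: "jump_probability q \<Longrightarrow> jump_probability (reversed q)"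
  unfolding jump_probability_def reversed_def by (simp add: has_sum_uminus_lattice)

lemma second_moment_reversed:
  fixes q :: "int ^ 'd \<Rightarrow> real"
  assumes "second_moment q" shows "second_moment (reversed q)"
  using assms has_sum_uminus_lattice[of "\<lambda>y. q y * (norm1 y)\<^sup>2"]
  by (auto simp: second_moment_def summable_on_def reversed_def)

text \<open>Stands for the resolvent of \<open>f\<close>, which need not be local, while every
  member of the sequence stays in the class where the exclusion operator is explicit.\<close>

definition resolvent_seq ::
    "(int ^ 'd \<Rightarrow> real) \<Rightarrow> real \<Rightarrow> ('d config \<Rightarrow> real) \<Rightarrow> (nat \<Rightarrow> 'd config \<Rightarrow> real) \<Rightarrow> bool" where
  "resolvent_seq q l f g \<longleftrightarrow> (\<forall>n. local_function (g n) \<and>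
     (\<forall>\<eta>. \<bar>f \<eta> - (l * g n \<eta> - exclusion_operator q (g n) \<eta>)\<bar> \<le> inverse (real (Suc n))))"

lemma resolvent_seqD:
  assumes "resolvent_seq q l f g"
  shows "local_function (g n)"
    "\<bar>f \<eta> - (l * g n \<eta> - exclusion_operator q (g n) \<eta>)\<bar> \<le> inverse (real (Suc n))"
  using assms unfolding resolvent_seq_def by auto

lemma resolvent_seq_exists:
  assumes dense: "resolvent_dense q l" and f: "local_function f"
  obtains g where "resolvent_seq q l f g"
proof -
  have "\<forall>n. \<exists>g. local_function g \<and>
      (\<forall>\<eta>. \<bar>f \<eta> - (l * g \<eta> - exclusion_operator q g \<eta>)\<bar> \<le> inverse (real (Suc n)))"
  proof
    fix n
    have "0 < inverse (real (Suc n))" by simp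
    with dense f show "\<exists>g. local_function g \<and>
        (\<forall>\<eta>. \<bar>f \<eta> - (l * g \<eta> - exclusion_operator q g \<eta>)\<bar> \<le> inverse (real (Suc n)))"
      unfolding resolvent_dense_def by simp
  qed
  from choice[OF this] obtain g where "resolvent_seq q l f g"
    unfolding resolvent_seq_def by (rule exE)
  then show ?thesis by (rule that)
qed

lemma resolvent_seq_bounded:
  assumes q: "jump_probability q" and l: "0 < l" and g: "resolvent_seq q l f g"
    and C: "\<And>\<eta>. \<bar>f \<eta>\<bar> \<le> C"
  shows "\<bar>g n \<eta>\<bar> \<le> (C + 1) / l"
proof (rule resolvent_bound[OF q resolvent_seqD(1)[OF g] l])
  fix \<xi>
  have "inverse (real (Suc n)) \<le> 1" by (simp add: field_simps)
  then show "\<bar>l * g n \<xi> - exclusion_operator q (g n) \<xi>\<bar> \<le> C + 1"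
    using resolvent_seqD(2)[OF g, of \<xi> n] C[of \<xi>] by linarith
qed

section \<open>Dirichlet forms and their comparison with the energy\<close>

context exchangeable
begin

lemma abs_expectation_mult_le:
  fixes g h :: "'d config \<Rightarrow> real"
  assumes "continuous_on UNIV g" "continuous_on UNIV h" "\<And>\<eta>. \<bar>g \<eta>\<bar> \<le> a" "\<And>\<eta>. \<bar>h \<eta>\<bar> \<le> b"
  shows "\<bar>expectation (\<lambda>\<eta>. g \<eta> * h \<eta>)\<bar> \<le> a * b"
proof (rule abs_expectation_le)
  show "continuous_on UNIV (\<lambda>\<eta>. g \<eta> * h \<eta>)" using assms(1,2) by (rule continuous_on_mult)
  fix \<eta>
  have "0 \<le> a" using assms(3)[of \<eta>] by linarith
  then show "\<bar>g \<eta> * h \<eta>\<bar> \<le> a * b"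
    unfolding abs_mult using assms(3)[of \<eta>] assms(4)[of \<eta>] by (intro mult_mono) auto
qed

definition dirichlet :: "(int ^ 'd \<Rightarrow> real) \<Rightarrow> ('d config \<Rightarrow> real) \<Rightarrow> real" where
  "dirichlet q g = - expectation (\<lambda>\<eta>. g \<eta> * exclusion_operator q g \<eta>)"

text \<open>The drift drops out by \<open>drift_self\<close>, so the Dirichlet form is a sum of
  nonnegative terms although the process is not reversible.\<close>

lemma dirichlet_has_sum:
  assumes q: "jump_probability q" and g: "local_function g"
  shows "((\<lambda>y. q y * ((grad g y)\<^sup>2 / 4)) has_sum dirichlet q g) UNIV"
  using has_sum_uminusI[OF expectation_exclusion_operator[OF q g g]]
  by (simp add: dirichlet_def drift_self[OF g] form_self)

lemma dirichlet_nonneg: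
  assumes q: "jump_probability q" and g: "local_function g"
  shows "0 \<le> dirichlet q g"
  by (rule has_sum_nonneg[OF dirichlet_has_sum[OF q g]]) (use q in \<open>simp add: jump_probability_def\<close>)

lemma grad_le_dirichlet:
  assumes q: "jump_probability q" and g: "local_function g" and y: "0 < q y"
  shows "grad g y \<le> 2 / sqrt (q y) * sqrt (dirichlet q g)"
proof -
  have "(\<Sum>z\<in>{y}. q z * ((grad g z)\<^sup>2 / 4)) \<le> dirichlet q g"
    by (rule finite_sum_le_has_sum[OF dirichlet_has_sum[OF q g]]) (use q in \<open>auto simp: jump_probability_def\<close>)
  then have "(grad g y)\<^sup>2 \<le> 4 / q y * dirichlet q g" using y by (simp add: field_simps)
  then have "grad g y \<le> sqrt (4 / q y * dirichlet q g)" by (rule real_le_rsqrt)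
  then show ?thesis by (simp add: real_sqrt_mult real_sqrt_divide)
qed

text \<open>Induction along a path of the symmetrized walk. Each step costs a gradient that is
  bounded by a single term of the Dirichlet sum; since gradients are even in the jump, a step may
  also be one that \<open>q\<close> only allows backwards. The constant depends on the path, not on
  \<open>g\<close>.\<close>

lemma grad_le_dirichlet_reachable:
  assumes q: "jump_probability q" and reach: "(0, y) \<in> {(u, v). 0 < symmetric_part q (v - u)}\<^sup>*"
  shows "\<exists>C\<ge>0. \<forall>g. local_function g \<longrightarrow> grad g y \<le> C * sqrt (dirichlet q g)"
  using reach
proof (induction rule: rtrancl_induct)
  case base
  show ?case using dirichlet_nonneg[OF q] by (intro exI[of _ 0]) simp
next
  case (step u v)
  then obtain C where C: "0 \<le> C" "\<And>g. local_function g \<Longrightarrow> grad g u \<le> C * sqrt (dirichlet q g)" by auto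
  have "0 < q (v - u) \<or> 0 < q (- (v - u))"
    using step.hyps(2) q unfolding symmetric_part_def jump_probability_def
    by (smt (verit) case_prodD divide_pos_pos mem_Collect_eq zero_less_divide_iff)
  then obtain w where w: "0 < q w" "w = v - u \<or> w = - (v - u)" by blast
  let ?D = "2 / sqrt (q w)"
  have "grad g v \<le> (2 * C + ?D) * sqrt (dirichlet q g)" if g: "local_function g" for g
  proof -
    have "grad g v \<le> 2 * grad g u + grad g (v - u)" using grad_add[OF g, of u "v - u"] by simp
    moreover have "grad g (v - u) = grad g w" using w(2) grad_uminus[of g "v - u"] by auto
    moreover have "grad g w \<le> ?D * sqrt (dirichlet q g)" by (rule grad_le_dirichlet[OF q g w(1)])
    ultimately show ?thesis using C(2)[OF g] by (simp add: algebra_simps)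
  qed
  then show ?case using C(1) w(1) by (intro exI[of _ "2 * C + ?D"]) auto
qed

text \<open>The constant is taken at least 1 so that it also covers the mass term
  \<open>l (l2 g)^2\<close> when both terms are estimated together.\<close>

definition coercive :: "(int ^ 'd \<Rightarrow> real) \<Rightarrow> bool" where
  "coercive q \<longleftrightarrow> (\<exists>C\<ge>1. \<forall>g. local_function g \<longrightarrow> energy g \<le> C * dirichlet q g)"

lemma irreducible_coercive:
  assumes q: "jump_probability q" and irr: "irreducible_jumps (symmetric_part q)"
  shows "coercive q"
proof -
  have "\<forall>i. \<exists>C\<ge>0. \<forall>g. local_function g \<longrightarrow> grad g (axis i 1) \<le> C * sqrt (dirichlet q g)"
    using grad_le_dirichlet_reachable[OF q] irr unfolding irreducible_jumps_def by blast
  from choice[OF this] obtain C where C: "\<And>i. 0 \<le> C i"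
    "\<And>i g. local_function g \<Longrightarrow> grad g (axis i 1) \<le> C i * sqrt (dirichlet q g)" by auto
  let ?C = "1 + (\<Sum>i\<in>UNIV. (C i)\<^sup>2)"
  have "energy g \<le> ?C * dirichlet q g" if g: "local_function g" for g
  proof -
    have "(grad g (axis i 1))\<^sup>2 \<le> (C i)\<^sup>2 * dirichlet q g" for i
    proof -
      have "(grad g (axis i 1))\<^sup>2 \<le> (C i * sqrt (dirichlet q g))\<^sup>2"
        by (rule power_mono[OF C(2)[OF g]]) simp
      then show ?thesis using dirichlet_nonneg[OF q g] by (simp add: power_mult_distrib)
    qed
    then have "energy g \<le> (\<Sum>i\<in>UNIV. (C i)\<^sup>2 * dirichlet q g)"
      unfolding energy_def by (rule sum_mono)
    also have "\<dots> \<le> ?C * dirichlet q g"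
      using dirichlet_nonneg[OF q g] by (simp add: sum_distrib_right distrib_right)
    finally show ?thesis .
  qed
  moreover have "1 \<le> ?C" by (simp add: sum_nonneg)
  ultimately show ?thesis unfolding coercive_def by blast
qed

text \<open>Gradients grow at most linearly in the jump, with constant 4, so each jump contributes
  at most \<open>4 |y|^2\<close> times the energy, and the second moment sums this up.\<close>

lemma dirichlet_le_energy:
  assumes q: "jump_probability q" and m: "second_moment q"
  obtains C where "1 \<le> C" "\<And>g. local_function g \<Longrightarrow> dirichlet q g \<le> C * energy g"
proof -
  obtain M where M: "((\<lambda>y. q y * (norm1 y)\<^sup>2) has_sum M) UNIV"
    using m unfolding second_moment_def summable_on_def by blast
  have q0: "0 \<le> q y" for y using q by (simp add: jump_probability_def)
  have M0: "0 \<le> M" by (rule has_sum_nonneg[OF M]) (simp add: q0)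
  have "dirichlet q g \<le> (1 + 4 * M) * energy g" if g: "local_function g" for g
  proof -
    have "dirichlet q g \<le> 4 * energy g * M"
    proof (rule has_sum_mono[OF dirichlet_has_sum[OF q g] has_sum_cmult_right[OF M]])
      fix y
      have "(grad g y)\<^sup>2 \<le> (4 * norm1 y * sqrt (energy g))\<^sup>2"
        by (rule power_mono[OF grad_le_energy[OF g]]) simp
      then have "(grad g y)\<^sup>2 / 4 \<le> 4 * energy g * (norm1 y)\<^sup>2"
        by (simp add: power_mult_distrib mult.commute mult.left_commute)
      then have "q y * ((grad g y)\<^sup>2 / 4) \<le> q y * (4 * energy g * (norm1 y)\<^sup>2)"
        by (rule mult_left_mono) (rule q0)
      then show "q y * ((grad g y)\<^sup>2 / 4) \<le> 4 * energy g * (q y * (norm1 y)\<^sup>2)"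
        by (simp add: algebra_simps)
    qed
    also have "4 * energy g * M \<le> (1 + 4 * M) * energy g" by (simp add: algebra_simps)
    finally show ?thesis .
  qed
  then show ?thesis using M0 by (intro that[of "1 + 4 * M"]) auto
qed

text \<open>The part of the drift that is linear in the jump cancels because the means agree; the rest is
  quadratic in the jump and controlled by the energies.\<close>

lemma sector_bound:
  fixes q q' :: "int ^ 'd \<Rightarrow> real"
  assumes q: "jump_probability q" "second_moment q" and q': "jump_probability q'" "second_moment q'"
    and mean: "\<And>i. ((\<lambda>y. q y * real_of_int (y $ i)) has_sum c * m i) UNIV"
    and mean': "\<And>i. ((\<lambda>y. q' y * real_of_int (y $ i)) has_sum m i) UNIV"
  obtains K where "0 \<le> K" "\<And>h g. local_function h \<Longrightarrow> local_function g \<Longrightarrow>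
    \<bar>expectation (\<lambda>\<eta>. h \<eta> * exclusion_operator q g \<eta>) - c * expectation (\<lambda>\<eta>. h \<eta> * exclusion_operator q' g \<eta>)\<bar>
      \<le> K * (sqrt (energy h) * sqrt (energy g))"
proof -
  obtain M where M: "((\<lambda>y. q y * (norm1 y)\<^sup>2) has_sum M) UNIV"
    using q(2) unfolding second_moment_def summable_on_def by blast
  obtain M' where M': "((\<lambda>y. q' y * (norm1 y)\<^sup>2) has_sum M') UNIV"
    using q'(2) unfolding second_moment_def summable_on_def by blast
  have q0: "0 \<le> q y" "0 \<le> q' y" for y using q q' by (simp_all add: jump_probability_def)
  have M0: "0 \<le> M" "0 \<le> M'" by (rule has_sum_nonneg[OF M] has_sum_nonneg[OF M'], simp add: q0)+
  define k where "k = (\<lambda>y. q y - c * q' y)"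
  \<comment> \<open>Half of the constant in \<open>drift_almost_linear\<close>, plus
    \<open>16 / 4\<close> for the symmetric form, whose gradients contribute a factor 4
    each.\<close>
  define D where "D = (real CARD('d) + 7) * 64 / 2 + 4"
  define M2 where "M2 = M + \<bar>c\<bar> * M'"
  have kM: "((\<lambda>y. (q y + \<bar>c\<bar> * q' y) * (norm1 y)\<^sup>2) has_sum M2) UNIV"
    unfolding M2_def using has_sum_add[OF M has_sum_cmult_right[OF M', of "\<bar>c\<bar>"]] by (simp add: algebra_simps)
  have k_le: "\<bar>k y\<bar> \<le> q y + \<bar>c\<bar> * q' y" for y
    unfolding k_def using q0[of y] abs_triangle_ineq4[of "q y" "c * q' y"] by (simp add: abs_mult)
  have "\<bar>expectation (\<lambda>\<eta>. h \<eta> * exclusion_operator q g \<eta>) - c * expectation (\<lambda>\<eta>. h \<eta> * exclusion_operator q' g \<eta>)\<bar>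
      \<le> D * M2 * (sqrt (energy h) * sqrt (energy g))" if h: "local_function h" and g: "local_function g" for h g
  proof -
    define E where "E = expectation (\<lambda>\<eta>. h \<eta> * exclusion_operator q g \<eta>)
      - c * expectation (\<lambda>\<eta>. h \<eta> * exclusion_operator q' g \<eta>)"
    define s where "s = sqrt (energy h) * sqrt (energy g)"
    have s0: "0 \<le> s" by (simp add: s_def)
    let ?lin = "\<lambda>y. \<Sum>i\<in>UNIV. real_of_int (y $ i) * drift h g (axis i 1)"
    let ?t = "\<lambda>y. drift h g y / 2 - form h g y / 4"
    have 1: "((\<lambda>y. k y * ?t y) has_sum E) UNIV"
    proof -
      have "((\<lambda>y. q y * ?t y + - (c * (q' y * ?t y))) has_sum
          expectation (\<lambda>\<eta>. h \<eta> * exclusion_operator q g \<eta>)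
          + - (c * expectation (\<lambda>\<eta>. h \<eta> * exclusion_operator q' g \<eta>))) UNIV"
        by (intro has_sum_add has_sum_uminusI has_sum_cmult_right
            expectation_exclusion_operator[OF q(1) h g] expectation_exclusion_operator[OF q'(1) h g])
      moreover have "q y * ?t y + - (c * (q' y * ?t y)) = k y * ?t y" for y
        unfolding k_def left_diff_distrib by (simp add: mult.assoc)
      ultimately show ?thesis unfolding E_def by simp
    qed
    have lin: "((\<lambda>y. k y * real_of_int (y $ i) * (drift h g (axis i 1) / 2)) has_sum 0) UNIV" for i
    proof -
      have "((\<lambda>y. q y * real_of_int (y $ i) + - (c * (q' y * real_of_int (y $ i)))) has_sum (c * m i + - (c * m i))) UNIV"
        by (intro has_sum_add has_sum_uminusI has_sum_cmult_right mean mean')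
      then have "((\<lambda>y. k y * real_of_int (y $ i)) has_sum 0) UNIV"
        by (simp add: k_def left_diff_distrib mult.assoc)
      from has_sum_cmult_left[OF this, of "drift h g (axis i 1) / 2"] show ?thesis
        by (simp only: mult_zero_left)
    qed
    have lins: "((\<lambda>y. \<Sum>i\<in>I. k y * real_of_int (y $ i) * (drift h g (axis i 1) / 2)) has_sum 0) UNIV" if "finite I" for I
      using that
    proof induction
      case (insert j I)
      from has_sum_add[OF lin[of j] insert.IH] insert.hyps show ?case by simp
    qed simp
    have 2: "((\<lambda>y. k y * ?t y + - (\<Sum>i\<in>UNIV. k y * real_of_int (y $ i) * (drift h g (axis i 1) / 2))) has_sum E + - 0) UNIV"
      by (intro has_sum_add 1 has_sum_uminusI lins) simp
    have le: "\<bar>k y * ?t y + - (\<Sum>i\<in>UNIV. k y * real_of_int (y $ i) * (drift h g (axis i 1) / 2))\<bar>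
        \<le> D * s * ((q y + \<bar>c\<bar> * q' y) * (norm1 y)\<^sup>2)" for y
    proof -
      have "\<bar>drift h g y - ?lin y\<bar> \<le> (real CARD('d) + 7) * (64 * sqrt (energy h) * sqrt (energy g)) * (norm1 y)\<^sup>2"
        by (rule drift_almost_linear[OF h g])
      then have d: "\<bar>drift h g y - ?lin y\<bar> \<le> (real CARD('d) + 7) * 64 * (s * (norm1 y)\<^sup>2)"
        by (simp add: s_def algebra_simps)
      have "\<bar>form h g y\<bar> \<le> grad h y * grad g y" by (rule form_le_grad[OF h g])
      also have "\<dots> \<le> (4 * norm1 y * sqrt (energy h)) * (4 * norm1 y * sqrt (energy g))"
        by (intro mult_mono grad_le_energy h g) auto
      finally have f: "\<bar>form h g y\<bar> \<le> 16 * (s * (norm1 y)\<^sup>2)"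
        by (simp add: s_def power2_eq_square algebra_simps)
      have eq: "k y * ?t y + - (\<Sum>i\<in>UNIV. k y * real_of_int (y $ i) * (drift h g (axis i 1) / 2))
          = k y * ((drift h g y - ?lin y) / 2 - form h g y / 4)"
        by (simp add: sum_distrib_left sum_divide_distrib algebra_simps diff_divide_distrib)
      have "\<bar>(drift h g y - ?lin y) / 2 - form h g y / 4\<bar> \<le> D * (s * (norm1 y)\<^sup>2)"
      proof -
        define Z where "Z = s * (norm1 y)\<^sup>2"
        define Y where "Y = (real CARD('d) + 7) * 64 * Z"
        have "D * Z = Y / 2 + 4 * Z" by (simp add: D_def Y_def algebra_simps)
        moreover have "\<bar>drift h g y - ?lin y\<bar> \<le> Y" "\<bar>form h g y\<bar> \<le> 16 * Z"
          using d f by (simp_all add: Y_def Z_def)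
        moreover have "\<bar>a / 2 - b / 4\<bar> \<le> Y / 2 + 4 * Z" if "\<bar>a\<bar> \<le> Y" "\<bar>b\<bar> \<le> 16 * Z" for a b
          using that by linarith
        ultimately show ?thesis unfolding Z_def [symmetric] by simp
      qed
      then have "\<bar>k y\<bar> * \<bar>(drift h g y - ?lin y) / 2 - form h g y / 4\<bar>
          \<le> (q y + \<bar>c\<bar> * q' y) * (D * (s * (norm1 y)\<^sup>2))"
        using k_le[of y] q0[of y] by (intro mult_mono) auto
      then show ?thesis unfolding eq abs_mult by (simp add: algebra_simps)
    qed
    have dom: "((\<lambda>y. D * s * ((q y + \<bar>c\<bar> * q' y) * (norm1 y)\<^sup>2)) has_sum D * s * M2) UNIV"
      by (rule has_sum_cmult_right[OF kM])
    have "E + - 0 \<le> D * s * M2"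
      by (rule has_sum_mono[OF 2 dom]) (use le abs_le_D1 in blast)
    moreover have "- (E + - 0) \<le> D * s * M2"
      by (rule has_sum_mono[OF has_sum_uminusI[OF 2] dom]) (use le abs_le_D2 in blast)
    ultimately have "\<bar>E\<bar> \<le> D * s * M2" by linarith
    then show ?thesis by (simp add: E_def s_def mult.assoc mult.left_commute mult.commute)
  qed
  moreover have "0 \<le> D * M2" using M0 by (simp add: D_def M2_def)
  ultimately show ?thesis by (intro that[of "D * M2"])
qed

section \<open>Energies of linear combinations and the adjoint operator\<close>

lemma edge_add:
  assumes g: "local_function g" and h: "local_function h"
  shows "edge x z (\<lambda>\<eta>. g \<eta> + h \<eta>) \<le> edge x z g + edge x z h"
proof -
  have "edge x z (\<lambda>\<eta>. g \<eta> + h \<eta>) = l2 (\<lambda>\<eta>. (g (exchange \<eta> x z) - g \<eta>) + (h (exchange \<eta> x z) - h \<eta>))"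
    unfolding edge_def by (simp add: algebra_simps)
  also have "\<dots> \<le> edge x z g + edge x z h"
    unfolding edge_def using g h by (intro l2_triangle) auto
  finally show ?thesis .
qed

lemma sum_power2_le: "(a + b)\<^sup>2 \<le> 2 * a\<^sup>2 + 2 * b\<^sup>2" for a b :: real
  using zero_le_power2[of "a - b"] by (simp add: power2_sum power2_diff)

lemma energy_add:
  assumes g: "local_function g" and h: "local_function h"
  shows "energy (\<lambda>\<eta>. g \<eta> + h \<eta>) \<le> 2 * energy g + 2 * energy h"
proof -
  obtain A where A: "local_on A g" "local_on A h" "finite A" using local_function_common[OF g h] .
  have "local_on (A \<union> A) (\<lambda>\<eta>. g \<eta> + h \<eta>)" by (rule local_on_comp2[OF A(1,2)])
  then have gh: "local_on A (\<lambda>\<eta>. g \<eta> + h \<eta>)" by simp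
  have "(grad (\<lambda>\<eta>. g \<eta> + h \<eta>) y)\<^sup>2 \<le> 2 * (grad g y)\<^sup>2 + 2 * (grad h y)\<^sup>2" for y
  proof -
    note F = finite_touching[OF A(3), of y]
    have "grad (\<lambda>\<eta>. g \<eta> + h \<eta>) y \<le> L2_set (\<lambda>x. edge x (x + y) g + edge x (x + y) h) (touching A y)"
      unfolding grad_eq_L2_set[OF gh F order_refl] using edge_add[OF g h] by (intro L2_set_mono) auto
    also have "\<dots> \<le> grad g y + grad h y"
      unfolding grad_eq_L2_set[OF A(1) F order_refl] grad_eq_L2_set[OF A(2) F order_refl]
      by (rule L2_set_triangle_ineq)
    finally have "(grad (\<lambda>\<eta>. g \<eta> + h \<eta>) y)\<^sup>2 \<le> (grad g y + grad h y)\<^sup>2"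
      by (rule power_mono) simp
    then show ?thesis using sum_power2_le[of "grad g y" "grad h y"] by linarith
  qed
  then have "energy (\<lambda>\<eta>. g \<eta> + h \<eta>) \<le> (\<Sum>i\<in>UNIV. 2 * (grad g (axis i 1))\<^sup>2 + 2 * (grad h (axis i 1))\<^sup>2)"
    unfolding energy_def by (rule sum_mono)
  then show ?thesis by (simp add: energy_def sum.distrib sum_distrib_left)
qed

lemma energy_cmult: "energy (\<lambda>\<eta>. c * g \<eta>) = c\<^sup>2 * energy g"
proof -
  have "edge x z (\<lambda>\<eta>. c * g \<eta>) = \<bar>c\<bar> * edge x z g" for x z
    unfolding edge_def using l2_cmult[of c "\<lambda>\<eta>. g (exchange \<eta> x z) - g \<eta>"] by (simp add: right_diff_distrib)
  then have "(grad (\<lambda>\<eta>. c * g \<eta>) y)\<^sup>2 = c\<^sup>2 * (grad g y)\<^sup>2" for y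
    by (simp add: grad_def power_mult_distrib infsum_cmult_right' infsum_nonneg)
  then show ?thesis by (simp add: energy_def sum_distrib_left)
qed

text \<open>Moving the exchange to the other factor changes a single bond term by
  \<open>2 E (h g current)\<close>. These corrections sum to 0 over all translates by
  \<open>current_sum_zero\<close>.\<close>

lemma drift_reverse:
  assumes h: "local_function h" and g: "local_function g"
  shows "drift g h (- y) = drift h g y"
proof -
  obtain A where A: "local_on A h" "local_on A g" "finite A" using local_function_common[OF h g] .
  note F = finite_touching[OF A(3), of y]
  have bond: "bond_drift z x g h = bond_drift x z h g + 2 * expectation (\<lambda>\<eta>. h \<eta> * g \<eta> * current \<eta> x z)" for x z
  proof -
    let ?k = "\<lambda>\<eta>. g \<eta> * current \<eta> x z * h (exchange \<eta> x z)"
    have "expectation (\<lambda>\<eta>. h \<eta> * current \<eta> x z * g (exchange \<eta> x z)) = expectation (\<lambda>\<eta>. - ?k \<eta>)"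
      using expectation_exchange[of "\<lambda>\<eta>. - ?k \<eta>" x z] h g by (simp add: current_exchange algebra_simps)
    then have "expectation (\<lambda>\<eta>. h \<eta> * current \<eta> x z * g (exchange \<eta> x z)) = - expectation ?k"
      by simp
    moreover have "bond_drift x z h g = expectation (\<lambda>\<eta>. h \<eta> * current \<eta> x z * g (exchange \<eta> x z))
        - expectation (\<lambda>\<eta>. h \<eta> * g \<eta> * current \<eta> x z)"
      unfolding bond_drift_def using h g
      by (subst Bochner_Integration.integral_diff [symmetric]) (auto simp: algebra_simps)
    moreover have "bond_drift x z g h = expectation ?k - expectation (\<lambda>\<eta>. h \<eta> * g \<eta> * current \<eta> x z)"
      unfolding bond_drift_def using h g
      by (subst Bochner_Integration.integral_diff [symmetric]) (auto simp: algebra_simps)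
    ultimately show ?thesis using bond_drift_commute[of z x g h] by simp
  qed
  have hg: "local_on A (\<lambda>\<eta>. h \<eta> * g \<eta>)" using local_on_comp2[OF A(1,2), of "(*)"] by simp
  have "drift g h (- y) = (\<Sum>\<^sub>\<infinity>x. bond_drift (x + y) x g h)"
    unfolding drift_def using infsum_translate[of "\<lambda>x. bond_drift x (x + - y) g h" y] by simp
  also have "\<dots> = (\<Sum>x\<in>touching A y. bond_drift (x + y) x g h)"
    by (rule infsum_finite_support[OF F], rule bond_drift_outside[OF A(1)])
       (use not_touching[of _ A y] in auto)
  also have "\<dots> = (\<Sum>x\<in>touching A y. bond_drift x (x + y) h g)
      + 2 * (\<Sum>x\<in>touching A y. expectation (\<lambda>\<eta>. h \<eta> * g \<eta> * current \<eta> x (x + y)))"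
    by (simp add: bond sum.distrib sum_distrib_left)
  finally show ?thesis
    using current_sum_zero[OF hg F order_refl] by (simp add: drift_eq_sum[OF A(2) F order_refl])
qed

lemma form_reverse: "form g h (- y) = form h g y"
  unfolding form_def using infsum_translate[of "\<lambda>x. bond_form x (x + - y) g h" y]
  by (simp add: bond_form_def exchange_commute[of _ "_ + y"] mult.commute)

text \<open>Jump by jump, reversing \<open>y\<close> swaps the two arguments of both drift and
  form.\<close>

lemma exclusion_operator_adjoint:
  assumes q: "jump_probability q" and h: "local_function h" and g: "local_function g"
  shows "expectation (\<lambda>\<eta>. h \<eta> * exclusion_operator q g \<eta>)
    = expectation (\<lambda>\<eta>. g \<eta> * exclusion_operator (reversed q) h \<eta>)"
proof -
  have "((\<lambda>y. reversed q (- y) * (drift g h (- y) / 2 - form g h (- y) / 4)) has_sum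
      expectation (\<lambda>\<eta>. g \<eta> * exclusion_operator (reversed q) h \<eta>)) UNIV"
    using expectation_exclusion_operator[OF jump_probability_reversed[OF q] g h]
    unfolding has_sum_uminus_lattice[of "\<lambda>y. reversed q y * (drift g h y / 2 - form g h y / 4)"] .
  then have "((\<lambda>y. q y * (drift h g y / 2 - form h g y / 4)) has_sum
      expectation (\<lambda>\<eta>. g \<eta> * exclusion_operator (reversed q) h \<eta>)) UNIV"
    by (simp add: reversed_def drift_reverse[OF h g] form_reverse)
  from has_sum_unique[OF expectation_exclusion_operator[OF q h g] this] show ?thesis .
qed

lemma coercive_reversed:
  assumes q: "jump_probability q" and "coercive q" shows "coercive (reversed q)"
proof -
  have "dirichlet (reversed q) g = dirichlet q g" if "local_function g" for g
    using exclusion_operator_adjoint[OF q that that] by (simp add: dirichlet_def)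
  then show ?thesis using assms(2) unfolding coercive_def by simp
qed

text \<open>The squared norm in which approximate resolvents are compared. It uses the
  nearest-neighbour energy and is therefore the same for both processes.\<close>

definition resolvent_energy :: "real \<Rightarrow> ('d config \<Rightarrow> real) \<Rightarrow> real" where
  "resolvent_energy l g = l * (l2 g)\<^sup>2 + energy g"

lemma resolvent_energy_nonneg: "0 \<le> l \<Longrightarrow> 0 \<le> resolvent_energy l g"
  by (simp add: resolvent_energy_def)

lemma resolvent_energy_add:
  assumes "0 \<le> l" "local_function g" "local_function h"
  shows "resolvent_energy l (\<lambda>\<eta>. g \<eta> + h \<eta>) \<le> 2 * resolvent_energy l g + 2 * resolvent_energy l h"
proof -
  have "(l2 (\<lambda>\<eta>. g \<eta> + h \<eta>))\<^sup>2 \<le> (l2 g + l2 h)\<^sup>2"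
    by (rule power_mono[OF l2_triangle[OF assms(2,3)]]) simp
  then have "(l2 (\<lambda>\<eta>. g \<eta> + h \<eta>))\<^sup>2 \<le> 2 * (l2 g)\<^sup>2 + 2 * (l2 h)\<^sup>2"
    using sum_power2_le[of "l2 g" "l2 h"] by linarith
  then have "l * (l2 (\<lambda>\<eta>. g \<eta> + h \<eta>))\<^sup>2 \<le> l * (2 * (l2 g)\<^sup>2 + 2 * (l2 h)\<^sup>2)"
    using assms(1) by (rule mult_left_mono)
  then show ?thesis
    using energy_add[OF assms(2,3)] by (simp add: resolvent_energy_def algebra_simps)
qed

lemma resolvent_energy_cmult: "resolvent_energy l (\<lambda>\<eta>. c * g \<eta>) = c\<^sup>2 * resolvent_energy l g"
  by (simp add: resolvent_energy_def l2_cmult energy_cmult power_mult_distrib algebra_simps)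

section \<open>Testing approximate resolvent equations\<close>

lemma resolvent_continuous:
  assumes "jump_probability q" "local_function g"
  shows "continuous_on UNIV (\<lambda>\<eta>. l * g \<eta> - exclusion_operator q g \<eta>)"
  using local_function_continuous[OF assms(2)] exclusion_operator_continuous[OF assms]
  by (intro continuous_intros)

lemma expectation_resolvent:
  assumes q: "jump_probability q" and h: "local_function h" and g: "local_function g"
  shows "expectation (\<lambda>\<eta>. h \<eta> * (l * g \<eta> - exclusion_operator q g \<eta>))
    = l * expectation (\<lambda>\<eta>. h \<eta> * g \<eta>) - expectation (\<lambda>\<eta>. h \<eta> * exclusion_operator q g \<eta>)"
proof -
  have "continuous_on UNIV (\<lambda>\<eta>. h \<eta> * exclusion_operator q g \<eta>)"
    using local_function_continuous[OF h] exclusion_operator_continuous[OF q g] by (rule continuous_on_mult)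
  then have int: "integrable \<mu> (\<lambda>\<eta>. h \<eta> * exclusion_operator q g \<eta>)"
    by (rule continuous_integrable)
  have "(\<lambda>\<eta>. h \<eta> * (l * g \<eta> - exclusion_operator q g \<eta>))
      = (\<lambda>\<eta>. l * (h \<eta> * g \<eta>) - h \<eta> * exclusion_operator q g \<eta>)"
    by (simp add: algebra_simps)
  then show ?thesis
    using int h g by (simp add: Bochner_Integration.integral_diff)
qed

lemma expectation_resolvent_self:
  assumes "jump_probability q" "local_function g"
  shows "expectation (\<lambda>\<eta>. g \<eta> * (l * g \<eta> - exclusion_operator q g \<eta>)) = l * (l2 g)\<^sup>2 + dirichlet q g"
  unfolding expectation_resolvent[OF assms(1) assms(2) assms(2)] l2_power2 dirichlet_def
  by (simp add: power2_eq_square)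

text \<open>Young's inequality \<open>2 D x y <= x^2 + D^2 y^2\<close> absorbs the cross term into
  the left-hand side.\<close>

lemma quadratic_absorb:
  fixes x y B D :: real
  assumes "x\<^sup>2 \<le> B + D * (x * y)" shows "x\<^sup>2 \<le> 2 * B + D\<^sup>2 * y\<^sup>2"
proof -
  have "2 * (x * (D * y)) \<le> x\<^sup>2 + (D * y)\<^sup>2"
    using zero_le_power2[of "x - D * y"] by (simp add: power2_diff)
  then show ?thesis using assms by (simp add: power_mult_distrib algebra_simps)
qed

text \<open>With \<open>w = h / c - g\<close> one has \<open>(c l - c L') w = (f' - f) + (1 - c) l g - (L - c L') g\<close>, where
  \<open>f = (l - L) g\<close> and \<open>f' = (l - L') h\<close>. Testing with \<open>w\<close> bounds the energy of \<open>w\<close> by that of \<open>g\<close>.\<close>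

lemma resolvent_energy_compare:
  assumes q: "jump_probability q" and q': "jump_probability q'" and c: "0 < c" and K: "0 \<le> K"
    and sector: "\<And>h g. local_function h \<Longrightarrow> local_function g \<Longrightarrow>
      \<bar>expectation (\<lambda>\<eta>. h \<eta> * exclusion_operator q g \<eta>) - c * expectation (\<lambda>\<eta>. h \<eta> * exclusion_operator q' g \<eta>)\<bar>
        \<le> K * (sqrt (energy h) * sqrt (energy g))"
    and C1: "1 \<le> C1" "\<And>g. local_function g \<Longrightarrow> energy g \<le> C1 * dirichlet q' g"
    and l: "0 < l" and g: "local_function g" and h: "local_function h"
  defines "w \<equiv> \<lambda>\<eta>. h \<eta> / c - g \<eta>"
  defines "d \<equiv> \<bar>expectation (\<lambda>\<eta>. w \<eta> * ((l * h \<eta> - exclusion_operator q' h \<eta>) - (l * g \<eta> - exclusion_operator q g \<eta>)))\<bar>"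
  shows "resolvent_energy l w \<le> 2 * (C1 / c * d) + (C1 / c * (\<bar>1 - c\<bar> + K))\<^sup>2 * resolvent_energy l g"
proof -
  have w: "local_function w" unfolding w_def using g h by simp
  let ?E = "\<lambda>u v. expectation (\<lambda>\<eta>. u \<eta> * v \<eta>)"
  let ?L = "exclusion_operator q" and ?L' = "exclusion_operator q'"
  define x y where "x = sqrt (resolvent_energy l w)" and "y = sqrt (resolvent_energy l g)"
  have x2: "x\<^sup>2 = resolvent_energy l w" and y2: "y\<^sup>2 = resolvent_energy l g"
    using l by (simp_all add: x_def y_def resolvent_energy_nonneg)
  have L'w: "?L' w \<eta> = ?L' h \<eta> / c - ?L' g \<eta>" for \<eta>
    unfolding w_def using exclusion_operator_linear[OF q' h g, of "1 / c" "-1" \<eta>] by simp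
  have cont: "continuous_on UNIV (\<lambda>\<eta>. w \<eta> * (l * h \<eta> - ?L' h \<eta>))" "continuous_on UNIV (\<lambda>\<eta>. w \<eta> * (l * g \<eta> - ?L g \<eta>))"
      "continuous_on UNIV (\<lambda>\<eta>. w \<eta> * (l * g \<eta> - ?L' g \<eta>))"
    by (rule continuous_on_mult[OF local_function_continuous[OF w]],
        rule resolvent_continuous[OF q' h] resolvent_continuous[OF q g] resolvent_continuous[OF q' g])+
  have D: "expectation (\<lambda>\<eta>. w \<eta> * ((l * h \<eta> - ?L' h \<eta>) - (l * g \<eta> - ?L g \<eta>)))
      = expectation (\<lambda>\<eta>. w \<eta> * (l * h \<eta> - ?L' h \<eta>)) - expectation (\<lambda>\<eta>. w \<eta> * (l * g \<eta> - ?L g \<eta>))"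
    using cont(1,2)[THEN continuous_integrable] by (simp add: right_diff_distrib)
  have "l * (l2 w)\<^sup>2 + dirichlet q' w = expectation (\<lambda>\<eta>. w \<eta> * (l * w \<eta> - ?L' w \<eta>))"
    by (rule expectation_resolvent_self[OF q' w, symmetric])
  also have "(\<lambda>\<eta>. w \<eta> * (l * w \<eta> - ?L' w \<eta>))
      = (\<lambda>\<eta>. (w \<eta> * (l * h \<eta> - ?L' h \<eta>)) / c - w \<eta> * (l * g \<eta> - ?L' g \<eta>))"
  proof
    fix \<eta>
    have "l * w \<eta> - ?L' w \<eta> = (l * h \<eta> - ?L' h \<eta>) / c - (l * g \<eta> - ?L' g \<eta>)"
      unfolding L'w by (simp add: w_def algebra_simps diff_divide_distrib)
    then show "w \<eta> * (l * w \<eta> - ?L' w \<eta>)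
        = (w \<eta> * (l * h \<eta> - ?L' h \<eta>)) / c - w \<eta> * (l * g \<eta> - ?L' g \<eta>)"
      by (simp only: right_diff_distrib times_divide_eq_right)
  qed
  also have "expectation \<dots> = expectation (\<lambda>\<eta>. w \<eta> * (l * h \<eta> - ?L' h \<eta>)) / c - expectation (\<lambda>\<eta>. w \<eta> * (l * g \<eta> - ?L' g \<eta>))"
    using cont(1,3)[THEN continuous_integrable] by simp
  finally have "c * (l * (l2 w)\<^sup>2 + dirichlet q' w)
      = expectation (\<lambda>\<eta>. w \<eta> * (l * h \<eta> - ?L' h \<eta>)) - c * expectation (\<lambda>\<eta>. w \<eta> * (l * g \<eta> - ?L' g \<eta>))"
    using c by (simp add: field_simps)
  \<comment> \<open>Here \<open>c (l - L') g\<close> is written as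
    \<open>(l - L) g - (1 - c) l g + (L - c L') g\<close>; the last term is the only place where the
    two operators meet, and the sector bound applies to it.\<close>
  also have "\<dots> = expectation (\<lambda>\<eta>. w \<eta> * ((l * h \<eta> - ?L' h \<eta>) - (l * g \<eta> - ?L g \<eta>)))
      + (1 - c) * (l * ?E w g) - (?E w (?L g) - c * ?E w (?L' g))"
    unfolding D expectation_resolvent[OF q w g] expectation_resolvent[OF q' w g] by (simp add: algebra_simps)
  also have "\<dots> \<le> d + \<bar>1 - c\<bar> * (x * y) + K * (x * y)"
  proof -
    have "l * \<bar>?E w g\<bar> \<le> l * (l2 w * l2 g)"
      using expectation_mult_le_l2[OF w g] l by (intro mult_left_mono) auto
    also have "\<dots> = (sqrt l * l2 w) * (sqrt l * l2 g)" using l by simp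
    also have "\<dots> \<le> x * y"
    proof (rule mult_mono)
      show "sqrt l * l2 w \<le> x" "sqrt l * l2 g \<le> y"
        unfolding x_def y_def by (rule real_le_rsqrt, use l in \<open>simp add: power_mult_distrib resolvent_energy_def\<close>)+
    qed (use l in \<open>simp_all add: x_def resolvent_energy_nonneg\<close>)
    finally have "\<bar>1 - c\<bar> * (l * \<bar>?E w g\<bar>) \<le> \<bar>1 - c\<bar> * (x * y)"
      by (rule mult_left_mono) simp
    moreover have "(1 - c) * (l * ?E w g) \<le> \<bar>1 - c\<bar> * (l * \<bar>?E w g\<bar>)"
      using l abs_ge_self[of "(1 - c) * (l * ?E w g)"] by (simp add: abs_mult)
    moreover have "sqrt (energy w) * sqrt (energy g) \<le> x * y"
      using l by (intro mult_mono) (simp_all add: x_def y_def resolvent_energy_def)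
    then have "K * (sqrt (energy w) * sqrt (energy g)) \<le> K * (x * y)"
      using K by (rule mult_left_mono)
    ultimately show ?thesis using sector[OF w g] unfolding d_def by linarith
  qed
  finally have main: "c * (l * (l2 w)\<^sup>2 + dirichlet q' w) \<le> d + (\<bar>1 - c\<bar> + K) * (x * y)"
    by (simp add: algebra_simps)
  \<comment> \<open>Coercivity of the second process replaces its Dirichlet form by the energy;
    \<open>C1 >= 1\<close> takes care of the mass term.\<close>
  have "x\<^sup>2 \<le> C1 * (l * (l2 w)\<^sup>2 + dirichlet q' w)"
  proof -
    have "1 * (l * (l2 w)\<^sup>2) \<le> C1 * (l * (l2 w)\<^sup>2)" using C1(1) l by (intro mult_right_mono) auto
    then show ?thesis unfolding x2 resolvent_energy_def using C1(2)[OF w] by (simp add: distrib_left)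
  qed
  also have "\<dots> = C1 / c * (c * (l * (l2 w)\<^sup>2 + dirichlet q' w))" using c by simp
  also have "\<dots> \<le> C1 / c * (d + (\<bar>1 - c\<bar> + K) * (x * y))"
    using main C1(1) c by (intro mult_left_mono) auto
  finally have "x\<^sup>2 \<le> C1 / c * d + (C1 / c * (\<bar>1 - c\<bar> + K)) * (x * y)"
    by (simp add: algebra_simps)
  from quadratic_absorb[OF this] show ?thesis unfolding x2 y2 .
qed

text \<open>Test functions bounded uniformly in \<open>n\<close> see at most \<open>B\<close> times
  the uniform residual.\<close>

lemma resolvent_seq_pairing:
  assumes q: "jump_probability q" and l: "0 < l" and f: "local_function f" and g: "resolvent_seq q l f g"
    and h: "\<And>n. local_function (h n)" "\<And>n \<eta>. \<bar>h n \<eta>\<bar> \<le> B"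
  shows "(\<lambda>n. expectation (\<lambda>\<eta>. h n \<eta> * f \<eta>)
    - expectation (\<lambda>\<eta>. h n \<eta> * (l * g n \<eta> - exclusion_operator q (g n) \<eta>))) \<longlonglongrightarrow> 0"
proof (rule Lim_null_comparison)
  show "\<forall>\<^sub>F n in sequentially. norm (expectation (\<lambda>\<eta>. h n \<eta> * f \<eta>)
    - expectation (\<lambda>\<eta>. h n \<eta> * (l * g n \<eta> - exclusion_operator q (g n) \<eta>))) \<le> B * inverse (real (Suc n))"
  proof (intro always_eventually allI)
    fix n
    let ?R = "\<lambda>\<eta>. l * g n \<eta> - exclusion_operator q (g n) \<eta>"
    have R: "continuous_on UNIV ?R" by (rule resolvent_continuous[OF q resolvent_seqD(1)[OF g]])
    have hR: "continuous_on UNIV (\<lambda>\<eta>. h n \<eta> * ?R \<eta>)"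
      by (rule continuous_on_mult[OF local_function_continuous[OF h(1)] R])
    have "expectation (\<lambda>\<eta>. h n \<eta> * f \<eta>) - expectation (\<lambda>\<eta>. h n \<eta> * ?R \<eta>)
        = expectation (\<lambda>\<eta>. h n \<eta> * f \<eta> - h n \<eta> * ?R \<eta>)"
      by (rule Bochner_Integration.integral_diff [symmetric, OF local_integrable continuous_integrable[OF hR]])
         (rule local_function_mult[OF h(1) f])
    also have "\<dots> = expectation (\<lambda>\<eta>. h n \<eta> * (f \<eta> - ?R \<eta>))"
      by (simp add: algebra_simps)
    finally have "norm (expectation (\<lambda>\<eta>. h n \<eta> * f \<eta>) - expectation (\<lambda>\<eta>. h n \<eta> * ?R \<eta>))
        = \<bar>expectation (\<lambda>\<eta>. h n \<eta> * (f \<eta> - ?R \<eta>))\<bar>" by simp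
    also have "\<dots> \<le> B * inverse (real (Suc n))"
    proof (rule abs_expectation_mult_le)
      show "continuous_on UNIV (\<lambda>\<eta>. f \<eta> - ?R \<eta>)"
        using local_function_continuous[OF f] R by (rule continuous_on_diff)
      show "continuous_on UNIV (h n)" by (rule local_function_continuous[OF h(1)])
      show "\<bar>h n \<eta>\<bar> \<le> B" for \<eta> by (rule h(2))
      show "\<bar>f \<eta> - ?R \<eta>\<bar> \<le> inverse (real (Suc n))" for \<eta> by (rule resolvent_seqD(2)[OF g])
    qed
    finally show "norm (expectation (\<lambda>\<eta>. h n \<eta> * f \<eta>) - expectation (\<lambda>\<eta>. h n \<eta> * ?R \<eta>)) \<le> B * inverse (real (Suc n))" .
  qed
  show "(\<lambda>n. B * inverse (real (Suc n))) \<longlonglongrightarrow> 0"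
    using tendsto_mult_right_zero[OF LIMSEQ_inverse_real_of_nat] .
qed

text \<open>The limits \<open>a\<close> and \<open>b\<close> are also the limits of
  \<open>E (g (l - L) g)\<close> and \<open>E (h (l - L') h)\<close>, which are comparable to the
  resolvent energies of \<open>g\<close> and \<open>h\<close>. Since \<open>h = c (w + g)\<close>,
  it remains to bound \<open>w\<close> by \<open>g\<close>.\<close>

lemma resolvent_compare:
  assumes q: "jump_probability q" "second_moment q" "coercive q"
    and q': "jump_probability q'" "second_moment q'" "coercive q'" and c: "0 < c"
    and mean: "\<And>i. ((\<lambda>y. q y * real_of_int (y $ i)) has_sum c * m i) UNIV"
    and mean': "\<And>i. ((\<lambda>y. q' y * real_of_int (y $ i)) has_sum m i) UNIV"
  obtains K where "0 < K" "\<And>l f g h a b. 0 < l \<Longrightarrow> local_function f \<Longrightarrow>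
    resolvent_seq q l f g \<Longrightarrow> resolvent_seq q' l f h \<Longrightarrow>
    (\<lambda>n. expectation (\<lambda>\<eta>. g n \<eta> * f \<eta>)) \<longlonglongrightarrow> a \<Longrightarrow>
    (\<lambda>n. expectation (\<lambda>\<eta>. h n \<eta> * f \<eta>)) \<longlonglongrightarrow> b \<Longrightarrow> b \<le> K * a"
proof -
  obtain K0 where K0: "0 \<le> K0" "\<And>h g. local_function h \<Longrightarrow> local_function g \<Longrightarrow>
    \<bar>expectation (\<lambda>\<eta>. h \<eta> * exclusion_operator q g \<eta>) - c * expectation (\<lambda>\<eta>. h \<eta> * exclusion_operator q' g \<eta>)\<bar>
      \<le> K0 * (sqrt (energy h) * sqrt (energy g))"
    by (rule sector_bound[OF q(1,2) q'(1,2) mean mean']) blast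
  obtain C1 where C1: "1 \<le> C1" "\<And>g. local_function g \<Longrightarrow> energy g \<le> C1 * dirichlet q' g"
    using q'(3) unfolding coercive_def by blast
  obtain C0 where C0: "1 \<le> C0" "\<And>g. local_function g \<Longrightarrow> energy g \<le> C0 * dirichlet q g"
    using q(3) unfolding coercive_def by blast
  obtain C2 where C2: "1 \<le> C2" "\<And>g. local_function g \<Longrightarrow> dirichlet q' g \<le> C2 * energy g"
    by (rule dirichlet_le_energy[OF q'(1,2)]) blast
  define D where "D = (C1 / c * (\<bar>1 - c\<bar> + K0))\<^sup>2"
  \<comment> \<open>Read from right to left: \<open>C0\<close> passes from the quadratic form of
    \<open>q\<close> to the resolvent energy of \<open>g\<close>, \<open>D + 1\<close> from
    \<open>g\<close> to \<open>w\<close> and \<open>g\<close> together, \<open>2 c^2\<close> to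
    \<open>h = c (w + g)\<close>, and \<open>C2\<close> to the quadratic form of
    \<open>q'\<close>.\<close>
  define K where "K = C2 * (2 * c\<^sup>2) * ((D + 1) * C0)"
  have D0: "0 \<le> D" by (simp add: D_def)
  have K_pos: "0 < K" unfolding K_def using C2(1) c C0(1) D0 by (intro mult_pos_pos) auto
  have "b \<le> K * a" if l: "0 < l" and f: "local_function f" and g: "resolvent_seq q l f g"
    and h: "resolvent_seq q' l f h" and a: "(\<lambda>n. expectation (\<lambda>\<eta>. g n \<eta> * f \<eta>)) \<longlonglongrightarrow> a"
    and b: "(\<lambda>n. expectation (\<lambda>\<eta>. h n \<eta> * f \<eta>)) \<longlonglongrightarrow> b" for l f g h a b
  proof -
    obtain C where C: "0 < C" "\<And>\<eta>. \<bar>f \<eta>\<bar> \<le> C" using local_function_bounded[OF f] by blast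
    define B where "B = (C + 1) / l"
    have gB: "\<bar>g n \<eta>\<bar> \<le> B" and hB: "\<bar>h n \<eta>\<bar> \<le> B" for n \<eta>
      unfolding B_def using resolvent_seq_bounded[OF q(1) l g C(2)] resolvent_seq_bounded[OF q'(1) l h C(2)] by auto
    note gl = resolvent_seqD(1)[OF g] and hl = resolvent_seqD(1)[OF h]
    define w where "w = (\<lambda>n \<eta>. h n \<eta> / c - g n \<eta>)"
    have wl: "local_function (w n)" for n unfolding w_def using gl hl by simp
    have wB: "\<bar>w n \<eta>\<bar> \<le> B / c + B" for n \<eta>
    proof -
      have "\<bar>h n \<eta> / c\<bar> \<le> B / c" unfolding abs_divide using hB[of n \<eta>] c by (simp add: divide_right_mono)
      then show ?thesis using gB[of n \<eta>] unfolding w_def by linarith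
    qed
    let ?F = "\<lambda>n \<eta>. l * g n \<eta> - exclusion_operator q (g n) \<eta>"
    let ?F' = "\<lambda>n \<eta>. l * h n \<eta> - exclusion_operator q' (h n) \<eta>"
    define d where "d = (\<lambda>n. \<bar>expectation (\<lambda>\<eta>. w n \<eta> * (?F' n \<eta> - ?F n \<eta>))\<bar>)"
    \<comment> \<open>Both equations have the same right-hand side \<open>f\<close> up to vanishing
      residuals, and the \<open>w n\<close> are uniformly bounded. Hence the defect \<open>d\<close>
      tends to 0.\<close>
    have "(\<lambda>n. \<bar>(expectation (\<lambda>\<eta>. w n \<eta> * f \<eta>) - expectation (\<lambda>\<eta>. w n \<eta> * ?F n \<eta>))
        - (expectation (\<lambda>\<eta>. w n \<eta> * f \<eta>) - expectation (\<lambda>\<eta>. w n \<eta> * ?F' n \<eta>))\<bar>) \<longlonglongrightarrow> \<bar>0 - 0\<bar>"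
      by (intro tendsto_intros resolvent_seq_pairing[OF q(1) l f g wl wB] resolvent_seq_pairing[OF q'(1) l f h wl wB])
    moreover have "d = (\<lambda>n. \<bar>(expectation (\<lambda>\<eta>. w n \<eta> * f \<eta>) - expectation (\<lambda>\<eta>. w n \<eta> * ?F n \<eta>))
        - (expectation (\<lambda>\<eta>. w n \<eta> * f \<eta>) - expectation (\<lambda>\<eta>. w n \<eta> * ?F' n \<eta>))\<bar>)"
    proof
      fix n
      have "continuous_on UNIV (\<lambda>\<eta>. w n \<eta> * ?F n \<eta>)" "continuous_on UNIV (\<lambda>\<eta>. w n \<eta> * ?F' n \<eta>)"
        by (rule continuous_on_mult[OF local_function_continuous[OF wl]],
            rule resolvent_continuous[OF q(1) gl] resolvent_continuous[OF q'(1) hl])+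
      from this[THEN continuous_integrable]
      show "d n = \<bar>(expectation (\<lambda>\<eta>. w n \<eta> * f \<eta>) - expectation (\<lambda>\<eta>. w n \<eta> * ?F n \<eta>))
          - (expectation (\<lambda>\<eta>. w n \<eta> * f \<eta>) - expectation (\<lambda>\<eta>. w n \<eta> * ?F' n \<eta>))\<bar>"
        unfolding d_def by (simp add: right_diff_distrib)
    qed
    ultimately have d0: "d \<longlonglongrightarrow> 0" by simp
    have "(\<lambda>n. expectation (\<lambda>\<eta>. g n \<eta> * f \<eta>) - (expectation (\<lambda>\<eta>. g n \<eta> * f \<eta>) - expectation (\<lambda>\<eta>. g n \<eta> * ?F n \<eta>))) \<longlonglongrightarrow> a - 0"
      by (intro tendsto_diff a resolvent_seq_pairing[OF q(1) l f g gl gB])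
    then have an: "(\<lambda>n. expectation (\<lambda>\<eta>. g n \<eta> * ?F n \<eta>)) \<longlonglongrightarrow> a"
      by simp
    have "(\<lambda>n. expectation (\<lambda>\<eta>. h n \<eta> * f \<eta>) - (expectation (\<lambda>\<eta>. h n \<eta> * f \<eta>) - expectation (\<lambda>\<eta>. h n \<eta> * ?F' n \<eta>))) \<longlonglongrightarrow> b - 0"
      by (intro tendsto_diff b resolvent_seq_pairing[OF q'(1) l f h hl hB])
    then have bn: "(\<lambda>n. expectation (\<lambda>\<eta>. h n \<eta> * ?F' n \<eta>)) \<longlonglongrightarrow> b"
      by simp
    have le: "expectation (\<lambda>\<eta>. h n \<eta> * ?F' n \<eta>)
        \<le> C2 * (2 * c\<^sup>2) * (2 * (C1 / c * d n) + (D + 1) * (C0 * expectation (\<lambda>\<eta>. g n \<eta> * ?F n \<eta>)))" for n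
    proof -
      let ?X = "resolvent_energy l"
      have combine: "p + xg \<le> u \<Longrightarrow> xw \<le> v + p \<Longrightarrow> xs \<le> 2 * xw + 2 * xg \<Longrightarrow> xs \<le> 2 * (v + u)"
        for p xg u xw v xs :: real by argo
      let ?G = "expectation (\<lambda>\<eta>. g n \<eta> * ?F n \<eta>)"
      define R where "R = 2 * (C1 / c * d n) + (D + 1) * (C0 * ?G)"
      have h_eq: "h n = (\<lambda>\<eta>. c * (w n \<eta> + g n \<eta>))" using c by (simp add: w_def)
      have "?X (g n) \<le> C0 * ?G"
      proof -
        have "1 * (l * (l2 (g n))\<^sup>2) \<le> C0 * (l * (l2 (g n))\<^sup>2)"
          using C0(1) l by (intro mult_right_mono) auto
        then show ?thesis
          unfolding expectation_resolvent_self[OF q(1) gl] using C0(2)[OF gl, of n]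
          by (simp add: resolvent_energy_def distrib_left)
      qed
      then have "(D + 1) * ?X (g n) \<le> (D + 1) * (C0 * ?G)" using D0 by (intro mult_left_mono) auto
      then have "D * ?X (g n) + ?X (g n) \<le> (D + 1) * (C0 * ?G)" by (simp add: distrib_right)
      moreover have "?X (w n) \<le> 2 * (C1 / c * d n) + D * ?X (g n)"
        unfolding w_def d_def D_def
        by (rule resolvent_energy_compare[OF q(1) q'(1) c K0(1) K0(2) C1(1) C1(2) l gl hl])
      moreover have "?X (\<lambda>\<eta>. w n \<eta> + g n \<eta>) \<le> 2 * ?X (w n) + 2 * ?X (g n)"
        using l by (intro resolvent_energy_add wl gl) simp
      ultimately have "?X (\<lambda>\<eta>. w n \<eta> + g n \<eta>) \<le> 2 * R"
        unfolding R_def by (rule combine)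
      moreover have "?X (h n) = c\<^sup>2 * ?X (\<lambda>\<eta>. w n \<eta> + g n \<eta>)"
        by (subst h_eq) (rule resolvent_energy_cmult)
      ultimately have "?X (h n) \<le> c\<^sup>2 * (2 * R)" by (simp add: mult_left_mono)
      then have "C2 * ?X (h n) \<le> C2 * (c\<^sup>2 * (2 * R))" using C2(1) by (intro mult_left_mono) auto
      moreover have "expectation (\<lambda>\<eta>. h n \<eta> * ?F' n \<eta>) \<le> C2 * ?X (h n)"
      proof -
        have "1 * (l * (l2 (h n))\<^sup>2) \<le> C2 * (l * (l2 (h n))\<^sup>2)"
          using C2(1) l by (intro mult_right_mono) auto
        then show ?thesis
          unfolding expectation_resolvent_self[OF q'(1) hl] using C2(2)[OF hl, of n]
          by (simp add: resolvent_energy_def distrib_left)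
      qed
      ultimately have "expectation (\<lambda>\<eta>. h n \<eta> * ?F' n \<eta>) \<le> C2 * (c\<^sup>2 * (2 * R))"
        by linarith
      also have "\<dots> = C2 * (2 * c\<^sup>2) * R" by simp
      finally show ?thesis unfolding R_def .
    qed
    have "(\<lambda>n. C2 * (2 * c\<^sup>2) * (2 * (C1 / c * d n) + (D + 1) * (C0 * expectation (\<lambda>\<eta>. g n \<eta> * ?F n \<eta>))))
        \<longlonglongrightarrow> C2 * (2 * c\<^sup>2) * (2 * (C1 / c * 0) + (D + 1) * (C0 * a))"
      by (intro tendsto_intros d0 an)
    from LIMSEQ_le[OF bn this] le show "b \<le> K * a"
      by (auto simp: K_def mult.assoc)
  qed
  with K_pos show ?thesis by (rule that)
qed

lemma resolvent_reversed:
  assumes q: "jump_probability q" and l: "0 < l" and f: "local_function f"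
    and g: "resolvent_seq q l f g" and h: "resolvent_seq (reversed q) l f h"
    and a: "(\<lambda>n. expectation (\<lambda>\<eta>. g n \<eta> * f \<eta>)) \<longlonglongrightarrow> a"
  shows "(\<lambda>n. expectation (\<lambda>\<eta>. h n \<eta> * f \<eta>)) \<longlonglongrightarrow> a"
proof -
  note rq = jump_probability_reversed[OF q]
  obtain C where C: "0 < C" "\<And>\<eta>. \<bar>f \<eta>\<bar> \<le> C" using local_function_bounded[OF f] by blast
  note gl = resolvent_seqD(1)[OF g] and hl = resolvent_seqD(1)[OF h]
  let ?F = "\<lambda>n \<eta>. l * g n \<eta> - exclusion_operator q (g n) \<eta>"
  let ?F' = "\<lambda>n \<eta>. l * h n \<eta> - exclusion_operator (reversed q) (h n) \<eta>"
  have eq: "expectation (\<lambda>\<eta>. h n \<eta> * ?F n \<eta>) = expectation (\<lambda>\<eta>. g n \<eta> * ?F' n \<eta>)" for n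
    unfolding expectation_resolvent[OF q hl gl] expectation_resolvent[OF rq gl hl]
      exclusion_operator_adjoint[OF q hl gl] by (simp add: mult.commute)
  have "(\<lambda>n. (expectation (\<lambda>\<eta>. h n \<eta> * f \<eta>) - expectation (\<lambda>\<eta>. h n \<eta> * ?F n \<eta>))
      - (expectation (\<lambda>\<eta>. g n \<eta> * f \<eta>) - expectation (\<lambda>\<eta>. g n \<eta> * ?F' n \<eta>))
      + expectation (\<lambda>\<eta>. g n \<eta> * f \<eta>)) \<longlonglongrightarrow> 0 - 0 + a"
    by (intro tendsto_add tendsto_diff a
        resolvent_seq_pairing[OF q l f g hl resolvent_seq_bounded[OF rq l h C(2)]]
        resolvent_seq_pairing[OF rq l f h gl resolvent_seq_bounded[OF q l g C(2)]])
  then show ?thesis by (simp add: eq)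
qed

end

section \<open>Laplace transforms along the semigroup\<close>

text \<open>Positivity applied to \<open>norm f + f\<close> and \<open>norm f - f\<close>, together
  with the preservation of constants.\<close>

lemma markov_semigroup_contraction:
  fixes f :: "'d::finite config \<Rightarrow>\<^sub>C real"
  assumes S: "markov_semigroup S" and t: "0 \<le> t"
  shows "norm (S t f) \<le> norm f"
proof -
  have lin: "linear (S t)" using S t by (simp add: markov_semigroup_def)
  have one: "S t (norm f *\<^sub>R const_bcontfun 1) = norm f *\<^sub>R const_bcontfun 1"
    using S t by (simp add: markov_semigroup_def linear_scale[OF lin])
  have pos: "0 \<le> apply_bcontfun (S t g) \<eta>" if "\<And>\<eta>. 0 \<le> apply_bcontfun g \<eta>" for g \<eta>
    using S t that by (simp add: markov_semigroup_def)
  have le: "\<bar>apply_bcontfun f \<eta>\<bar> \<le> norm f" for \<eta>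
    using norm_bounded[of f \<eta>] by simp
  have "\<bar>apply_bcontfun (S t f) \<eta>\<bar> \<le> norm f" for \<eta>
  proof -
    have "0 \<le> apply_bcontfun (S t (norm f *\<^sub>R const_bcontfun 1 - f)) \<eta>"
    proof (rule pos)
      show "0 \<le> apply_bcontfun (norm f *\<^sub>R const_bcontfun 1 - f) \<xi>" for \<xi>
        using le[of \<xi>] by (simp add: const_bcontfun.rep_eq)
    qed
    moreover have "0 \<le> apply_bcontfun (S t (norm f *\<^sub>R const_bcontfun 1 + f)) \<eta>"
    proof (rule pos)
      show "0 \<le> apply_bcontfun (norm f *\<^sub>R const_bcontfun 1 + f) \<xi>" for \<xi>
        using le[of \<xi>] by (simp add: const_bcontfun.rep_eq)
    qed
    ultimately show ?thesis
      by (simp add: linear_diff[OF lin] linear_add[OF lin] one const_bcontfun.rep_eq abs_le_iff)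
  qed
  then show ?thesis by (intro norm_bound) simp
qed

lemma markov_semigroup_increment:
  fixes f :: "'d::finite config \<Rightarrow>\<^sub>C real"
  assumes S: "markov_semigroup S" and st: "0 \<le> s" "s \<le> t"
  shows "S t f = S s (S (t - s) f)"
proof -
  have "S (s + (t - s)) f = S s (S (t - s) f)"
    using S st unfolding markov_semigroup_def by (metis diff_ge_0_iff_ge)
  then show ?thesis by simp
qed

text \<open>Strong continuity is assumed at time 0 only. The semigroup property and the contraction
  bound carry it to all times, with the same modulus.\<close>

lemma markov_semigroup_modulus:
  fixes f :: "'d::finite config \<Rightarrow>\<^sub>C real"
  assumes S: "markov_semigroup S" and e: "0 < e"
  obtains d where "0 < d" "\<And>s t. 0 \<le> s \<Longrightarrow> 0 \<le> t \<Longrightarrow> \<bar>t - s\<bar> < d \<Longrightarrow> norm (S t f - S s f) < e"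
proof -
  have "((\<lambda>t. S t f) \<longlongrightarrow> f) (at_right 0)" using S by (simp add: markov_semigroup_def)
  then have "\<forall>\<^sub>F t in at_right 0. dist (S t f) f < e" using e by (rule tendstoD)
  then obtain d where d: "0 < d" "\<And>t. 0 < t \<Longrightarrow> t < d \<Longrightarrow> norm (S t f - f) < e"
    unfolding eventually_at_right_field dist_norm by auto
  have le: "norm (S t f - S s f) < e" if "0 \<le> s" "s < t" "t - s < d" for s t
  proof -
    have lin: "linear (S s)" using S that by (simp add: markov_semigroup_def)
    have "S t f - S s f = S s (S (t - s) f - f)"
      using markov_semigroup_increment[OF S, of s t f] that by (simp add: linear_diff[OF lin])
    also have "norm \<dots> \<le> norm (S (t - s) f - f)" by (rule markov_semigroup_contraction[OF S that(1)])
    also have "\<dots> < e" by (rule d(2)) (use that in auto)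
    finally show ?thesis .
  qed
  show ?thesis
  proof (rule that[OF d(1)])
    fix s t :: real assume st: "0 \<le> s" "0 \<le> t" "\<bar>t - s\<bar> < d"
    consider "s < t" | "t < s" | "s = t" by linarith
    then show "norm (S t f - S s f) < e"
    proof cases
      case 1
      then show ?thesis using st by (intro le) auto
    next
      case 2
      have "norm (S s f - S t f) < e" using 2 st by (intro le) auto
      then show ?thesis by (simp add: norm_minus_commute)
    next
      case 3
      then show ?thesis using e by simp
    qed
  qed
qed

lemma markov_semigroup_continuous:
  fixes f :: "'d::finite config \<Rightarrow>\<^sub>C real"
  assumes S: "markov_semigroup S" shows "continuous_on {0..} (\<lambda>t. S t f)"
  unfolding continuous_on_iff
proof (intro ballI allI impI)
  fix s e :: real assume s: "s \<in> {0..}" and e: "0 < e"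
  obtain d where d: "0 < d" "\<And>s t. 0 \<le> s \<Longrightarrow> 0 \<le> t \<Longrightarrow> \<bar>t - s\<bar> < d \<Longrightarrow> norm (S t f - S s f) < e"
    using markov_semigroup_modulus[OF S e] by blast
  then show "\<exists>d>0. \<forall>t\<in>{0..}. dist t s < d \<longrightarrow> dist (S t f) (S s f) < e"
    using s by (intro exI[of _ d]) (auto simp: dist_norm)
qed

text \<open>The generator only gives a right derivative at 0. Contraction transports it to every
  time with an error uniform in time, and this uniformity yields the derivative from the left as
  well.\<close>

lemma markov_semigroup_derivative:
  fixes g h :: "'d::finite config \<Rightarrow>\<^sub>C real"
  assumes S: "markov_semigroup S" and gen: "(g, h) \<in> generator S" and t: "0 \<le> t"
  shows "((\<lambda>t. S t g) has_vector_derivative S t h) (at t within {0..})"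
  unfolding has_vector_derivative_def has_derivative_within_alt
proof (intro conjI allI impI)
  show "bounded_linear (\<lambda>x. x *\<^sub>R S t h)" by (rule bounded_linear_scaleR_left)
  fix e :: real assume e: "0 < e"
  have "((\<lambda>t. (S t g - g) /\<^sub>R t) \<longlongrightarrow> h) (at_right 0)"
    using gen by (simp add: generator_def)
  then have "\<forall>\<^sub>F t in at_right 0. dist ((S t g - g) /\<^sub>R t) h < e / 2"
    using e by (intro tendstoD) auto
  then obtain d1 where d1: "0 < d1" "\<And>t. 0 < t \<Longrightarrow> t < d1 \<Longrightarrow> norm ((S t g - g) /\<^sub>R t - h) < e / 2"
    unfolding eventually_at_right_field dist_norm by auto
  have small: "norm (S x g - g - x *\<^sub>R h) \<le> e / 2 * x" if "0 < x" "x < d1" for x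
  proof -
    have "S x g - g - x *\<^sub>R h = x *\<^sub>R ((S x g - g) /\<^sub>R x - h)"
      using that by (simp add: scaleR_diff_right)
    also have "norm \<dots> = x * norm ((S x g - g) /\<^sub>R x - h)" using that by simp
    also have "\<dots> \<le> x * (e / 2)" using d1(2)[OF that] that by (intro mult_left_mono) auto
    finally show ?thesis by (simp add: mult.commute)
  qed
  have forward: "norm (S y g - S x g - (y - x) *\<^sub>R S x h) \<le> e / 2 * (y - x)" if "0 \<le> x" "x < y" "y - x < d1" for x y
  proof -
    have lin: "linear (S x)" using S that by (simp add: markov_semigroup_def)
    have "S y g - S x g - (y - x) *\<^sub>R S x h = S x (S (y - x) g - g - (y - x) *\<^sub>R h)"
      using markov_semigroup_increment[OF S, of x y g] that
      by (simp add: linear_diff[OF lin] linear_scale[OF lin])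
    also have "norm \<dots> \<le> norm (S (y - x) g - g - (y - x) *\<^sub>R h)"
      by (rule markov_semigroup_contraction[OF S that(1)])
    also have "\<dots> \<le> e / 2 * (y - x)" by (rule small) (use that in auto)
    finally show ?thesis .
  qed
  obtain d2 where d2: "0 < d2" "\<And>s t. 0 \<le> s \<Longrightarrow> 0 \<le> t \<Longrightarrow> \<bar>t - s\<bar> < d2 \<Longrightarrow> norm (S t h - S s h) < e / 2"
    using markov_semigroup_modulus[OF S half_gt_zero[OF e]] by blast
  show "\<exists>d>0. \<forall>y\<in>{0..}. norm (y - t) < d \<longrightarrow> norm (S y g - S t g - (y - t) *\<^sub>R S t h) \<le> e * norm (y - t)"
  proof (intro exI[of _ "min d1 d2"] conjI ballI impI)
    show "0 < min d1 d2" using d1 d2 by simp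
    fix y :: real assume y: "y \<in> {0..}" "norm (y - t) < min d1 d2"
    consider "t < y" | "y < t" | "y = t" by linarith
    then show "norm (S y g - S t g - (y - t) *\<^sub>R S t h) \<le> e * norm (y - t)"
    proof cases
      case 1
      have "norm (S y g - S t g - (y - t) *\<^sub>R S t h) \<le> e / 2 * (y - t)" using 1 y t by (intro forward) auto
      also have "\<dots> \<le> e * norm (y - t)" using 1 e by simp
      finally show ?thesis .
    next
      case 2
      \<comment> \<open>From the left the forward estimate is applied at \<open>y\<close>, where the
        slope is \<open>S y h\<close>; replacing it by \<open>S t h\<close> costs the modulus of
        continuity.\<close>
      have "S y g - S t g - (y - t) *\<^sub>R S t h
          = (t - y) *\<^sub>R (S t h - S y h) - (S t g - S y g - (t - y) *\<^sub>R S y h)"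
        by (simp add: algebra_simps)
      also have "norm \<dots> \<le> norm ((t - y) *\<^sub>R (S t h - S y h)) + norm (S t g - S y g - (t - y) *\<^sub>R S y h)"
        by (rule norm_triangle_ineq4)
      also have "norm (S t g - S y g - (t - y) *\<^sub>R S y h) \<le> e / 2 * (t - y)"
        using 2 y t by (intro forward) auto
      also have "norm ((t - y) *\<^sub>R (S t h - S y h)) \<le> (t - y) * (e / 2)"
      proof -
        have "norm (S t h - S y h) \<le> e / 2" using d2(2)[of y t] 2 y t by auto
        then show ?thesis using 2 by (simp add: mult_left_mono)
      qed
      finally show ?thesis using 2 by (simp add: algebra_simps)
    qed simp
  qed
qed

section \<open>Laplace transforms of bounded functions\<close>

lemma exp_decay_tendsto: "0 < l \<Longrightarrow> ((\<lambda>t :: real. exp (- l * t)) \<longlongrightarrow> 0) at_top"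
  by (intro filterlim_compose[OF exp_at_bot] filterlim_tendsto_neg_mult_at_bot[OF tendsto_const] filterlim_ident) auto

lemma exp_decay_integral:
  assumes l: "0 < (l :: real)"
  shows "integrable lborel (\<lambda>t. indicator {a..} t * exp (- l * t))"
    and "(LINT t|lborel. indicator {a..} t * exp (- l * t)) = exp (- l * a) / l"
proof -
  have nn: "(\<integral>\<^sup>+ t. ennreal (exp (- l * t)) * indicator {a..} t \<partial>lborel) = ennreal (0 - (- exp (- l * a) / l))"
  proof (rule nn_integral_FTC_atLeast)
    show "((\<lambda>t. - exp (- l * t) / l) has_real_derivative exp (- l * t)) (at t)" if "a \<le> t" for t
      using l by (auto intro!: derivative_eq_intros)
    have "((\<lambda>t. exp (- l * t)) \<longlongrightarrow> 0) at_top"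
      using l by (rule exp_decay_tendsto)
    then have "((\<lambda>t. - exp (- l * t) / l) \<longlongrightarrow> - 0 / l) at_top"
      using l by (intro tendsto_intros) auto
    then show "((\<lambda>t. - exp (- l * t) / l) \<longlongrightarrow> 0) at_top" by simp
  qed (use l in auto)
  have eq: "ennreal (indicator {a..} t * exp (- l * t)) = ennreal (exp (- l * t)) * indicator {a..} t" for t
    by (simp add: indicator_def)
  have nn': "(\<integral>\<^sup>+ t. ennreal (indicator {a..} t * exp (- l * t)) \<partial>lborel) = ennreal (exp (- l * a) / l)"
    unfolding eq using nn by simp
  have bochner: "has_bochner_integral lborel (\<lambda>t. indicator {a..} t * exp (- l * t)) (exp (- l * a) / l)"
    by (rule has_bochner_integral_nn_integral) (use l nn' in simp_all)
  show "integrable lborel (\<lambda>t. indicator {a..} t * exp (- l * t))"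
    using bochner by (rule integrable.intros)
  show "(LINT t|lborel. indicator {a..} t * exp (- l * t)) = exp (- l * a) / l"
    using bochner by (rule has_bochner_integral_integral_eq)
qed

definition laplace :: "real \<Rightarrow> (real \<Rightarrow> real) \<Rightarrow> real" where
  "laplace l k = (LINT t|lborel. indicator {0..} t * exp (- l * t) * k t)"

lemma laplace_integrable:
  fixes l :: real
  assumes l: "0 < l" and k: "(\<lambda>t. indicator {0..} t * k t) \<in> borel_measurable borel"
    and B: "\<And>t. 0 \<le> t \<Longrightarrow> \<bar>k t\<bar> \<le> B"
  shows "integrable lborel (\<lambda>t. indicator {0..} t * exp (- l * t) * k t)"
proof (rule Bochner_Integration.integrable_bound)
  show "integrable lborel (\<lambda>t. indicator {0..} t * exp (- l * t) * B)"
    using exp_decay_integral(1)[OF l, of 0] by (intro integrable_mult_left) auto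
  have "(\<lambda>t. (indicator {0..} t * k t) * exp (- l * t)) \<in> borel_measurable borel"
    by (rule borel_measurable_times[OF k]) measurable
  moreover have "(\<lambda>t. (indicator {0..} t * k t) * exp (- l * t)) = (\<lambda>t. indicator {0..} t * exp (- l * t) * k t)"
    by (simp add: algebra_simps)
  ultimately show "(\<lambda>t. indicator {0..} t * exp (- l * t) * k t) \<in> borel_measurable lborel" by simp
  show "AE t in lborel. norm (indicator {0..} t * exp (- l * t) * k t) \<le> norm (indicator {0..} t * exp (- l * t) * B)"
  proof (intro AE_I2)
    fix t :: real
    have "\<bar>k t\<bar> \<le> \<bar>B\<bar>" if "0 \<le> t" using B[OF that] by linarith
    then show "norm (indicator {0..} t * exp (- l * t) * k t) \<le> norm (indicator {0..} t * exp (- l * t) * B)"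
      by (auto simp: abs_mult indicator_def)
  qed
qed

lemma continuous_indicator_measurable:
  fixes k :: "real \<Rightarrow> real"
  assumes "continuous_on {0..} k" shows "(\<lambda>t. indicator {0..} t * k t) \<in> borel_measurable borel"
  using borel_measurable_continuous_on_indicator[OF _ assms] by simp

lemma laplace_abs_le:
  assumes l: "0 < l" and k: "(\<lambda>t. indicator {0..} t * k t) \<in> borel_measurable borel"
    and B: "\<And>t. 0 \<le> t \<Longrightarrow> \<bar>k t\<bar> \<le> B"
  shows "\<bar>laplace l k\<bar> \<le> B / l"
proof -
  have "\<bar>laplace l k\<bar> \<le> (LINT t|lborel. \<bar>indicator {0..} t * exp (- l * t) * k t\<bar>)"
    unfolding laplace_def by (rule integral_abs_bound)
  also have "\<dots> \<le> (LINT t|lborel. indicator {0..} t * exp (- l * t) * B)"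
  proof (rule integral_mono)
    show "integrable lborel (\<lambda>t. \<bar>indicator {0..} t * exp (- l * t) * k t\<bar>)"
      using laplace_integrable[OF l k B] by (rule integrable_abs)
    show "integrable lborel (\<lambda>t. indicator {0..} t * exp (- l * t) * B)"
      using exp_decay_integral(1)[OF l, of 0] by (intro integrable_mult_left) auto
    show "\<bar>indicator {0..} t * exp (- l * t) * k t\<bar> \<le> indicator {0..} t * exp (- l * t) * B" for t :: real
      using B[of t] by (auto simp: abs_mult indicator_def)
  qed
  also have "\<dots> = B / l" using exp_decay_integral(2)[OF l, of 0] by simp
  finally show ?thesis .
qed

lemma laplace_diff:
  assumes l: "0 < l" and k: "continuous_on {0..} k" "\<And>t. 0 \<le> t \<Longrightarrow> \<bar>k t\<bar> \<le> B"
    and j: "continuous_on {0..} j" "\<And>t. 0 \<le> t \<Longrightarrow> \<bar>j t\<bar> \<le> B'"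
  shows "laplace l (\<lambda>t. k t - j t) = laplace l k - laplace l j"
  unfolding laplace_def right_diff_distrib
  using laplace_integrable[OF l continuous_indicator_measurable[OF k(1)] k(2)]
    laplace_integrable[OF l continuous_indicator_measurable[OF j(1)] j(2)]
  by (rule Bochner_Integration.integral_diff)

text \<open>The integrand is the derivative of \<open>- exp (- l t) F (S t g)\<close>.\<close>

lemma laplace_resolvent:
  fixes g h :: "'d::finite config \<Rightarrow>\<^sub>C real" and F :: "('d config \<Rightarrow>\<^sub>C real) \<Rightarrow> real"
  assumes S: "markov_semigroup S" and gen: "(g, h) \<in> generator S" and l: "0 < l" and F: "bounded_linear F"
  shows "laplace l (\<lambda>t. F (S t (l *\<^sub>R g - h))) = F g"
proof -
  obtain K where K: "0 < K" "\<And>x. norm (F x) \<le> norm x * K"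
    using bounded_linear.pos_bounded[OF F] by blast
  have cont: "continuous_on {0..} (\<lambda>t. F (S t x))" for x
    using markov_semigroup_continuous[OF S] by (rule bounded_linear.continuous_on[OF F])
  have bound: "\<bar>F (S t x)\<bar> \<le> norm x * K" if "0 \<le> t" for t x
  proof -
    have "\<bar>F (S t x)\<bar> \<le> norm (S t x) * K" using K(2)[of "S t x"] by simp
    also have "\<dots> \<le> norm x * K"
      using markov_semigroup_contraction[OF S that, of x] K(1) by (intro mult_right_mono) auto
    finally show ?thesis .
  qed
  let ?k = "\<lambda>t. F (S t (l *\<^sub>R g - h))"
  let ?v = "\<lambda>t. - (exp (- l * t) * F (S t g))"
  have deriv: "(?v has_vector_derivative exp (- l * t) * ?k t) (at t within {0..})" if t: "0 \<le> t" for t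
  proof -
    have lin: "linear (S t)" using S t by (simp add: markov_semigroup_def)
    have "((\<lambda>t. F (S t g)) has_vector_derivative F (S t h)) (at t within {0..})"
      by (rule bounded_linear.has_vector_derivative[OF F markov_semigroup_derivative[OF S gen t]])
    then have "((\<lambda>t. F (S t g)) has_real_derivative F (S t h)) (at t within {0..})"
      by (simp add: has_real_derivative_iff_has_vector_derivative)
    then have "(?v has_real_derivative - (exp (- l * t) * (- l) * F (S t g) + F (S t h) * exp (- l * t))) (at t within {0..})"
      by (auto intro!: derivative_eq_intros)
    moreover have "?k t = l * F (S t g) - F (S t h)"
      by (simp add: linear_diff[OF lin] linear_scale[OF lin] bounded_linear.linear[OF F] linear_diff linear_scale)
    then have "exp (- l * t) * ?k t = - (exp (- l * t) * (- l) * F (S t g) + F (S t h) * exp (- l * t))"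
      by (simp only:) (simp add: algebra_simps)
    ultimately show ?thesis
      unfolding has_real_derivative_iff_has_vector_derivative [symmetric] by (simp only:)
  qed
  have fin: "(LINT t|lborel. indicator {0..real n} t *\<^sub>R (exp (- l * t) * ?k t)) = ?v (real n) - ?v 0" for n
  proof (rule integral_FTC_Icc)
    show "(?v has_vector_derivative exp (- l * t) * ?k t) (at t within {0..real n})" if "0 \<le> t" "t \<le> real n" for t
      using deriv[OF that(1)] by (rule has_vector_derivative_within_subset) auto
    show "continuous_on {0..real n} (\<lambda>t. exp (- l * t) * ?k t)"
      by (intro continuous_intros continuous_on_subset[OF cont]) auto
  qed simp
  have "(\<lambda>n. LINT t|lborel. indicator {0..real n} t *\<^sub>R (exp (- l * t) * ?k t))
      \<longlonglongrightarrow> (LINT t|lborel. indicator {0..} t * exp (- l * t) * ?k t)"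
  proof (rule integral_dominated_convergence)
    have meas: "(\<lambda>t. indicator {0..} t * ?k t) \<in> borel_measurable borel"
      using cont by (rule continuous_indicator_measurable)
    show "(\<lambda>t. indicator {0..} t * exp (- l * t) * ?k t) \<in> borel_measurable lborel"
      using laplace_integrable[OF l meas bound] by (rule borel_measurable_integrable)
    show "(\<lambda>t. indicator {0..real n} t *\<^sub>R (exp (- l * t) * ?k t)) \<in> borel_measurable lborel" for n
    proof -
      have "(\<lambda>t. indicator {0..real n} t * (exp (- l * t) * (indicator {0..} t * ?k t))) \<in> borel_measurable borel"
        by (intro borel_measurable_times[OF _ borel_measurable_times[OF _ meas]]) auto
      moreover have "(\<lambda>t. indicator {0..real n} t * (exp (- l * t) * (indicator {0..} t * ?k t)))
          = (\<lambda>t. indicator {0..real n} t *\<^sub>R (exp (- l * t) * ?k t))"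
        by (auto simp: indicator_def)
      ultimately show ?thesis by simp
    qed
    show "integrable lborel (\<lambda>t. indicator {0..} t * exp (- l * t) * (norm (l *\<^sub>R g - h) * K))"
      using exp_decay_integral(1)[OF l, of 0] by (intro integrable_mult_left) auto
    show "AE t in lborel. (\<lambda>n. indicator {0..real n} t *\<^sub>R (exp (- l * t) * ?k t)) \<longlonglongrightarrow> indicator {0..} t * exp (- l * t) * ?k t"
    proof (intro AE_I2 tendsto_eventually)
      fix t :: real
      obtain m where "t < real m" using reals_Archimedean2 by blast
      then have "indicator {0..real n} t *\<^sub>R (exp (- l * t) * ?k t) = indicator {0..} t * exp (- l * t) * ?k t" if "m \<le> n" for n
        using that by (auto simp: indicator_def)
      then show "\<forall>\<^sub>F n in sequentially. indicator {0..real n} t *\<^sub>R (exp (- l * t) * ?k t) = indicator {0..} t * exp (- l * t) * ?k t"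
        unfolding eventually_sequentially by blast
    qed
    show "AE t in lborel. norm (indicator {0..real n} t *\<^sub>R (exp (- l * t) * ?k t)) \<le> indicator {0..} t * exp (- l * t) * (norm (l *\<^sub>R g - h) * K)" for n
      using bound[of _ "l *\<^sub>R g - h"] K(1) by (intro AE_I2) (auto simp: indicator_def abs_mult)
  qed
  then have "(\<lambda>n. ?v (real n) - ?v 0) \<longlonglongrightarrow> laplace l ?k" unfolding fin laplace_def .
  moreover have "(\<lambda>n. ?v (real n) - ?v 0) \<longlonglongrightarrow> 0 - ?v 0"
  proof (rule tendsto_diff[OF _ tendsto_const])
    have "((\<lambda>t. exp (- l * t)) \<longlongrightarrow> 0) at_top" using l by (rule exp_decay_tendsto)
    from tendsto_mult_left_zero[OF filterlim_compose[OF this filterlim_real_sequentially], of "norm g * K"]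
    have null: "(\<lambda>n. exp (- l * real n) * (norm g * K)) \<longlonglongrightarrow> 0" .
    have "norm (?v (real n)) \<le> exp (- l * real n) * (norm g * K)" for n
      using bound[of "real n" g] by (simp add: abs_mult)
    then show "(\<lambda>n. ?v (real n)) \<longlonglongrightarrow> 0"
      by (intro Lim_null_comparison[OF _ null] always_eventually allI)
  qed
  ultimately have "laplace l ?k = 0 - ?v 0" by (rule LIMSEQ_unique)
  then show ?thesis using S by (simp add: markov_semigroup_def)
qed

section \<open>Expectations along the exclusion semigroup\<close>

lemma local_bcontfun_apply [simp]: "local_function g \<Longrightarrow> apply_bcontfun (Bcontfun g) = g"
  using local_function_bcontfun by (rule Bcontfun_inverse)

lemma exclusion_semigroup_generator:
  fixes g :: "'d::finite config \<Rightarrow> real"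
  assumes S: "exclusion_semigroup q S" and g: "local_function g"
  obtains h where "(Bcontfun g, h) \<in> generator S" "apply_bcontfun h = exclusion_operator q g"
proof -
  have "\<exists>h. (Bcontfun g, h) \<in> generator S \<and> apply_bcontfun h = exclusion_operator q (apply_bcontfun (Bcontfun g))"
    using S local_bcontfun_apply[OF g] g unfolding exclusion_semigroup_def by (elim conjE allE[of _ "Bcontfun g"]) simp
  then show ?thesis using that g by auto
qed

context exchangeable
begin

lemma bounded_linear_expectation_mult:
  fixes f :: "'d config \<Rightarrow>\<^sub>C real"
  shows "bounded_linear (\<lambda>g. expectation (\<lambda>\<eta>. apply_bcontfun f \<eta> * apply_bcontfun g \<eta>))"
proof (rule bounded_linear_intro)
  have int: "integrable \<mu> (\<lambda>\<eta>. apply_bcontfun f \<eta> * apply_bcontfun g \<eta>)" for g :: "'d config \<Rightarrow>\<^sub>C real"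
    by (intro continuous_integrable continuous_on_mult continuous_on_apply_bcontfun)
  fix g h :: "'d config \<Rightarrow>\<^sub>C real" and r :: real
  show "expectation (\<lambda>\<eta>. apply_bcontfun f \<eta> * apply_bcontfun (g + h) \<eta>)
      = expectation (\<lambda>\<eta>. apply_bcontfun f \<eta> * apply_bcontfun g \<eta>) + expectation (\<lambda>\<eta>. apply_bcontfun f \<eta> * apply_bcontfun h \<eta>)"
    using int by (simp add: distrib_left)
  show "expectation (\<lambda>\<eta>. apply_bcontfun f \<eta> * apply_bcontfun (r *\<^sub>R g) \<eta>)
      = r *\<^sub>R expectation (\<lambda>\<eta>. apply_bcontfun f \<eta> * apply_bcontfun g \<eta>)"
    using Bochner_Integration.integral_mult_right_zero[of \<mu> r "\<lambda>\<eta>. apply_bcontfun f \<eta> * apply_bcontfun g \<eta>"]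
    by (simp add: mult.left_commute)
  show "norm (expectation (\<lambda>\<eta>. apply_bcontfun f \<eta> * apply_bcontfun g \<eta>)) \<le> norm g * norm f"
    using abs_expectation_mult_le[of "apply_bcontfun f" "apply_bcontfun g" "norm f" "norm g"]
      norm_bounded[of f] norm_bounded[of g] by (simp add: mult.commute)
qed

text \<open>For the datum \<open>(l - L) (g n)\<close> in place of \<open>f\<close> inside the
  semigroup, \<open>laplace_resolvent\<close> identifies the transform exactly with
  \<open>E (f (g n))\<close>. That datum is uniformly close to \<open>f\<close>, and the semigroup
  contracts.\<close>

lemma resolvent_seq_limit:
  assumes q: "jump_probability q" and S: "exclusion_semigroup q S" and l: "0 < l"
    and f: "local_function f" and g: "resolvent_seq q l f g"
  shows "(\<lambda>n. expectation (\<lambda>\<eta>. g n \<eta> * f \<eta>))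
    \<longlonglongrightarrow> laplace l (\<lambda>t. expectation (\<lambda>\<eta>. f \<eta> * apply_bcontfun (S t (Bcontfun f)) \<eta>))"
proof -
  have ms: "markov_semigroup S" using S by (simp add: exclusion_semigroup_def)
  note gl = resolvent_seqD(1)[OF g]
  let ?F = "\<lambda>u. expectation (\<lambda>\<eta>. apply_bcontfun (Bcontfun f) \<eta> * apply_bcontfun u \<eta>)"
  have F: "bounded_linear ?F" by (rule bounded_linear_expectation_mult)
  obtain K where K: "0 < K" "\<And>x. norm (?F x) \<le> norm x * K"
    using bounded_linear.pos_bounded[OF F] by blast
  have cont: "continuous_on {0..} (\<lambda>t. ?F (S t x))" for x
    using markov_semigroup_continuous[OF ms] by (rule bounded_linear.continuous_on[OF F])
  have bound: "\<bar>?F (S t x)\<bar> \<le> norm x * K" if "0 \<le> t" for t x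
  proof -
    have "\<bar>?F (S t x)\<bar> \<le> norm (S t x) * K" using K(2)[of "S t x"] by simp
    also have "\<dots> \<le> norm x * K"
      using markov_semigroup_contraction[OF ms that, of x] K(1) by (intro mult_right_mono) auto
    finally show ?thesis .
  qed
  have close: "\<bar>laplace l (\<lambda>t. ?F (S t (Bcontfun f))) - expectation (\<lambda>\<eta>. g n \<eta> * f \<eta>)\<bar> \<le> inverse (real (Suc n)) * K / l" for n
  proof -
    obtain h where h: "(Bcontfun (g n), h) \<in> generator S" "apply_bcontfun h = exclusion_operator q (g n)"
      using exclusion_semigroup_generator[OF S gl] by blast
    let ?r = "l *\<^sub>R Bcontfun (g n) - h"
    have norm: "norm (Bcontfun f - ?r) \<le> inverse (real (Suc n))"
      by (rule norm_bound) (use resolvent_seqD(2)[OF g, of _ n] f gl h(2) in simp)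
    have "laplace l (\<lambda>t. ?F (S t (Bcontfun f))) - ?F (Bcontfun (g n))
        = laplace l (\<lambda>t. ?F (S t (Bcontfun f))) - laplace l (\<lambda>t. ?F (S t ?r))"
      by (simp only: laplace_resolvent[OF ms h(1) l F])
    also have "\<dots> = laplace l (\<lambda>t. ?F (S t (Bcontfun f)) - ?F (S t ?r))"
      by (rule laplace_diff[OF l cont bound cont bound, symmetric])
    also have "\<bar>\<dots>\<bar> \<le> inverse (real (Suc n)) * K / l"
    proof (rule laplace_abs_le[OF l])
      show "(\<lambda>t. indicator {0..} t * (?F (S t (Bcontfun f)) - ?F (S t ?r))) \<in> borel_measurable borel"
        by (rule continuous_indicator_measurable) (intro continuous_on_diff cont)
      fix t :: real assume t: "0 \<le> t"
      have lin: "linear (S t)" using ms t by (simp add: markov_semigroup_def)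
      have "?F (S t (Bcontfun f)) - ?F (S t ?r) = ?F (S t (Bcontfun f - ?r))"
        unfolding linear_diff[OF lin] by (rule linear_diff[OF bounded_linear.linear[OF F], symmetric])
      also have "\<bar>\<dots>\<bar> \<le> norm (Bcontfun f - ?r) * K" by (rule bound[OF t])
      also have "\<dots> \<le> inverse (real (Suc n)) * K" using norm K(1) by (intro mult_right_mono) auto
      finally show "\<bar>?F (S t (Bcontfun f)) - ?F (S t ?r)\<bar> \<le> inverse (real (Suc n)) * K" .
    qed
    finally show ?thesis using f gl by (simp add: mult.commute)
  qed
  have "(\<lambda>n. inverse (real (Suc n)) * K / l) \<longlonglongrightarrow> 0 * K / l"
    by (intro tendsto_intros LIMSEQ_inverse_real_of_nat) (use l in simp)
  then have null: "(\<lambda>n. inverse (real (Suc n)) * K / l) \<longlonglongrightarrow> 0" by simp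
  have "(\<lambda>n. expectation (\<lambda>\<eta>. g n \<eta> * f \<eta>) - laplace l (\<lambda>t. ?F (S t (Bcontfun f)))) \<longlonglongrightarrow> 0"
    by (rule Lim_null_comparison[OF _ null]) (use close in \<open>auto simp: abs_minus_commute intro!: always_eventually\<close>)
  then show ?thesis using f by (simp add: LIM_zero_iff)
qed

text \<open>Invariance of \<open>\<mu>\<close> is needed only in this integrated form, so that no Laplace transform has
  to be inverted.\<close>

lemma laplace_expectation_semigroup:
  assumes q: "jump_probability q" and dense: "resolvent_dense q l" and S: "exclusion_semigroup q S" and l: "0 < l"
  shows "laplace l (\<lambda>t. expectation (apply_bcontfun (S t F))) = expectation (apply_bcontfun F) / l"
proof -
  have ms: "markov_semigroup S" using S by (simp add: exclusion_semigroup_def)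
  let ?E = "\<lambda>u :: 'd config \<Rightarrow>\<^sub>C real. expectation (apply_bcontfun u)"
  have E: "bounded_linear ?E"
    using bounded_linear_expectation_mult[of "const_bcontfun 1"] by (simp add: const_bcontfun.rep_eq)
  have E_le: "\<bar>?E x\<bar> \<le> norm x" for x
    using abs_expectation_le[of "apply_bcontfun x" "norm x"] norm_bounded[of x] by simp
  have cont: "continuous_on {0..} (\<lambda>t. ?E (S t x))" for x
    using markov_semigroup_continuous[OF ms] by (rule bounded_linear.continuous_on[OF E])
  have bound: "\<bar>?E (S t x)\<bar> \<le> norm x" if "0 \<le> t" for t x
    using E_le[of "S t x"] markov_semigroup_contraction[OF ms that, of x] by linarith
  \<comment> \<open>The datum \<open>?r\<close> lies in the range of \<open>l - L\<close> and is
    within \<open>2 e\<close> of \<open>F\<close>. Replacing \<open>F\<close> by it costs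
    \<open>2 e / l\<close> in the transform and \<open>2 e / l\<close> in the expectation.\<close>
  have close: "\<bar>laplace l (\<lambda>t. ?E (S t F)) - ?E F / l\<bar> \<le> 4 * e / l" if e: "0 < e" for e
  proof -
    obtain f where f: "local_function f" "\<And>\<eta>. \<bar>apply_bcontfun F \<eta> - f \<eta>\<bar> < e"
      using continuous_local_approx[OF continuous_on_apply_bcontfun e] by blast
    obtain g where g: "local_function g" "\<And>\<eta>. \<bar>f \<eta> - (l * g \<eta> - exclusion_operator q g \<eta>)\<bar> \<le> e"
      using resolvent_denseD[OF dense f(1) e] by blast
    obtain h where h: "(Bcontfun g, h) \<in> generator S" "apply_bcontfun h = exclusion_operator q g"
      using exclusion_semigroup_generator[OF S g(1)] by blast
    let ?r = "l *\<^sub>R Bcontfun g - h"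
    have norm: "norm (F - ?r) \<le> 2 * e"
    proof (rule norm_bound)
      fix \<eta>
      show "norm (apply_bcontfun (F - ?r) \<eta>) \<le> 2 * e"
        using f(2)[of \<eta>] g(2)[of \<eta>] g(1) h(2) by simp
    qed
    have "?E ?r = l * ?E (Bcontfun g) - ?E h"
      by (simp only: linear_diff[OF bounded_linear.linear[OF E]] linear_scale[OF bounded_linear.linear[OF E]] real_scaleR_def)
    \<comment> \<open>The infinitesimal invariance of the measure enters here.\<close>
    also have "?E h = 0" unfolding h(2) by (rule expectation_exclusion_operator_eq_0[OF q g(1)])
    finally have Er: "?E (Bcontfun g) = ?E ?r / l" using l by simp
    have "laplace l (\<lambda>t. ?E (S t F)) - laplace l (\<lambda>t. ?E (S t ?r)) = laplace l (\<lambda>t. ?E (S t F) - ?E (S t ?r))"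
      by (rule laplace_diff[OF l cont bound cont bound, symmetric])
    also have "\<bar>\<dots>\<bar> \<le> 2 * e / l"
    proof (rule laplace_abs_le[OF l])
      show "(\<lambda>t. indicator {0..} t * (?E (S t F) - ?E (S t ?r))) \<in> borel_measurable borel"
        by (rule continuous_indicator_measurable) (intro continuous_on_diff cont)
      fix t :: real assume t: "0 \<le> t"
      have lin: "linear (S t)" using ms t by (simp add: markov_semigroup_def)
      have "?E (S t F) - ?E (S t ?r) = ?E (S t (F - ?r))"
        unfolding linear_diff[OF lin] by (rule linear_diff[OF bounded_linear.linear[OF E], symmetric])
      then show "\<bar>?E (S t F) - ?E (S t ?r)\<bar> \<le> 2 * e" using bound[OF t, of "F - ?r"] norm by simp
    qed
    finally have 1: "\<bar>laplace l (\<lambda>t. ?E (S t F)) - ?E ?r / l\<bar> \<le> 2 * e / l"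
      unfolding laplace_resolvent[OF ms h(1) l E] Er .
    have "\<bar>?E ?r - ?E F\<bar> \<le> 2 * e"
      using E_le[of "F - ?r"] norm unfolding linear_diff[OF bounded_linear.linear[OF E]] by linarith
    then have "\<bar>?E ?r / l - ?E F / l\<bar> \<le> 2 * e / l"
      using l unfolding diff_divide_distrib [symmetric] abs_divide by (simp add: divide_right_mono)
    then show ?thesis using 1 by simp
  qed
  have "\<bar>laplace l (\<lambda>t. ?E (S t F)) - ?E F / l\<bar> \<le> 0"
  proof (rule field_le_epsilon)
    fix e :: real assume "0 < e"
    then show "\<bar>laplace l (\<lambda>t. ?E (S t F)) - ?E F / l\<bar> \<le> 0 + e"
      using close[of "e * l / 4"] l by simp
  qed
  then show ?thesis by simp
qed

end

section \<open>The variance of an additive functional\<close>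

text \<open>The exponential weight is made part of a finite measure on times, so that bounded
  measurable integrands may be integrated in any order.\<close>

definition expm :: "real \<Rightarrow> real measure" where
  "expm a = density lborel (\<lambda>t. ennreal (indicator {0..} t * exp (- a * t)))"

lemma sets_expm [measurable_cong, simp]: "sets (expm a) = sets borel"
  by (simp add: expm_def)

lemma space_expm [simp]: "space (expm a) = UNIV"
  by (simp add: expm_def)

lemma integral_expm:
  fixes g :: "real \<Rightarrow> real"
  assumes [measurable]: "g \<in> borel_measurable borel"
  shows "integral\<^sup>L (expm a) g = laplace a g"
  unfolding expm_def laplace_def by (subst integral_real_density) auto

lemma finite_measure_expm:
  assumes "0 < a" shows "finite_measure (expm a)"
proof
  have "emeasure (expm a) (space (expm a)) = (\<integral>\<^sup>+ t. ennreal (indicator {0..} t * exp (- a * t)) \<partial>lborel)"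
    by (simp add: expm_def emeasure_density)
  also have "\<dots> = ennreal (LINT t|lborel. indicator {0..} t * exp (- a * t))"
    using exp_decay_integral(1)[OF assms, of 0] by (rule nn_integral_eq_integral) auto
  finally show "emeasure (expm a) (space (expm a)) \<noteq> \<infinity>" by simp
qed

lemma bounded_integral_swap:
  fixes G :: "'a \<Rightarrow> 'b \<Rightarrow> real"
  assumes A: "finite_measure A" and B: "finite_measure B"
    and G [measurable]: "case_prod G \<in> borel_measurable (A \<Otimes>\<^sub>M B)" and C: "\<And>x y. \<bar>G x y\<bar> \<le> C"
  shows "(\<integral>x. (\<integral>y. G x y \<partial>B) \<partial>A) = (\<integral>y. (\<integral>x. G x y \<partial>A) \<partial>B)"
proof -
  interpret A: finite_measure A by (rule A)
  interpret B: finite_measure B by (rule B)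
  interpret P: pair_sigma_finite A B ..
  interpret AB: finite_measure "A \<Otimes>\<^sub>M B" by (rule finite_measure_pair_measure[OF B A])
  have "integrable (A \<Otimes>\<^sub>M B) (case_prod G)"
    by (rule AB.integrable_const_bound[of _ C]) (use C G in \<open>auto simp: case_prod_unfold\<close>)
  from P.Fubini_integral[OF this] show ?thesis by simp
qed

lemma bounded_integral_le:
  fixes g :: "'a \<Rightarrow> real"
  assumes A: "finite_measure A" and C: "\<And>x. \<bar>g x\<bar> \<le> C"
  shows "\<bar>\<integral>x. g x \<partial>A\<bar> \<le> C * measure A (space A)"
proof (cases "integrable A g")
  case True
  interpret A: finite_measure A by (rule A)
  have "\<bar>\<integral>x. g x \<partial>A\<bar> \<le> (\<integral>x. \<bar>g x\<bar> \<partial>A)"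
    by (rule integral_abs_bound)
  also have "\<dots> \<le> (\<integral>x. C \<partial>A)" using True C by (intro integral_mono) auto
  finally show ?thesis by (simp add: mult.commute)
next
  \<comment> \<open>A function that is not integrable has integral 0 by convention, so the bound
    holds without a measurability assumption.\<close>
  case False
  have "0 \<le> C" using order_trans[OF abs_ge_zero C] by blast
  then show ?thesis using False by (simp add: not_integrable_integral_eq)
qed

lemma max_diagonal:
  fixes t s r :: real
  shows "indicator {0..} t * (of_bool (s \<le> t) * of_bool (r \<le> t)) = (indicator {max 0 (max r s)..} t :: real)"
  by (auto simp: indicator_def)

text \<open>The variance formula is an identity for bounded jointly measurable processes. Markov
  property and invariance only enter afterwards, through \<open>corr\<close>.\<close>

locale bounded_process = prob_space M for M :: "'w measure" +
  fixes Z :: "real \<Rightarrow> 'w \<Rightarrow> real" and C :: real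
  assumes Z [measurable]: "case_prod Z \<in> borel_measurable (borel \<Otimes>\<^sub>M M)" and C: "\<And>r \<omega>. \<bar>Z r \<omega>\<bar> \<le> C"
begin

definition corr :: "real \<Rightarrow> real \<Rightarrow> real" where
  "corr r s = expectation (\<lambda>\<omega>. Z r \<omega> * Z s \<omega>)"

lemma C_nonneg: "0 \<le> C"
  using order_trans[OF abs_ge_zero C] by blast

lemma Z_Z_le: "\<bar>Z r \<omega> * Z s \<omega>\<bar> \<le> C * C"
  unfolding abs_mult using C C_nonneg by (intro mult_mono) auto

lemma corr_measurable [measurable]: "case_prod corr \<in> borel_measurable (borel \<Otimes>\<^sub>M borel)"
  unfolding corr_def by measurable

lemma corr_le: "\<bar>corr r s\<bar> \<le> C * C"
  unfolding corr_def using bounded_integral_le[OF finite_measure_axioms Z_Z_le] by (simp add: prob_space)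

lemma corr_commute: "corr r s = corr s r"
  by (simp add: corr_def mult.commute)

text \<open>The density of Lebesgue measure on \<open>{0..t}\<close> with respect to
  \<open>expm a\<close>: the growing exponential undoes the weight of the measure.\<close>

definition truncated :: "real \<Rightarrow> real \<Rightarrow> real \<Rightarrow> real" where
  "truncated a t s = of_bool (s \<le> t) * exp (a * s)"

lemma truncated_measurable [measurable]:
  "case_prod (truncated a) \<in> borel_measurable (borel \<Otimes>\<^sub>M borel)"
  unfolding truncated_def by measurable

lemma truncated_nonneg: "0 \<le> truncated a t s"
  by (simp add: truncated_def)

lemma truncated_le: "0 < a \<Longrightarrow> truncated a t s \<le> exp (a * t)"
  by (simp add: truncated_def)

lemma additive_square:
  assumes a: "0 < a"
  shows "expectation (\<lambda>\<omega>. (LINT s|lborel. indicator {0..t} s * Z s \<omega>)\<^sup>2)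
    = (\<integral>s. (\<integral>r. truncated a t s * truncated a t r * corr r s \<partial>expm a) \<partial>expm a)"
proof -
  interpret K: finite_measure "expm a" using a by (rule finite_measure_expm)
  let ?p = "truncated a t"
  define I where "I = (\<lambda>\<omega>. \<integral>r. ?p r * Z r \<omega> \<partial>expm a)"
  have [measurable]: "I \<in> borel_measurable M" unfolding I_def by measurable
  have p_le: "\<bar>?p s\<bar> \<le> exp (a * t)" for s
    using truncated_nonneg[of a t s] truncated_le[OF a, of t s] by simp
  have pZ_le: "\<bar>?p s * Z s \<omega>\<bar> \<le> exp (a * t) * C" for s \<omega>
    unfolding abs_mult using p_le C by (intro mult_mono) auto
  have I_le: "\<bar>I \<omega>\<bar> \<le> exp (a * t) * C * measure (expm a) (space (expm a))" for \<omega>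
    unfolding I_def by (rule bounded_integral_le[OF K.finite_measure_axioms pZ_le])
  have I_eq: "(LINT s|lborel. indicator {0..t} s * Z s \<omega>) = I \<omega>" if "\<omega> \<in> space M" for \<omega>
  proof -
    have "(\<lambda>s. ?p s * Z s \<omega>) \<in> borel_measurable borel" using that by measurable
    then have "I \<omega> = laplace a (\<lambda>s. ?p s * Z s \<omega>)" unfolding I_def by (rule integral_expm)
    also have "\<dots> = (LINT s|lborel. indicator {0..t} s * Z s \<omega>)"
      unfolding laplace_def
      by (rule Bochner_Integration.integral_cong) (auto simp: truncated_def indicator_def simp flip: exp_add)
    finally show ?thesis by simp
  qed
  have "expectation (\<lambda>\<omega>. (LINT s|lborel. indicator {0..t} s * Z s \<omega>)\<^sup>2) = expectation (\<lambda>\<omega>. \<integral>s. I \<omega> * (?p s * Z s \<omega>) \<partial>expm a)"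
    by (rule Bochner_Integration.integral_cong) (simp_all add: I_eq power2_eq_square I_def)
  also have "\<dots> = (\<integral>s. expectation (\<lambda>\<omega>. I \<omega> * (?p s * Z s \<omega>)) \<partial>expm a)"
  proof (rule bounded_integral_swap[OF finite_measure_axioms K.finite_measure_axioms])
    show "(\<lambda>(\<omega>, s). I \<omega> * (?p s * Z s \<omega>)) \<in> borel_measurable (M \<Otimes>\<^sub>M expm a)"
      by measurable
    show "\<bar>I \<omega> * (?p s * Z s \<omega>)\<bar> \<le> exp (a * t) * C * measure (expm a) (space (expm a)) * (exp (a * t) * C)" for \<omega> s
      unfolding abs_mult[of "I \<omega>"] using I_le pZ_le C_nonneg by (intro mult_mono) auto
  qed
  also have "\<dots> = (\<integral>s. (\<integral>r. ?p s * ?p r * corr r s \<partial>expm a) \<partial>expm a)"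
  proof (rule Bochner_Integration.integral_cong[OF refl])
    fix s
    have "I \<omega> * (?p s * Z s \<omega>) = (\<integral>r. ?p s * ?p r * (Z r \<omega> * Z s \<omega>) \<partial>expm a)" for \<omega>
    proof -
      have "I \<omega> * (?p s * Z s \<omega>) = (\<integral>r. ?p r * Z r \<omega> * (?p s * Z s \<omega>) \<partial>expm a)"
        unfolding I_def by (rule integral_mult_left_zero [symmetric])
      then show ?thesis by (simp add: mult.assoc mult.left_commute)
    qed
    then have "expectation (\<lambda>\<omega>. I \<omega> * (?p s * Z s \<omega>)) = expectation (\<lambda>\<omega>. \<integral>r. ?p s * ?p r * (Z r \<omega> * Z s \<omega>) \<partial>expm a)"
      by simp
    also have "\<dots> = (\<integral>r. expectation (\<lambda>\<omega>. ?p s * ?p r * (Z r \<omega> * Z s \<omega>)) \<partial>expm a)"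
    proof (rule bounded_integral_swap[OF finite_measure_axioms K.finite_measure_axioms])
      show "(\<lambda>(\<omega>, r). ?p s * ?p r * (Z r \<omega> * Z s \<omega>)) \<in> borel_measurable (M \<Otimes>\<^sub>M expm a)"
        by measurable
      show "\<bar>?p s * ?p r * (Z r \<omega> * Z s \<omega>)\<bar> \<le> exp (a * t) * exp (a * t) * (C * C)" for \<omega> r
        unfolding abs_mult[of "?p s * ?p r"] abs_mult[of "?p s" "?p r"] using p_le Z_Z_le
        by (intro mult_mono) auto
    qed
    finally show "expectation (\<lambda>\<omega>. I \<omega> * (?p s * Z s \<omega>)) = (\<integral>r. ?p s * ?p r * corr r s \<partial>expm a)"
      by (simp add: corr_def)
  qed
  finally show ?thesis .
qed

text \<open>The square is a double time integral over \<open>r\<close> and \<open>s\<close>.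
  Integrating \<open>exp (- l t)\<close> over \<open>t\<close> above both gives \<open>1 / l\<close>
  times its value at the maximum; symmetry reduces to \<open>r <= s\<close> with a factor 2; for
  \<open>s = r + h\<close> the weight \<open>exp (- l (r + h))\<close> factorizes.\<close>

lemma laplace_additive_square:
  assumes l: "0 < l"
  shows "laplace l (\<lambda>t. expectation (\<lambda>\<omega>. (LINT s|lborel. indicator {0..t} s * Z s \<omega>)\<^sup>2))
    = 2 / l * laplace l (\<lambda>h. laplace l (\<lambda>r. corr r (r + h)))"
proof -
  \<comment> \<open>The decay \<open>exp (- l t)\<close> is split into three equal parts: one
    becomes the measure \<open>expm a\<close> in \<open>t\<close>, the other two compensate the
    growth \<open>exp (a t)\<close> of the two truncated factors. Hence \<open>G\<close> is bounded
    and Fubini applies.\<close>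
  define a where "a = l / 3"
  have a: "0 < a" and la: "l = 3 * a" using l by (auto simp: a_def)
  interpret K: finite_measure "expm a" using a by (rule finite_measure_expm)
  interpret L: finite_measure "expm l" using l by (rule finite_measure_expm)
  note Kf = K.finite_measure_axioms and Lf = L.finite_measure_axioms
  let ?p = "truncated a"
  define G where "G = (\<lambda>t s r. exp (- (2 * a) * t) * (?p t s * ?p t r * corr r s))"
  have G_meas [measurable]: "(\<lambda>(t, s, r). G t s r) \<in> borel_measurable (borel \<Otimes>\<^sub>M borel \<Otimes>\<^sub>M borel)"
    unfolding G_def by measurable
  have G_meas2: "(\<lambda>(t, r). G t s r) \<in> borel_measurable (borel \<Otimes>\<^sub>M borel)" for s
    unfolding G_def by measurable
  have G_meas1: "(\<lambda>t. G t s r) \<in> borel_measurable borel" for s r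
    unfolding G_def by measurable
  have G_le: "\<bar>G t s r\<bar> \<le> C * C" for t s r
  proof -
    have "exp (- (2 * a) * t) * (?p t s * ?p t r) \<le> exp (- (2 * a) * t) * (exp (a * t) * exp (a * t))"
      by (intro mult_left_mono mult_mono truncated_le[OF a] truncated_nonneg) auto
    also have "\<dots> = 1" by (simp flip: exp_add)
    finally have le: "exp (- (2 * a) * t) * (?p t s * ?p t r) \<le> 1" .
    have "\<bar>G t s r\<bar> = (exp (- (2 * a) * t) * (?p t s * ?p t r)) * \<bar>corr r s\<bar>"
      by (simp add: G_def abs_mult truncated_nonneg)
    also have "\<dots> \<le> 1 * (C * C)" using le corr_le by (intro mult_mono) (auto simp: truncated_nonneg)
    finally show ?thesis by simp
  qed
  \<comment> \<open>This is \<open>l\<close> times the integral of \<open>G\<close> over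
    \<open>t\<close>. The inner \<open>max 0\<close> covers negative \<open>r\<close> and
    \<open>s\<close>, where the time measure starts at 0.\<close>
  define U where "U = (\<lambda>s r. exp (a * s + a * r) * corr r s * exp (- l * max 0 (max r s)))"
  have U_meas [measurable]: "case_prod U \<in> borel_measurable (borel \<Otimes>\<^sub>M borel)"
    unfolding U_def by measurable
  have U_le: "\<bar>U s r\<bar> \<le> C * C" for s r
  proof -
    have "exp (a * s + a * r) * exp (- l * max 0 (max r s)) = exp (a * s + a * r - l * max 0 (max r s))"
      by (simp flip: exp_add)
    also have "\<dots> \<le> 1"
    proof -
      have "a * s + a * r \<le> a * max 0 (max r s) + a * max 0 (max r s)"
        using a by (intro add_mono mult_left_mono) auto
      also have "\<dots> \<le> l * max 0 (max r s)" using a by (simp add: la)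
      finally show ?thesis by simp
    qed
    finally have le: "exp (a * s + a * r) * exp (- l * max 0 (max r s)) \<le> 1" .
    have "\<bar>U s r\<bar> = (exp (a * s + a * r) * exp (- l * max 0 (max r s))) * \<bar>corr r s\<bar>"
      by (simp add: U_def abs_mult)
    also have "\<dots> \<le> 1 * (C * C)" using le corr_le by (intro mult_mono) auto
    finally show ?thesis by simp
  qed
  have U_sym: "U s r = U r s" for s r
    by (simp add: U_def corr_commute[of r s] max.commute add.commute)
  have inner: "(\<integral>t. G t s r \<partial>expm a) = U s r / l" for s r
  proof -
    have "(\<integral>t. G t s r \<partial>expm a) = laplace a (\<lambda>t. G t s r)"
      by (rule integral_expm[OF G_meas1])
    also have "\<dots> = (LINT t|lborel. (exp (a * s + a * r) * corr r s) * (indicator {max 0 (max r s)..} t * exp (- l * t)))"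
      unfolding laplace_def
    proof (rule Bochner_Integration.integral_cong[OF refl])
      fix t :: real
      have "indicator {0..} t * exp (- a * t) * G t s r
          = (indicator {0..} t * (of_bool (s \<le> t) * of_bool (r \<le> t)))
            * (exp (- a * t) * exp (- (2 * a) * t)) * (exp (a * s) * exp (a * r)) * corr r s"
        by (simp add: G_def truncated_def)
      also have "exp (- a * t) * exp (- (2 * a) * t) = exp (- l * t)"
        by (simp add: la flip: exp_add)
      also have "exp (a * s) * exp (a * r) = exp (a * s + a * r)" by (simp add: exp_add)
      finally show "indicator {0..} t * exp (- a * t) * G t s r
          = (exp (a * s + a * r) * corr r s) * (indicator {max 0 (max r s)..} t * exp (- l * t))"
        unfolding max_diagonal by simp
    qed
    also have "\<dots> = (exp (a * s + a * r) * corr r s) * (exp (- l * max 0 (max r s)) / l)"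
      by (simp only: integral_mult_right_zero exp_decay_integral(2)[OF l])
    finally show ?thesis by (simp add: U_def)
  qed
  have V_meas: "(\<lambda>t. \<integral>s. (\<integral>r. G t s r \<partial>expm a) \<partial>expm a) \<in> borel_measurable borel"
    unfolding G_def by measurable
  have "laplace l (\<lambda>t. expectation (\<lambda>\<omega>. (LINT s|lborel. indicator {0..t} s * Z s \<omega>)\<^sup>2))
      = laplace a (\<lambda>t. \<integral>s. (\<integral>r. G t s r \<partial>expm a) \<partial>expm a)"
  proof -
    have "(\<integral>s. (\<integral>r. G t s r \<partial>expm a) \<partial>expm a)
        = exp (- (2 * a) * t) * (\<integral>s. (\<integral>r. ?p t s * ?p t r * corr r s \<partial>expm a) \<partial>expm a)" for t
      unfolding G_def by simp
    moreover have "exp (- l * t) = exp (- a * t) * exp (- (2 * a) * t)" for t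
      by (simp add: la flip: exp_add)
    ultimately show ?thesis
      unfolding laplace_def additive_square[OF a] by (simp add: mult.assoc)
  qed
  also have "\<dots> = (\<integral>t. (\<integral>s. (\<integral>r. G t s r \<partial>expm a) \<partial>expm a) \<partial>expm a)"
    by (rule integral_expm[OF V_meas, symmetric])
  also have "\<dots> = (\<integral>s. (\<integral>t. (\<integral>r. G t s r \<partial>expm a) \<partial>expm a) \<partial>expm a)"
  proof (rule bounded_integral_swap[OF Kf Kf])
    show "(\<lambda>(t, s). \<integral>r. G t s r \<partial>expm a) \<in> borel_measurable (expm a \<Otimes>\<^sub>M expm a)"
      unfolding G_def by measurable
    show "\<bar>\<integral>r. G t s r \<partial>expm a\<bar> \<le> C * C * measure (expm a) (space (expm a))" for t s
      by (rule bounded_integral_le[OF Kf G_le])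
  qed
  also have "\<dots> = (\<integral>s. (\<integral>r. (\<integral>t. G t s r \<partial>expm a) \<partial>expm a) \<partial>expm a)"
  proof (rule Bochner_Integration.integral_cong[OF refl], rule bounded_integral_swap[OF Kf Kf _ G_le])
    show "(\<lambda>(t, r). G t s r) \<in> borel_measurable (expm a \<Otimes>\<^sub>M expm a)" for s
      unfolding G_def by measurable
  qed
  also have "\<dots> = (\<integral>s. (\<integral>r. U s r \<partial>expm a) \<partial>expm a) / l"
    by (simp add: inner)
  \<comment> \<open>\<open>U\<close> is symmetric and the diagonal is a null set, so the double
    integral is twice the one over \<open>r <= s\<close>.\<close>
  also have "(\<integral>s. (\<integral>r. U s r \<partial>expm a) \<partial>expm a) = 2 * (\<integral>r. (\<integral>s. of_bool (r \<le> s) * U s r \<partial>expm a) \<partial>expm a)"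
  proof -
    have bU: "\<bar>of_bool b * U s r\<bar> \<le> C * C" for b s r
      using U_le[of s r] C_nonneg by (cases b) auto
    have int: "integrable (expm a) (\<lambda>r. of_bool (r \<le> s) * U s r)" "integrable (expm a) (\<lambda>r. of_bool (s < r) * U s r)" for s
      by (rule K.integrable_const_bound[of _ "C * C"]; use bU in \<open>auto\<close>)+
    have int1: "integrable (expm a) (\<lambda>s. \<integral>r. of_bool (r \<le> s) * U s r \<partial>expm a)"
    proof (rule K.integrable_const_bound[of _ "C * C * measure (expm a) (space (expm a))"])
      show "AE s in expm a. norm (\<integral>r. of_bool (r \<le> s) * U s r \<partial>expm a) \<le> C * C * measure (expm a) (space (expm a))"
        unfolding real_norm_def by (intro AE_I2 bounded_integral_le[OF Kf bU])
    qed measurable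
    have int2: "integrable (expm a) (\<lambda>s. \<integral>r. of_bool (s < r) * U s r \<partial>expm a)"
    proof (rule K.integrable_const_bound[of _ "C * C * measure (expm a) (space (expm a))"])
      show "AE s in expm a. norm (\<integral>r. of_bool (s < r) * U s r \<partial>expm a) \<le> C * C * measure (expm a) (space (expm a))"
        unfolding real_norm_def by (intro AE_I2 bounded_integral_le[OF Kf bU])
    qed measurable
    have "(\<integral>s. (\<integral>r. U s r \<partial>expm a) \<partial>expm a)
        = (\<integral>s. (\<integral>r. of_bool (r \<le> s) * U s r + of_bool (s < r) * U s r \<partial>expm a) \<partial>expm a)"
      by (intro Bochner_Integration.integral_cong refl) auto
    also have "\<dots> = (\<integral>s. (\<integral>r. of_bool (r \<le> s) * U s r \<partial>expm a) \<partial>expm a) + (\<integral>s. (\<integral>r. of_bool (s < r) * U s r \<partial>expm a) \<partial>expm a)"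
      using int int1 int2 by simp
    also have "(\<integral>s. (\<integral>r. of_bool (r \<le> s) * U s r \<partial>expm a) \<partial>expm a) = (\<integral>r. (\<integral>s. of_bool (r \<le> s) * U s r \<partial>expm a) \<partial>expm a)"
      by (rule bounded_integral_swap[OF Kf Kf _ bU]) measurable
    also have "(\<integral>s. (\<integral>r. of_bool (s < r) * U s r \<partial>expm a) \<partial>expm a) = (\<integral>r. (\<integral>s. of_bool (r \<le> s) * U s r \<partial>expm a) \<partial>expm a)"
    proof (rule Bochner_Integration.integral_cong[OF refl])
      fix s
      show "(\<integral>r. of_bool (s < r) * U s r \<partial>expm a) = (\<integral>r. of_bool (s \<le> r) * U r s \<partial>expm a)"
      proof (rule integral_cong_AE)
        have "AE r in lborel. r \<noteq> s" by (rule AE_lborel_singleton)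
        then have "AE r in expm a. r \<noteq> s" unfolding expm_def by (subst AE_density) auto
        then show "AE r in expm a. of_bool (s < r) * U s r = of_bool (s \<le> r) * U r s"
          by eventually_elim (auto simp: U_sym[of s])
      qed measurable
    qed
    finally show ?thesis by simp
  qed
  also have "(\<integral>r. (\<integral>s. of_bool (r \<le> s) * U s r \<partial>expm a) \<partial>expm a) = laplace l (\<lambda>r. laplace l (\<lambda>h. corr r (r + h)))"
  proof -
    have "(\<integral>r. (\<integral>s. of_bool (r \<le> s) * U s r \<partial>expm a) \<partial>expm a) = laplace a (\<lambda>r. \<integral>s. of_bool (r \<le> s) * U s r \<partial>expm a)"
      by (rule integral_expm) measurable
    also have "\<dots> = laplace l (\<lambda>r. laplace l (\<lambda>h. corr r (r + h)))"
      unfolding laplace_def[of a] laplace_def[of l "\<lambda>r. laplace l (\<lambda>h. corr r (r + h))"]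
    proof (rule Bochner_Integration.integral_cong[OF refl])
      fix r :: real
      show "indicator {0..} r * exp (- a * r) * (\<integral>s. of_bool (r \<le> s) * U s r \<partial>expm a)
          = indicator {0..} r * exp (- l * r) * laplace l (\<lambda>h. corr r (r + h))"
      proof (cases "0 \<le> r")
        case True
        have "(\<integral>s. of_bool (r \<le> s) * U s r \<partial>expm a) = laplace a (\<lambda>s. of_bool (r \<le> s) * U s r)"
          by (rule integral_expm) measurable
        also have "\<dots> = (LINT s|lborel. indicator {0..} (s - r) * (exp (a * r) * exp (- l * s)) * corr r s)"
          unfolding laplace_def
        proof (rule Bochner_Integration.integral_cong[OF refl])
          fix s :: real
          show "indicator {0..} s * exp (- a * s) * (of_bool (r \<le> s) * U s r)
              = indicator {0..} (s - r) * (exp (a * r) * exp (- l * s)) * corr r s"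
          proof (cases "r \<le> s")
            case le: True
            have "exp (- a * s) * exp (a * s + a * r) = exp (a * r)" by (simp flip: exp_add)
            moreover have "max 0 (max r s) = s" using le True by simp
            ultimately show ?thesis using le True by (simp add: U_def flip: mult.assoc)
          qed (simp add: indicator_def)
        qed
        \<comment> \<open>Substitution \<open>s = r + h\<close>, with \<open>h\<close> the time
          lag.\<close>
        also have "\<dots> = (LINT h|lborel. indicator {0..} h * (exp (a * r) * exp (- l * (r + h))) * corr r (r + h))"
          by (subst lborel_integral_real_affine[where c = 1 and t = r]) simp_all
        also have "\<dots> = (LINT h|lborel. (exp (a * r) * exp (- l * r)) * (indicator {0..} h * exp (- l * h) * corr r (r + h)))"
        proof (rule Bochner_Integration.integral_cong[OF refl])
          fix h :: real
          have "exp (- l * (r + h)) = exp (- l * r) * exp (- l * h)" by (simp add: algebra_simps flip: exp_add)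
          then show "indicator {0..} h * (exp (a * r) * exp (- l * (r + h))) * corr r (r + h)
              = (exp (a * r) * exp (- l * r)) * (indicator {0..} h * exp (- l * h) * corr r (r + h))"
            by simp
        qed
        also have "\<dots> = (exp (a * r) * exp (- l * r)) * laplace l (\<lambda>h. corr r (r + h))"
          unfolding laplace_def by (rule integral_mult_right_zero)
        finally have "(\<integral>s. of_bool (r \<le> s) * U s r \<partial>expm a) = (exp (a * r) * exp (- l * r)) * laplace l (\<lambda>h. corr r (r + h))" .
        moreover have "exp (- a * r) * (exp (a * r) * v) = v" for v
          by (simp add: mult.assoc [symmetric] flip: exp_add)
        ultimately show ?thesis by (simp add: mult.assoc)
      qed simp
    qed
    finally show ?thesis .
  qed
  \<comment> \<open>The transform in the starting time \<open>r\<close>, at a fixed lag, is moved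
    inside: this is the form in which \<open>laplace_expectation_semigroup\<close> provides
    invariance.\<close>
  also have "laplace l (\<lambda>r. laplace l (\<lambda>h. corr r (r + h))) = laplace l (\<lambda>h. laplace l (\<lambda>r. corr r (r + h)))"
  proof -
    have 1: "(\<integral>h. corr r (r + h) \<partial>expm l) = laplace l (\<lambda>h. corr r (r + h))" for r
      by (rule integral_expm) measurable
    have 2: "(\<integral>r. corr r (r + h) \<partial>expm l) = laplace l (\<lambda>r. corr r (r + h))" for h
      by (rule integral_expm) measurable
    have "laplace l (\<lambda>r. \<integral>h. corr r (r + h) \<partial>expm l) = (\<integral>r. (\<integral>h. corr r (r + h) \<partial>expm l) \<partial>expm l)"
      by (rule integral_expm [symmetric]) measurable
    also have "\<dots> = (\<integral>h. (\<integral>r. corr r (r + h) \<partial>expm l) \<partial>expm l)"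
      by (rule bounded_integral_swap[OF Lf Lf _ corr_le]) measurable
    also have "\<dots> = laplace l (\<lambda>h. \<integral>r. corr r (r + h) \<partial>expm l)"
      by (rule integral_expm) measurable
    finally show ?thesis unfolding 1 2 .
  qed
  finally show ?thesis by simp
qed

end

section \<open>Realizations of the exclusion process\<close>

lemma continuous_bcontfun:
  fixes g :: "'d::finite config \<Rightarrow> real"
  assumes "continuous_on UNIV g" shows "g \<in> bcontfun"
proof -
  obtain C where C: "\<And>\<eta>. \<bar>g \<eta>\<bar> \<le> C" using continuous_config_bounded[OF assms] by blast
  show ?thesis by (rule bcontfun_normI[OF assms, of C]) (simp add: C)
qed

lemma laplace_cong: "(\<And>t. 0 \<le> t \<Longrightarrow> k t = j t) \<Longrightarrow> laplace l k = laplace l j"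
  unfolding laplace_def by (intro Bochner_Integration.integral_cong refl) (auto simp: indicator_def)

lemma exclusion_processD:
  assumes "exclusion_process q \<mu> M X"
  shows "prob_space M" "\<And>t. 0 \<le> t \<Longrightarrow> X t \<in> measurable M config_algebra"
    "\<And>\<omega> t. \<omega> \<in> space M \<Longrightarrow> 0 \<le> t \<Longrightarrow> ((\<lambda>s. X s \<omega>) \<longlongrightarrow> X t \<omega>) (at_right t)"
    "distr M \<mu> (X 0) = \<mu>"
  using assms unfolding exclusion_process_def by auto

text \<open>Right-continuity makes the path a limit of step functions, sampled to the right of \<open>r\<close>.\<close>

lemma exclusion_process_jointly_measurable:
  fixes f :: "'d::finite config \<Rightarrow> real"
  assumes X: "exclusion_process q \<mu> M X" and f: "continuous_on UNIV f"
  shows "case_prod (\<lambda>r \<omega>. f (X (max r 0) \<omega>)) \<in> borel_measurable (borel \<Otimes>\<^sub>M M)"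
proof -
  \<comment> \<open>The sampling time is \<open>(k + 1) / (n + 1)\<close> with \<open>k\<close> the
    floor of \<open>(n + 1) r\<close>. The added 1 puts it strictly to the right of
    \<open>r\<close>, within \<open>1 / (n + 1)\<close>; \<open>max\<close> keeps it nonnegative for
    every integer index.\<close>
  let ?k = "\<lambda>n r. \<lfloor>real (Suc n) * max r 0\<rfloor>"
  let ?s = "\<lambda>n i. max (real_of_int (i + 1) / real (Suc n)) 0"
  define u where "u = (\<lambda>n p. f (X (?s n (?k n (fst p))) (snd p)))"
  have meas: "u n \<in> borel_measurable (borel \<Otimes>\<^sub>M M)" for n
    unfolding u_def
  proof (rule measurable_compose_countable[where f = "\<lambda>i p. f (X (?s n i) (snd p))" and g = "\<lambda>p. ?k n (fst p)"])
    show "(\<lambda>p. f (X (?s n i) (snd p))) \<in> borel_measurable (borel \<Otimes>\<^sub>M M)" for i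
      by (rule measurable_compose[OF measurable_compose[OF measurable_snd exclusion_processD(2)[OF X]]
            continuous_config_measurable[OF f]]) simp
    show "(\<lambda>p :: real \<times> _. ?k n (fst p)) \<in> measurable (borel \<Otimes>\<^sub>M M) (count_space UNIV)"
      by measurable
  qed
  have lim: "(\<lambda>n. u n p) \<longlonglongrightarrow> case_prod (\<lambda>r \<omega>. f (X (max r 0) \<omega>)) p" if p: "p \<in> space (borel \<Otimes>\<^sub>M M)" for p
  proof -
    obtain r \<omega> where [simp]: "p = (r, \<omega>)" by (cases p)
    have \<omega>: "\<omega> \<in> space M" using p by (simp add: space_pair_measure)
    define t where "t = max r 0"
    have t: "0 \<le> t" by (simp add: t_def)
    let ?t = "\<lambda>n. ?s n (?k n r)"
    have gt: "t < ?t n" and le: "?t n \<le> t + inverse (real (Suc n))" for n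
    proof -
      have pos: "0 < real (Suc n)" by simp
      have fl: "real_of_int (?k n r) \<le> real (Suc n) * t" "real (Suc n) * t < real_of_int (?k n r) + 1"
        unfolding t_def by linarith+
      have "real (Suc n) * t < real_of_int (?k n r + 1)" using fl by simp
      then have "t < real_of_int (?k n r + 1) / real (Suc n)"
        using pos by (simp add: pos_less_divide_eq mult.commute)
      then show "t < ?t n" by simp
      have "real_of_int (?k n r + 1) \<le> real (Suc n) * t + 1" using fl by simp
      then have "real_of_int (?k n r + 1) / real (Suc n) \<le> (real (Suc n) * t + 1) / real (Suc n)"
        using pos by (intro divide_right_mono) auto
      also have "\<dots> = t + inverse (real (Suc n))" using pos by (simp add: add_divide_distrib inverse_eq_divide)
      finally have "real_of_int (?k n r + 1) / real (Suc n) \<le> t + inverse (real (Suc n))" .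
      moreover have "0 \<le> t + inverse (real (Suc n))" using t by simp
      ultimately show "?t n \<le> t + inverse (real (Suc n))" by (rule max.boundedI)
    qed
    have "?t \<longlonglongrightarrow> t"
    proof (rule tendsto_sandwich)
      show "(\<lambda>n. t) \<longlonglongrightarrow> t" by simp
      show "(\<lambda>n. t + inverse (real (Suc n))) \<longlonglongrightarrow> t"
        using tendsto_add[OF tendsto_const LIMSEQ_inverse_real_of_nat, of t] by simp
      show "\<forall>\<^sub>F n in sequentially. t \<le> ?t n" using gt by (intro always_eventually allI less_imp_le)
      show "\<forall>\<^sub>F n in sequentially. ?t n \<le> t + inverse (real (Suc n))"
        using le by (intro always_eventually allI)
    qed
    then have right: "filterlim ?t (at_right t) sequentially"
      unfolding filterlim_at using gt by (auto intro!: always_eventually simp: less_imp_neq[THEN not_sym])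
    have "((\<lambda>s. f (X s \<omega>)) \<longlongrightarrow> f (X t \<omega>)) (at_right t)"
      by (rule continuous_on_tendsto_compose[OF f exclusion_processD(3)[OF X \<omega> t]]) auto
    from filterlim_compose[OF this right]
    show ?thesis by (simp add: t_def u_def)
  qed
  show ?thesis by (rule borel_measurable_LIMSEQ_real[OF lim meas])
qed

lemma history_subalgebra:
  assumes X: "exclusion_process q \<mu> M X"
  shows "subalgebra M (history M X s)"
    and "0 \<le> u \<Longrightarrow> u \<le> s \<Longrightarrow> X u \<in> measurable (history M X s) config_algebra"
proof -
  let ?G = "{X u -` B \<inter> space M | u B. 0 \<le> u \<and> u \<le> s \<and> B \<in> sets config_algebra}"
  have sub: "?G \<subseteq> Pow (space M)" by auto
  have sp: "space (history M X s) = space M"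
    unfolding history_def using sub by (rule space_measure_of)
  have se: "sets (history M X s) = sigma_sets (space M) ?G"
    unfolding history_def using sub by (rule sets_measure_of)
  have "?G \<subseteq> sets M" using exclusion_processD(2)[OF X] by (auto intro: measurable_sets)
  then have "sigma_sets (space M) ?G \<subseteq> sets M" by (rule sets.sigma_sets_subset)
  then show "subalgebra M (history M X s)" by (simp add: subalgebra_def sp se)
  assume u: "0 \<le> u" "u \<le> s"
  show "X u \<in> measurable (history M X s) config_algebra"
  proof (rule measurableI)
    show "X u \<omega> \<in> space config_algebra" if "\<omega> \<in> space (history M X s)" for \<omega>
      using measurable_space[OF exclusion_processD(2)[OF X u(1)]] that sp by simp
    show "X u -` B \<inter> space (history M X s) \<in> sets (history M X s)" if "B \<in> sets config_algebra" for B
      unfolding sp se using u that by (intro sigma_sets.Basic) auto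
  qed
qed

text \<open>The factor at time \<open>s\<close> is measurable for the history up to \<open>s\<close>
  and can be pulled into the conditional expectation.\<close>

lemma exclusion_process_markov:
  fixes g h :: "'d::finite config \<Rightarrow>\<^sub>C real"
  assumes X: "exclusion_process q \<mu> M X" and st: "0 \<le> s" "0 \<le> t"
    and markov: "AE \<omega> in M. real_cond_exp M (history M X s) (\<lambda>\<omega>'. apply_bcontfun g (X (s + t) \<omega>')) \<omega> =
             apply_bcontfun (S t g) (X s \<omega>)"
  shows "(LINT \<omega>|M. apply_bcontfun h (X s \<omega>) * apply_bcontfun g (X (s + t) \<omega>))
    = (LINT \<omega>|M. apply_bcontfun h (X s \<omega>) * apply_bcontfun (S t g) (X s \<omega>))"
proof -
  interpret M: prob_space M by (rule exclusion_processD(1)[OF X])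
  interpret H: finite_measure_subalgebra M "history M X s"
    by unfold_locales (rule history_subalgebra(1)[OF X])
  have meas: "(\<lambda>\<omega>. apply_bcontfun u (X r \<omega>)) \<in> borel_measurable M" if "0 \<le> r" for u :: "'d config \<Rightarrow>\<^sub>C real" and r
    by (rule measurable_compose[OF exclusion_processD(2)[OF X that] continuous_config_measurable]) simp
  have measH: "(\<lambda>\<omega>. apply_bcontfun h (X s \<omega>)) \<in> borel_measurable (history M X s)"
    by (rule measurable_compose[OF history_subalgebra(2)[OF X st(1) order_refl] continuous_config_measurable]) simp
  have st': "0 \<le> s + t" using st by simp
  have int: "integrable M (\<lambda>\<omega>. apply_bcontfun h (X s \<omega>) * apply_bcontfun g (X (s + t) \<omega>))"
  proof (rule M.integrable_const_bound[of _ "norm h * norm g"])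
    show "AE \<omega> in M. norm (apply_bcontfun h (X s \<omega>) * apply_bcontfun g (X (s + t) \<omega>)) \<le> norm h * norm g"
      unfolding norm_mult by (intro AE_I2 mult_mono norm_bounded) auto
  qed (intro borel_measurable_times meas st st')
  have "(LINT \<omega>|M. apply_bcontfun h (X s \<omega>) * apply_bcontfun g (X (s + t) \<omega>))
      = (LINT \<omega>|M. apply_bcontfun h (X s \<omega>) * real_cond_exp M (history M X s) (\<lambda>\<omega>'. apply_bcontfun g (X (s + t) \<omega>')) \<omega>)"
    by (rule H.real_cond_exp_intg(2)[OF int measH meas[OF st'], symmetric])
  also have "\<dots> = (LINT \<omega>|M. apply_bcontfun h (X s \<omega>) * apply_bcontfun (S t g) (X s \<omega>))"
  proof (rule integral_cong_AE)
    show "(\<lambda>\<omega>. apply_bcontfun h (X s \<omega>) * real_cond_exp M (history M X s) (\<lambda>\<omega>'. apply_bcontfun g (X (s + t) \<omega>')) \<omega>) \<in> borel_measurable M"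
      by (intro borel_measurable_times meas[OF st(1)] borel_measurable_cond_exp2)
    show "(\<lambda>\<omega>. apply_bcontfun h (X s \<omega>) * apply_bcontfun (S t g) (X s \<omega>)) \<in> borel_measurable M"
      by (intro borel_measurable_times meas[OF st(1)])
    show "AE \<omega> in M. apply_bcontfun h (X s \<omega>) * real_cond_exp M (history M X s) (\<lambda>\<omega>'. apply_bcontfun g (X (s + t) \<omega>')) \<omega>
        = apply_bcontfun h (X s \<omega>) * apply_bcontfun (S t g) (X s \<omega>)"
      using markov by eventually_elim simp
  qed
  finally show ?thesis .
qed

context exchangeable
begin

text \<open>The Markov property at time \<open>r\<close> and then at time 0 expresses
  \<open>corr r (r + h)\<close> by the semigroup and the initial law. The transform in
  \<open>r\<close> contributes \<open>1 / l\<close> by invariance, which turns the prefactor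
  \<open>2 / l\<close> into \<open>2 / l^2\<close>.\<close>

lemma variance_laplace_eq:
  fixes f :: "'d config \<Rightarrow> real"
  assumes X: "exclusion_process q \<mu> M X" and q: "jump_probability q" and dense: "\<And>l. 0 < l \<Longrightarrow> resolvent_dense q l"
    and f: "local_function f"
  obtains S where "exclusion_semigroup q S"
    "\<And>l. 0 < l \<Longrightarrow> variance_laplace M X f l
      = 2 / l\<^sup>2 * laplace l (\<lambda>t. expectation (\<lambda>\<eta>. f \<eta> * apply_bcontfun (S t (Bcontfun f)) \<eta>))"
proof -
  obtain S where S: "exclusion_semigroup q S"
    and markov: "\<And>s t g. 0 \<le> s \<Longrightarrow> 0 \<le> t \<Longrightarrow>
       AE \<omega> in M. real_cond_exp M (history M X s) (\<lambda>\<omega>'. apply_bcontfun g (X (s + t) \<omega>')) \<omega> =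
         apply_bcontfun (S t g) (X s \<omega>)"
    using X unfolding exclusion_process_def by blast
  have fc: "continuous_on UNIV f" using f by (rule local_function_continuous)
  obtain C where C: "0 < C" "\<And>\<eta>. \<bar>f \<eta>\<bar> \<le> C" using local_function_bounded[OF f] by blast
  \<comment> \<open>Freezing the path at negative times gives a process on all of the real line
    without affecting integrals over \<open>{0..t}\<close>.\<close>
  define Z where "Z = (\<lambda>r \<omega>. f (X (max r 0) \<omega>))"
  interpret Z: bounded_process M Z C
    by (intro bounded_process.intro bounded_process_axioms.intro exclusion_processD(1)[OF X])
       (simp_all add: Z_def C exclusion_process_jointly_measurable[OF X fc])
  have corr: "Z.corr r (r + h) = expectation (apply_bcontfun (S r (Bcontfun (\<lambda>\<eta>. f \<eta> * apply_bcontfun (S h (Bcontfun f)) \<eta>))))"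
    if r: "0 \<le> r" and h: "0 \<le> h" for r h
  proof -
    let ?F = "Bcontfun (\<lambda>\<eta>. f \<eta> * apply_bcontfun (S h (Bcontfun f)) \<eta>)"
    have "continuous_on UNIV (\<lambda>\<eta>. f \<eta> * apply_bcontfun (S h (Bcontfun f)) \<eta>)"
      using fc by (intro continuous_on_mult continuous_on_apply_bcontfun)
    then have F: "apply_bcontfun ?F = (\<lambda>\<eta>. f \<eta> * apply_bcontfun (S h (Bcontfun f)) \<eta>)"
      by (rule Bcontfun_inverse[OF continuous_bcontfun])
    have "Z.corr r (r + h) = (LINT \<omega>|M. apply_bcontfun (Bcontfun f) (X r \<omega>) * apply_bcontfun (Bcontfun f) (X (r + h) \<omega>))"
      unfolding Z.corr_def using r h f by (simp add: Z_def)
    also have "\<dots> = (LINT \<omega>|M. apply_bcontfun (Bcontfun f) (X r \<omega>) * apply_bcontfun (S h (Bcontfun f)) (X r \<omega>))"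
      by (rule exclusion_process_markov[where S = S, OF X r h], rule markov[OF r h])
    \<comment> \<open>The constant 1 serves as the factor at time 0, so that the two-time identity
      also evaluates a one-time expectation.\<close>
    also have "\<dots> = (LINT \<omega>|M. apply_bcontfun (const_bcontfun 1) (X 0 \<omega>) * apply_bcontfun ?F (X (0 + r) \<omega>))"
      using f by (simp add: F const_bcontfun.rep_eq)
    also have "\<dots> = (LINT \<omega>|M. apply_bcontfun (const_bcontfun 1) (X 0 \<omega>) * apply_bcontfun (S r ?F) (X 0 \<omega>))"
      by (rule exclusion_process_markov[where S = S, OF X order_refl r], rule markov[OF order_refl r])
    also have "\<dots> = (LINT \<omega>|M. apply_bcontfun (S r ?F) (X 0 \<omega>))" by (simp add: const_bcontfun.rep_eq)
    also have "\<dots> = integral\<^sup>L (distr M \<mu> (X 0)) (apply_bcontfun (S r ?F))"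
    proof (rule integral_distr [symmetric])
      show "X 0 \<in> measurable M \<mu>"
        unfolding measurable_cong_sets[OF refl sets_eq] by (rule exclusion_processD(2)[OF X order_refl])
      show "apply_bcontfun (S r ?F) \<in> borel_measurable \<mu>"
        unfolding measurable_eq by (rule continuous_config_measurable) simp
    qed
    finally show ?thesis unfolding exclusion_processD(4)[OF X] .
  qed
  have "variance_laplace M X f l
      = 2 / l\<^sup>2 * laplace l (\<lambda>t. expectation (\<lambda>\<eta>. f \<eta> * apply_bcontfun (S t (Bcontfun f)) \<eta>))" if l: "0 < l" for l
  proof -
    have "additive_functional X f t \<omega> = (LINT s|lborel. indicator {0..t} s * Z s \<omega>)" for t \<omega>
      unfolding additive_functional_def set_lebesgue_integral_def
      by (rule Bochner_Integration.integral_cong) (auto simp: Z_def indicator_def)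
    then have "variance_laplace M X f l = laplace l (\<lambda>t. Z.expectation (\<lambda>\<omega>. (LINT s|lborel. indicator {0..t} s * Z s \<omega>)\<^sup>2))"
      unfolding variance_laplace_def additive_variance_def set_lebesgue_integral_def laplace_def
      by (simp add: mult.assoc)
    also have "\<dots> = 2 / l * laplace l (\<lambda>h. laplace l (\<lambda>r. Z.corr r (r + h)))"
      by (rule Z.laplace_additive_square[OF l])
    also have "laplace l (\<lambda>h. laplace l (\<lambda>r. Z.corr r (r + h)))
        = laplace l (\<lambda>h. expectation (\<lambda>\<eta>. f \<eta> * apply_bcontfun (S h (Bcontfun f)) \<eta>) / l)"
    proof (rule laplace_cong)
      fix h :: real assume h: "0 \<le> h"
      let ?F = "Bcontfun (\<lambda>\<eta>. f \<eta> * apply_bcontfun (S h (Bcontfun f)) \<eta>)"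
      have "continuous_on UNIV (\<lambda>\<eta>. f \<eta> * apply_bcontfun (S h (Bcontfun f)) \<eta>)"
        using fc by (intro continuous_on_mult continuous_on_apply_bcontfun)
      then have F: "apply_bcontfun ?F = (\<lambda>\<eta>. f \<eta> * apply_bcontfun (S h (Bcontfun f)) \<eta>)"
        by (rule Bcontfun_inverse[OF continuous_bcontfun])
      have "laplace l (\<lambda>r. Z.corr r (r + h)) = laplace l (\<lambda>r. expectation (apply_bcontfun (S r ?F)))"
        by (rule laplace_cong) (rule corr[OF _ h])
      also have "\<dots> = expectation (apply_bcontfun ?F) / l"
        by (rule laplace_expectation_semigroup[OF q dense[OF l] S l])
      finally show "laplace l (\<lambda>r. Z.corr r (r + h)) = expectation (\<lambda>\<eta>. f \<eta> * apply_bcontfun (S h (Bcontfun f)) \<eta>) / l"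
        unfolding F .
    qed
    also have "\<dots> = laplace l (\<lambda>h. expectation (\<lambda>\<eta>. f \<eta> * apply_bcontfun (S h (Bcontfun f)) \<eta>)) / l"
      unfolding laplace_def by simp
    finally show ?thesis by (simp add: power2_eq_square)
  qed
  with S show ?thesis by (rule that)
qed

text \<open>Only one inequality is stated; the other follows by exchanging the two laws and
  replacing \<open>c\<close> by \<open>1 / c\<close>.\<close>

lemma laplace_compare:
  fixes q q' :: "int ^ 'd \<Rightarrow> real"
  assumes q: "jump_probability q" "second_moment q" "coercive q" and dense: "\<And>l. 0 < l \<Longrightarrow> resolvent_dense q l"
      "\<And>l. 0 < l \<Longrightarrow> resolvent_dense (reversed q) l"
    and q': "jump_probability q'" "second_moment q'" "coercive q'" and dense': "\<And>l. 0 < l \<Longrightarrow> resolvent_dense q' l"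
    and c: "c \<noteq> 0"
    and mean: "\<And>i. ((\<lambda>y. q y * real_of_int (y $ i)) has_sum c * m i) UNIV"
    and mean': "\<And>i. ((\<lambda>y. q' y * real_of_int (y $ i)) has_sum m i) UNIV"
    and S: "exclusion_semigroup q S" and S': "exclusion_semigroup q' S'" and f: "local_function f"
  obtains K where "0 < K" "\<And>l. 0 < l \<Longrightarrow>
    laplace l (\<lambda>t. expectation (\<lambda>\<eta>. f \<eta> * apply_bcontfun (S' t (Bcontfun f)) \<eta>))
    \<le> K * laplace l (\<lambda>t. expectation (\<lambda>\<eta>. f \<eta> * apply_bcontfun (S t (Bcontfun f)) \<eta>))"
proof (cases "0 < c")
  case True
  obtain K where K: "0 < K" "\<And>l f g h a b. 0 < l \<Longrightarrow> local_function f \<Longrightarrow>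
      resolvent_seq q l f g \<Longrightarrow> resolvent_seq q' l f h \<Longrightarrow>
      (\<lambda>n. expectation (\<lambda>\<eta>. g n \<eta> * f \<eta>)) \<longlonglongrightarrow> a \<Longrightarrow>
      (\<lambda>n. expectation (\<lambda>\<eta>. h n \<eta> * f \<eta>)) \<longlonglongrightarrow> b \<Longrightarrow> b \<le> K * a"
    by (rule resolvent_compare[OF q q' True mean mean']) (rule that)
  show ?thesis
  proof (rule that[OF K(1)])
    fix l :: real assume l: "0 < l"
    obtain g where g: "resolvent_seq q l f g" using resolvent_seq_exists[OF dense(1)[OF l] f] .
    obtain h where h: "resolvent_seq q' l f h" using resolvent_seq_exists[OF dense'[OF l] f] .
    show "laplace l (\<lambda>t. expectation (\<lambda>\<eta>. f \<eta> * apply_bcontfun (S' t (Bcontfun f)) \<eta>))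
        \<le> K * laplace l (\<lambda>t. expectation (\<lambda>\<eta>. f \<eta> * apply_bcontfun (S t (Bcontfun f)) \<eta>))"
      by (rule K(2)[OF l f g h resolvent_seq_limit[OF q(1) S l f g] resolvent_seq_limit[OF q'(1) S' l f h]])
  qed
next
  case False
  \<comment> \<open>Reversing \<open>q\<close> changes the sign of its mean, so the positive factor
    \<open>- c\<close> is available; \<open>resolvent_reversed\<close> shows that the limit for
    \<open>f\<close> stays the same.\<close>
  then have c': "0 < - c" using c by simp
  have rmean: "((\<lambda>y. reversed q y * real_of_int (y $ i)) has_sum (- c) * m i) UNIV" for i
  proof -
    have "((\<lambda>y. - (q y * real_of_int (y $ i))) has_sum - (c * m i)) UNIV"
      using mean by (rule has_sum_uminusI)
    then show ?thesis
      using has_sum_uminus_lattice[of "\<lambda>y. - (q y * real_of_int (y $ i))" "- (c * m i)"]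
      by (simp add: reversed_def)
  qed
  note rq = jump_probability_reversed[OF q(1)] second_moment_reversed[OF q(2)] coercive_reversed[OF q(1) q(3)]
  obtain K where K: "0 < K" "\<And>l f g h a b. 0 < l \<Longrightarrow> local_function f \<Longrightarrow>
      resolvent_seq (reversed q) l f g \<Longrightarrow> resolvent_seq q' l f h \<Longrightarrow>
      (\<lambda>n. expectation (\<lambda>\<eta>. g n \<eta> * f \<eta>)) \<longlonglongrightarrow> a \<Longrightarrow>
      (\<lambda>n. expectation (\<lambda>\<eta>. h n \<eta> * f \<eta>)) \<longlonglongrightarrow> b \<Longrightarrow> b \<le> K * a"
    by (rule resolvent_compare[OF rq q' c' rmean mean']) (rule that)
  show ?thesis
  proof (rule that[OF K(1)])
    fix l :: real assume l: "0 < l"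
    obtain g where g: "resolvent_seq q l f g" using resolvent_seq_exists[OF dense(1)[OF l] f] .
    obtain k where k: "resolvent_seq (reversed q) l f k" using resolvent_seq_exists[OF dense(2)[OF l] f] .
    obtain h where h: "resolvent_seq q' l f h" using resolvent_seq_exists[OF dense'[OF l] f] .
    show "laplace l (\<lambda>t. expectation (\<lambda>\<eta>. f \<eta> * apply_bcontfun (S' t (Bcontfun f)) \<eta>))
        \<le> K * laplace l (\<lambda>t. expectation (\<lambda>\<eta>. f \<eta> * apply_bcontfun (S t (Bcontfun f)) \<eta>))"
      by (rule K(2)[OF l f k h resolvent_reversed[OF q(1) l f g k resolvent_seq_limit[OF q(1) S l f g]]
            resolvent_seq_limit[OF q'(1) S' l f h]])
  qed
qed

end

section \<open>Moments of the jump probabilities\<close>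

text \<open>The norm is a nonnegative integer. Thus a finite second moment implies a finite first
  moment.\<close>

lemma norm1_le_power2: "norm1 y \<le> (norm1 y)\<^sup>2"
proof -
  define k where "k = (\<Sum>i\<in>UNIV. \<bar>y $ i\<bar>)"
  have k: "norm1 y = real_of_int k" by (simp add: norm1_def k_def)
  have "0 \<le> k" by (simp add: k_def sum_nonneg)
  then have "k \<le> k * k" by (cases "k = 0") (auto simp: mult_le_cancel_left1)
  then show ?thesis unfolding k power2_eq_square of_int_mult [symmetric] of_int_le_iff .
qed

lemma second_moment_first_moment:
  assumes q: "jump_probability q" and m: "second_moment q"
  shows "(\<lambda>y. q y * norm1 y) summable_on UNIV"
proof (rule summable_on_comparison_test)
  show "(\<lambda>y. q y * (norm1 y)\<^sup>2) summable_on UNIV" using m by (simp add: second_moment_def)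
qed (use q norm1_le_power2 in \<open>auto simp: jump_probability_def intro: mult_left_mono\<close>)

lemma norm_lattice_embed_le: "norm (lattice_embed y) \<le> norm1 y"
  using norm_le_l1_cart[of "lattice_embed y"] by (simp add: lattice_embed_def norm1_def)

lemma norm_lattice_embed_ge_1:
  assumes "y \<noteq> 0" shows "1 \<le> norm (lattice_embed y)"
proof -
  obtain j where "y $ j \<noteq> 0" using assms by (auto simp: vec_eq_iff)
  then have "1 \<le> real_of_int \<bar>y $ j\<bar>" by linarith
  also have "\<dots> \<le> norm (lattice_embed y)"
    using component_le_norm_cart[of "lattice_embed y" j] by (simp add: lattice_embed_def)
  finally show ?thesis .
qed

lemma norm1_le_norm_lattice_embed:
  fixes y :: "int ^ 'd"
  shows "norm1 y \<le> real CARD('d) * norm (lattice_embed y)"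
proof -
  have "real_of_int \<bar>y $ i\<bar> \<le> norm (lattice_embed y)" for i
    using component_le_norm_cart[of "lattice_embed y" i] by (simp add: lattice_embed_def)
  then have "norm1 y \<le> (\<Sum>i\<in>(UNIV :: 'd set). norm (lattice_embed y))"
    unfolding norm1_def by (intro sum_mono)
  then show ?thesis by simp
qed

lemma mean_jump_has_sum:
  fixes q :: "int ^ 'd \<Rightarrow> real"
  assumes q: "jump_probability q" and m: "second_moment q"
  shows "((\<lambda>y. q y * real_of_int (y $ i)) has_sum mean_jump q $ i) UNIV"
proof -
  have q0: "0 \<le> q y" for y using q by (simp add: jump_probability_def)
  have "(\<lambda>y. norm (q y *\<^sub>R lattice_embed y)) summable_on UNIV"
    by (rule summable_on_comparison_test[OF second_moment_first_moment[OF q m]])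
       (simp_all add: q0 norm_lattice_embed_le mult_left_mono)
  then have "(\<lambda>y. q y *\<^sub>R lattice_embed y) summable_on UNIV" by (rule Infinite_Sum.abs_summable_summable)
  then have "((\<lambda>y. q y *\<^sub>R lattice_embed y) has_sum mean_jump q) UNIV"
    unfolding mean_jump_def by (rule has_sum_infsum)
  from has_sum_bounded_linear[OF bounded_linear_vec_nth this, of i]
  show ?thesis by (simp add: lattice_embed_def)
qed

lemma FR_second_moment:
  fixes q :: "int ^ 'd \<Rightarrow> real"
  assumes "FR_jump_probability q" shows "second_moment q"
proof -
  obtain R where R: "\<And>y. R < norm (lattice_embed y) \<Longrightarrow> q y = 0"
    using assms unfolding FR_jump_probability_def by blast
  have "{y. q y * (norm1 y)\<^sup>2 \<noteq> 0} \<subseteq> {y. norm1 y \<le> real CARD('d) * R}"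
  proof
    fix y assume "y \<in> {y. q y * (norm1 y)\<^sup>2 \<noteq> 0}"
    then have "norm (lattice_embed y) \<le> R" using R[of y] by force
    then have "real CARD('d) * norm (lattice_embed y) \<le> real CARD('d) * R" by (rule mult_left_mono) simp
    with norm1_le_norm_lattice_embed have "norm1 y \<le> real CARD('d) * R" by (rule order_trans)
    then show "y \<in> {y. norm1 y \<le> real CARD('d) * R}" by simp
  qed
  then have "finite {y. q y * (norm1 y)\<^sup>2 \<noteq> 0}" using finite_norm1_le by (rule finite_subset)
  then show ?thesis
    unfolding second_moment_def by (intro summable_finite_support[where F = "{y. q y * (norm1 y)\<^sup>2 \<noteq> 0}"]) auto
qed

lemma summable_int_powr:
  assumes s: "1 < s"
  obtains B where "0 \<le> B" "\<And>n. (\<Sum>k\<in>{- int n..int n}. max 1 (real_of_int \<bar>k\<bar>) powr (- s)) \<le> B"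
proof -
  have summ: "summable (\<lambda>n. real n powr (- s))" using s by (simp add: summable_real_powr_iff)
  define T where "T = (\<Sum>n. real n powr (- s))"
  have le: "(\<Sum>k\<in>{1..n}. real k powr (- s)) \<le> T" for n
    unfolding T_def by (rule sum_le_suminf[OF summ]) auto
  have "(\<Sum>k\<in>{- int n..int n}. max 1 (real_of_int \<bar>k\<bar>) powr (- s)) \<le> 1 + 2 * T" for n
  proof -
    have split: "{- int n..int n} = insert 0 (int ` {1..n} \<union> (\<lambda>k. - int k) ` {1..n})"
    proof (intro equalityI subsetI)
      fix k assume k: "k \<in> {- int n..int n}"
      consider "k = 0" | "0 < k" | "k < 0" by linarith
      then show "k \<in> insert 0 (int ` {1..n} \<union> (\<lambda>k. - int k) ` {1..n})"
      proof cases
        case 2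
        then have "k = int (nat k)" "nat k \<in> {1..n}" using k by auto
        then show ?thesis by blast
      next
        case 3
        then have "k = - int (nat (- k))" "nat (- k) \<in> {1..n}" using k by auto
        then show ?thesis by blast
      qed simp
    qed auto
    have "(\<Sum>k\<in>{- int n..int n}. max 1 (real_of_int \<bar>k\<bar>) powr (- s))
        = 1 + ((\<Sum>k\<in>int ` {1..n}. max 1 (real_of_int \<bar>k\<bar>) powr (- s))
          + (\<Sum>k\<in>(\<lambda>k. - int k) ` {1..n}. max 1 (real_of_int \<bar>k\<bar>) powr (- s)))"
      unfolding split by (subst sum.insert, simp, force, subst sum.union_disjoint) auto
    also have "(\<Sum>k\<in>int ` {1..n}. max 1 (real_of_int \<bar>k\<bar>) powr (- s)) = (\<Sum>k\<in>{1..n}. real k powr (- s))"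
      by (subst sum.reindex) (auto simp: inj_on_def max_def intro!: sum.cong)
    also have "(\<Sum>k\<in>(\<lambda>k. - int k) ` {1..n}. max 1 (real_of_int \<bar>k\<bar>) powr (- s)) = (\<Sum>k\<in>{1..n}. real k powr (- s))"
      by (subst sum.reindex) (auto simp: inj_on_def max_def intro!: sum.cong)
    finally show ?thesis using le[of n] by simp
  qed
  moreover have "0 \<le> T" unfolding T_def by (rule suminf_nonneg[OF summ]) simp
  ultimately show ?thesis by (intro that[of "1 + 2 * T"]) auto
qed

text \<open>Since \<open>|y| \<ge> max 1 |y\<^sub>i|\<close> for every \<open>i\<close>, the power of \<open>|y|\<close> is bounded by a product of
  one-dimensional summable functions.\<close>

lemma summable_lattice_powr:
  assumes b: "0 < b"
  shows "(\<lambda>y :: int ^ 'd. of_bool (y \<noteq> 0) * norm (lattice_embed y) powr (- (real CARD('d) + b))) summable_on UNIV"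
proof -
  \<comment> \<open>The exponent \<open>d + b\<close> is shared equally among the d coordinates:
    \<open>d s = d + b\<close>, and \<open>s > 1\<close> makes each one-dimensional sum
    converge.\<close>
  define s where "s = 1 + b / real CARD('d)"
  have d: "0 < real CARD('d)" by simp
  have s: "1 < s" using b d by (simp add: s_def)
  obtain B where B: "0 \<le> B" "\<And>n. (\<Sum>k\<in>{- int n..int n}. max 1 (real_of_int \<bar>k\<bar>) powr (- s)) \<le> B"
    using summable_int_powr[OF s] by blast
  define g where "g = (\<lambda>y :: int ^ 'd. \<Prod>i\<in>UNIV. max 1 (real_of_int \<bar>y $ i\<bar>) powr (- s))"
  have g0: "0 \<le> g y" for y unfolding g_def by (intro prod_nonneg) auto
  have "g summable_on UNIV"
  proof (rule nonneg_bdd_above_summable_on)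
    show "bdd_above (sum g ` {F. F \<subseteq> UNIV \<and> finite F})"
    proof (rule bdd_aboveI2)
      fix F :: "(int ^ 'd) set" assume "F \<in> {F. F \<subseteq> UNIV \<and> finite F}"
      then have F: "finite F" by simp
      define n where "n = nat (Max (insert 0 ((\<lambda>(y, i). \<bar>y $ i\<bar>) ` (F \<times> UNIV))))"
      have n: "\<bar>y $ i\<bar> \<le> int n" if "y \<in> F" for y i
      proof -
        have "\<bar>y $ i\<bar> \<le> Max (insert 0 ((\<lambda>(y, i). \<bar>y $ i\<bar>) ` (F \<times> UNIV)))"
          using F that by (intro Max_ge) auto
        then show ?thesis unfolding n_def by linarith
      qed
      \<comment> \<open>A cube containing \<open>F\<close>. Over a cube the sum of the product
        factorizes into one-dimensional sums.\<close>
      let ?P = "(UNIV :: 'd set) \<rightarrow>\<^sub>E {- int n..int n}"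
      have sub: "F \<subseteq> vec_lambda ` ?P"
      proof
        fix y assume y: "y \<in> F"
        have "y $ i \<in> {- int n..int n}" for i using n[OF y, of i] by auto
        then have "vec_nth y \<in> ?P" by auto
        then show "y \<in> vec_lambda ` ?P" by (intro image_eqI[of _ _ "vec_nth y"]) (simp_all add: vec_nth_inverse)
      qed
      have fin: "finite ?P" by (intro finite_PiE) auto
      have "sum g F \<le> sum g (vec_lambda ` ?P)"
        by (rule sum_mono2[OF finite_imageI[OF fin] sub]) (rule g0)
      also have "\<dots> = (\<Sum>h\<in>?P. \<Prod>i\<in>UNIV. max 1 (real_of_int \<bar>h i\<bar>) powr (- s))"
        by (subst sum.reindex) (auto simp: inj_on_def vec_lambda_inject g_def)
      also have "\<dots> = (\<Prod>i\<in>(UNIV :: 'd set). \<Sum>k\<in>{- int n..int n}. max 1 (real_of_int \<bar>k\<bar>) powr (- s))"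
        by (rule prod_sum_PiE [symmetric]) auto
      also have "\<dots> \<le> (\<Prod>i\<in>(UNIV :: 'd set). B)"
        by (intro prod_mono conjI sum_nonneg B) auto
      finally show "sum g F \<le> (\<Prod>i\<in>(UNIV :: 'd set). B)" .
    qed
  qed (rule g0)
  then show ?thesis
  proof (rule summable_on_comparison_test)
    fix y :: "int ^ 'd"
    show "of_bool (y \<noteq> 0) * norm (lattice_embed y) powr (- (real CARD('d) + b)) \<le> g y"
    proof (cases "y = 0")
      case False
      then have one: "1 \<le> norm (lattice_embed y)" by (rule norm_lattice_embed_ge_1)
      have comp: "real_of_int \<bar>y $ i\<bar> \<le> norm (lattice_embed y)" for i
        using component_le_norm_cart[of "lattice_embed y" i] by (simp add: lattice_embed_def)
      have "norm (lattice_embed y) powr (- (real CARD('d) + b)) = norm (lattice_embed y) powr (- s * real CARD('d))"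
      proof -
        have "- s * real CARD('d) = - (real CARD('d) + b)" using d by (simp add: s_def left_diff_distrib)
        then show ?thesis by (simp only:)
      qed
      also have "\<dots> = (\<Prod>i\<in>(UNIV :: 'd set). norm (lattice_embed y) powr (- s))"
      proof -
        have "lattice_embed y \<noteq> 0" using one by auto
        then have "0 < norm (lattice_embed y) powr (- s)" by simp
        from powr_realpow[OF this, of "CARD('d)"] show ?thesis by (simp add: powr_powr)
      qed
      also have "\<dots> \<le> g y"
        unfolding g_def using comp one s by (intro prod_mono conjI powr_mono2') auto
      finally show ?thesis using False by simp
    qed (simp add: g0)
  qed auto
qed

text \<open>The directional factor is bounded, so the summand is at most a constant times
  \<open>|y|\<close> to the power \<open>- (d + (\<alpha> - 2))\<close>, which is summable for
  \<alpha> > 2. The square of d in \<open>D\<close> comes from comparing the l1 norm with the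
  Euclidean one.\<close>

lemma LA_second_moment:
  fixes p :: "int ^ 'd \<Rightarrow> real"
  assumes p: "LA_jump_probability \<alpha> p" and \<alpha>: "2 < \<alpha>" shows "second_moment p"
proof -
  obtain c bp bm where pos: "\<And>i. 0 < bp i \<and> 0 < bm i"
    and eq: "\<And>y. y \<noteq> 0 \<Longrightarrow> p y = c / norm (lattice_embed y) powr (real CARD('d) + \<alpha>) *
             (\<Sum>i\<in>UNIV. bp i * of_bool (0 < y $ i) + bm i * of_bool (y $ i < 0))"
    and jp: "jump_probability p"
    using p unfolding LA_jump_probability_def by blast
  define D where "D = \<bar>c\<bar> * (\<Sum>i\<in>UNIV. bp i + bm i) * (real CARD('d))\<^sup>2"
  let ?g = "\<lambda>y :: int ^ 'd. of_bool (y \<noteq> 0) * norm (lattice_embed y) powr (- (real CARD('d) + (\<alpha> - 2)))"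
  have "(\<lambda>y. D * ?g y) summable_on UNIV"
    using \<alpha> by (intro summable_on_cmult_right summable_lattice_powr) simp
  then show ?thesis
    unfolding second_moment_def
  proof (rule summable_on_comparison_test)
    fix y :: "int ^ 'd"
    show "0 \<le> p y * (norm1 y)\<^sup>2" using jp by (simp add: jump_probability_def)
    show "p y * (norm1 y)\<^sup>2 \<le> D * ?g y"
    proof (cases "y = 0")
      case False
      define r where "r = norm (lattice_embed y)"
      have r: "0 < r" unfolding r_def using norm_lattice_embed_ge_1[OF False] by linarith
      define b where "b = (\<Sum>i\<in>UNIV. bp i * of_bool (0 < y $ i) + bm i * of_bool (y $ i < 0))"
      have b: "0 \<le> b" "b \<le> (\<Sum>i\<in>UNIV. bp i + bm i)"
        unfolding b_def using pos
        by (auto intro!: sum_nonneg sum_mono add_nonneg_nonneg add_mono simp: less_imp_le)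
      have "p y = c * b / r powr (real CARD('d) + \<alpha>)" using eq[OF False] by (simp add: r_def b_def)
      also have "\<dots> \<le> \<bar>c\<bar> * (\<Sum>i\<in>UNIV. bp i + bm i) / r powr (real CARD('d) + \<alpha>)"
        using b by (intro divide_right_mono mult_mono) auto
      finally have py: "p y \<le> \<bar>c\<bar> * (\<Sum>i\<in>UNIV. bp i + bm i) / r powr (real CARD('d) + \<alpha>)" .
      have "norm1 y \<le> real CARD('d) * r" unfolding r_def by (rule norm1_le_norm_lattice_embed)
      then have "(norm1 y)\<^sup>2 \<le> (real CARD('d) * r)\<^sup>2" by (rule power_mono) simp
      then have "p y * (norm1 y)\<^sup>2 \<le> \<bar>c\<bar> * (\<Sum>i\<in>UNIV. bp i + bm i) / r powr (real CARD('d) + \<alpha>) * (real CARD('d) * r)\<^sup>2"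
        using py jp b by (intro mult_mono) (auto simp: jump_probability_def)
      also have "\<dots> = D * (r powr 2 / r powr (real CARD('d) + \<alpha>))"
        using r by (simp add: D_def power_mult_distrib powr_numeral)
      also have "r powr 2 / r powr (real CARD('d) + \<alpha>) = r powr (- (real CARD('d) + (\<alpha> - 2)))"
        unfolding powr_diff [symmetric] by (simp add: algebra_simps)
      finally show ?thesis using False by (simp add: r_def)
    qed (simp add: norm1_def)
  qed
qed

text \<open>Every nonzero jump has positive probability, so any two sites are joined by at most one
  step.\<close>

lemma LA_irreducible:
  fixes p :: "int ^ 'd \<Rightarrow> real"
  assumes p: "LA_jump_probability \<alpha> p" shows "irreducible_jumps (symmetric_part p)"
proof -
  obtain c bp bm where pos: "\<And>i. 0 < bp i \<and> 0 < bm i"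
    and eq: "\<And>y. y \<noteq> 0 \<Longrightarrow> p y = c / norm (lattice_embed y) powr (real CARD('d) + \<alpha>) *
             (\<Sum>i\<in>UNIV. bp i * of_bool (0 < y $ i) + bm i * of_bool (y $ i < 0))"
    and jp: "jump_probability p"
    using p unfolding LA_jump_probability_def by blast
  let ?b = "\<lambda>y :: int ^ 'd. \<Sum>i\<in>UNIV. bp i * of_bool (0 < y $ i) + bm i * of_bool (y $ i < 0)"
  have b0: "0 \<le> ?b y" for y
    using pos by (auto intro!: sum_nonneg add_nonneg_nonneg simp: less_imp_le)
  \<comment> \<open>Otherwise \<open>p\<close> would be nonpositive and hence identically 0, against
    total mass 1.\<close>
  have c: "0 < c"
  proof (rule ccontr)
    assume "\<not> 0 < c"
    then have "p y \<le> 0" for y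
      using eq[of y] b0[of y] jp by (cases "y = 0") (auto simp: jump_probability_def mult_nonpos_nonneg divide_nonpos_nonneg)
    moreover have "0 \<le> p y" for y using jp by (simp add: jump_probability_def)
    ultimately have "p = (\<lambda>_. 0)" by (intro ext antisym)
    then have "((\<lambda>_ :: int ^ 'd. 0) has_sum (1 :: real)) UNIV" using jp by (simp add: jump_probability_def)
    from has_sum_unique[OF this has_sum_0_simp] show False by simp
  qed
  have p_pos: "0 < p y" if y: "y \<noteq> 0" for y
  proof -
    obtain j where j: "y $ j \<noteq> 0" using y by (auto simp: vec_eq_iff)
    have "0 < ?b y"
    proof (rule sum_pos2[of _ j])
      show "0 < bp j * of_bool (0 < y $ j) + bm j * of_bool (y $ j < 0)"
        using pos[of j] j by (cases "0 < y $ j") auto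
      show "0 \<le> bp i * of_bool (0 < y $ i) + bm i * of_bool (y $ i < 0)" for i
        using pos[of i] by (auto simp: less_imp_le)
    qed auto
    moreover have "0 < norm (lattice_embed y)"
      using norm_lattice_embed_ge_1[OF y] by linarith
    ultimately show ?thesis unfolding eq[OF y] using c by (intro mult_pos_pos divide_pos_pos) auto
  qed
  show ?thesis
    unfolding irreducible_jumps_def
  proof (intro allI)
    fix x y :: "int ^ 'd"
    show "(x, y) \<in> {(u, v). 0 < symmetric_part p (v - u)}\<^sup>*"
    proof (cases "x = y")
      case False
      then have "0 < symmetric_part p (y - x)"
        unfolding symmetric_part_def by (intro divide_pos_pos add_pos_pos p_pos) auto
      then show ?thesis by (intro r_into_rtrancl) simp
    qed simp
  qed
qed

lemma variance_laplace_nonneg: "0 \<le> variance_laplace M X f l"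
  unfolding variance_laplace_def additive_variance_def set_lebesgue_integral_def
  by (intro integral_nonneg_AE AE_I2) (auto simp: indicator_def)

theorem theorem2p4:
  fixes \<alpha> \<rho> c :: real
    and p pFR :: "int ^ 'd \<Rightarrow> real"
    and f :: "'d config \<Rightarrow> real"
    and M :: "'v measure" and X :: "real \<Rightarrow> 'v \<Rightarrow> 'd config"
    and M' :: "'w measure" and Y :: "real \<Rightarrow> 'w \<Rightarrow> 'd config"
  assumes "2 < \<alpha>" and "0 < \<rho>" and "\<rho> < 1"
    and "LA_jump_probability \<alpha> p"
    and "FR_jump_probability pFR" and "irreducible_jumps (symmetric_part pFR)"
    and "c \<noteq> 0" and "mean_jump p = c *\<^sub>R mean_jump pFR"
    and "local_function f" and "(LINT \<eta>|bernoulli_product \<rho>. f \<eta>) = 0"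
    and "exclusion_process p (bernoulli_product \<rho>) M X"
    and "exclusion_process pFR (bernoulli_product \<rho>) M' Y"
  shows "comparable_at_0 (variance_laplace M X f) (variance_laplace M' Y f)"
proof -
  interpret exchangeable "bernoulli_product \<rho> :: ('d config) measure"
    by (rule exchangeable_bernoulli)
  note c = \<open>c \<noteq> 0\<close> and f = \<open>local_function f\<close>
  have p: "jump_probability p" "second_moment p" "coercive p"
    using \<open>LA_jump_probability \<alpha> p\<close> LA_second_moment[OF \<open>LA_jump_probability \<alpha> p\<close> \<open>2 < \<alpha>\<close>]
      irreducible_coercive[OF _ LA_irreducible[OF \<open>LA_jump_probability \<alpha> p\<close>]]
    by (simp_all add: LA_jump_probability_def)
  have r: "jump_probability pFR" "second_moment pFR" "coercive pFR"
    using \<open>FR_jump_probability pFR\<close> FR_second_moment[OF \<open>FR_jump_probability pFR\<close>]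
      irreducible_coercive[OF _ \<open>irreducible_jumps (symmetric_part pFR)\<close>]
    by (simp_all add: FR_jump_probability_def)
  have dense: "resolvent_dense q l" if "jump_probability q" "second_moment q" "0 < l" for q :: "int ^ 'd \<Rightarrow> real" and l
    by (rule resolvent_dense[OF that(1) second_moment_first_moment[OF that(1,2)] that(3)])
  have rev: "resolvent_dense (reversed q) l" if "jump_probability q" "second_moment q" "0 < l" for q :: "int ^ 'd \<Rightarrow> real" and l
    by (rule dense[OF jump_probability_reversed[OF that(1)] second_moment_reversed[OF that(2)] that(3)])
  have mean_r: "((\<lambda>y. pFR y * real_of_int (y $ i)) has_sum mean_jump pFR $ i) UNIV" for i
    by (rule mean_jump_has_sum[OF r(1,2)])
  have mean_p: "((\<lambda>y. p y * real_of_int (y $ i)) has_sum mean_jump p $ i) UNIV" for i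
    by (rule mean_jump_has_sum[OF p(1,2)])
  have mean: "((\<lambda>y. p y * real_of_int (y $ i)) has_sum c * mean_jump pFR $ i) UNIV" for i
    using mean_p[of i] by (simp add: \<open>mean_jump p = c *\<^sub>R mean_jump pFR\<close>)
  \<comment> \<open>Solved for the finite-range mean, the hypothesis has the same shape with the
    factor \<open>1 / c\<close>, so the comparison applies in the opposite direction too.\<close>
  have mean': "((\<lambda>y. pFR y * real_of_int (y $ i)) has_sum (1 / c) * mean_jump p $ i) UNIV" for i
    using mean_r[of i] c by (simp add: \<open>mean_jump p = c *\<^sub>R mean_jump pFR\<close>)
  obtain S where S: "exclusion_semigroup p S" "\<And>l. 0 < l \<Longrightarrow> variance_laplace M X f l
      = 2 / l\<^sup>2 * laplace l (\<lambda>t. expectation (\<lambda>\<eta>. f \<eta> * apply_bcontfun (S t (Bcontfun f)) \<eta>))"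
    using variance_laplace_eq[OF \<open>exclusion_process p (bernoulli_product \<rho>) M X\<close> p(1) dense[OF p(1,2)] f] by blast
  obtain S' where S': "exclusion_semigroup pFR S'" "\<And>l. 0 < l \<Longrightarrow> variance_laplace M' Y f l
      = 2 / l\<^sup>2 * laplace l (\<lambda>t. expectation (\<lambda>\<eta>. f \<eta> * apply_bcontfun (S' t (Bcontfun f)) \<eta>))"
    using variance_laplace_eq[OF \<open>exclusion_process pFR (bernoulli_product \<rho>) M' Y\<close> r(1) dense[OF r(1,2)] f] by blast
  obtain K where K: "0 < K" "\<And>l. 0 < l \<Longrightarrow>
      laplace l (\<lambda>t. expectation (\<lambda>\<eta>. f \<eta> * apply_bcontfun (S' t (Bcontfun f)) \<eta>))
      \<le> K * laplace l (\<lambda>t. expectation (\<lambda>\<eta>. f \<eta> * apply_bcontfun (S t (Bcontfun f)) \<eta>))"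
    using laplace_compare[OF p dense[OF p(1,2)] rev[OF p(1,2)] r dense[OF r(1,2)] c mean mean_r S(1) S'(1) f] by blast
  have c': "1 / c \<noteq> 0" using c by simp
  obtain K' where K': "0 < K'" "\<And>l. 0 < l \<Longrightarrow>
      laplace l (\<lambda>t. expectation (\<lambda>\<eta>. f \<eta> * apply_bcontfun (S t (Bcontfun f)) \<eta>))
      \<le> K' * laplace l (\<lambda>t. expectation (\<lambda>\<eta>. f \<eta> * apply_bcontfun (S' t (Bcontfun f)) \<eta>))"
    using laplace_compare[OF r dense[OF r(1,2)] rev[OF r(1,2)] p dense[OF p(1,2)] c' mean' mean_p S'(1) S(1) f] by blast
  let ?a = "variance_laplace M X f" and ?b = "variance_laplace M' Y f"
  have le: "?b l \<le> K * ?a l" "?a l \<le> K' * ?b l" if l: "0 < l" for l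
    using mult_left_mono[OF K(2)[OF l], of "2 / l\<^sup>2"] mult_left_mono[OF K'(2)[OF l], of "2 / l\<^sup>2"]
    unfolding S(2)[OF l] S'(2)[OF l] by (simp_all add: mult.left_commute)
  \<comment> \<open>A common constant for both directions; enlarging the constants is harmless since
    both transforms are nonnegative.\<close>
  define D where "D = max K K'"
  have D: "0 < D" "K \<le> D" "K' \<le> D" using K(1) by (auto simp: D_def)
  have "inverse D * ?b l \<le> ?a l \<and> ?a l \<le> D * ?b l" if l: "0 < l" for l
  proof
    have "?b l \<le> D * ?a l"
      using le(1)[OF l] mult_right_mono[OF D(2) variance_laplace_nonneg[of M X f l]] by linarith
    then show "inverse D * ?b l \<le> ?a l" using D(1) by (simp add: field_simps)
    show "?a l \<le> D * ?b l"
      using le(2)[OF l] mult_right_mono[OF D(3) variance_laplace_nonneg[of M' Y f l]] by linarith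
  qed
  then have "\<forall>\<^sub>F l in at_right 0. inverse D * ?b l \<le> ?a l \<and> ?a l \<le> D * ?b l"
    by (intro eventually_at_right_less[THEN eventually_mono])
  then show ?thesis unfolding comparable_at_0_def using D(1) by blast
qed

end
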